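(* Let $I \subset S$ be a bihomogeneous ideal and let $(a,b) \in \operatorname{x-reg}(I) \cap (\mathbb{Z}_{>0}\times\mathbb{Z}_{\geq 0})$. If $(a',b') \geq (a+1, b)$, then there is no minimal generator of $\operatorname{bigin}(I)$ of bidegree $(a',b')$.
   Context: Let $\mathbf{k}$ be a field of characteristic $0$ and $S=\mathbf{k}[x_0,\dots,x_n,y_0,\dots,y_m]$ with the standard $\mathbb{Z}^2$-grading $\deg(x_i)=(1,0)$, $\deg(y_j)=(0,1)$. An ideal of $S$ is bihomogeneous if it is generated by bihomogeneous polynomials. For pairs in $\mathbb{Z}^2$, $(a',b')\geq(a,b)$ means $a'\geq a$ and $b'\geq b$. Let $\mathfrak{m}_x=(x_0,\dots,x_n)$, and let $H^i_{\mathfrak{m}_x}$ denote local cohomology with respect to $\mathfrak{m}_x$. The partial regularity region $\operatorname{x-reg}(I)$ is the set of $(a,b)\in\mathbb{Z}^2$ such that for all $i\geq 1$ and all $(a',b')\geq(a-i+1,b)$ one has $H^i_{\mathfrak{m}_x}(I)_{(a',b')}=0$. Monomial order: the degree reverse lexicographical order with $x_0<\dots<x_n<y_0<\dots<y_m$, so that for two monomials of the same bidegree, $x^{\alpha}y^{\beta}<x^{\alpha'}y^{\beta'}$ iff the leftmost nonzero entry of $(\alpha'-\alpha,\beta'-\beta)=(\alpha'_0-\alpha_0,\dots,\alpha'_n-\alpha_n,\beta'_0-\beta_0,\dots,\beta'_m-\beta_m)$ is negative. $\operatorname{in}(I)$ is the ideal generated by the leading monomials of the elements of $I$. A block-diagonal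 matrix $u=(u^x,u^y)\in \mathrm{GL}(n+1)\times\mathrm{GL}(m+1)$ acts on $S$ by $x_i\mapsto\sum_j u^x_{ij}x_j$, $y_i\mapsto\sum_j u^y_{ij}y_j$; $u\circ I$ is the image of $I$. The bigeneric initial ideal $\operatorname{bigin}(I)$ is the monomial ideal such that $\operatorname{in}(u\circ I)=\operatorname{bigin}(I)$ for all $u$ in a nonempty Zariski open subset of $\mathrm{GL}(n+1)\times\mathrm{GL}(m+1)$ (it is known to exist). *)

theory Defs
  imports
    "HOL-Library.Poly_Mapping"
    "HOL-Computational_Algebra.Fraction_Field"
    "HOL-Algebra.Ideal"
    "Jordan_Normal_Form.Matrix"
begin

section \<open>The bigraded polynomial ring\<close>

text \<open>
  The variables of \<open>S = k[x\<^sub>0,\<dots>,x\<^sub>n,y\<^sub>0,\<dots>,y\<^sub>m]\<close> are indexed by the natural numbers up to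
  \<open>n + m + 1\<close>: index \<open>i \<le> n\<close> stands for \<open>x\<^sub>i\<close> and index \<open>n + 1 + j\<close> with \<open>j \<le> m\<close> for \<open>y\<^sub>j\<close>.
  A monomial is given by its exponent vector.
\<close>

type_synonym expo = "nat \<Rightarrow>\<^sub>0 nat"
type_synonym 'a mpol = "expo \<Rightarrow>\<^sub>0 'a"

definition expos :: "nat \<Rightarrow> nat \<Rightarrow> expo set" where
  "expos n m = {t. Poly_Mapping.keys t \<subseteq> {..n + m + 1}}"

definition monom_of :: "expo \<Rightarrow> 'a::comm_ring_1 mpol" where
  "monom_of t = Poly_Mapping.single t 1"

definition var :: "nat \<Rightarrow> 'a::comm_ring_1 mpol" where
  "var k = monom_of (Poly_Mapping.single k 1)"

definition bi_ring :: "nat \<Rightarrow> nat \<Rightarrow> 'a::comm_ring_1 mpol ring" where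
  "bi_ring n m =
    \<lparr>carrier = {p. Poly_Mapping.keys p \<subseteq> expos n m}, monoid.mult = (*), one = 1, zero = 0, add = (+)\<rparr>"

definition xdeg :: "nat \<Rightarrow> expo \<Rightarrow> nat" where
  "xdeg n t = (\<Sum>i\<le>n. Poly_Mapping.lookup t i)"

definition ydeg :: "nat \<Rightarrow> nat \<Rightarrow> expo \<Rightarrow> nat" where
  "ydeg n m t = (\<Sum>j\<le>m. Poly_Mapping.lookup t (n + 1 + j))"

definition bideg :: "nat \<Rightarrow> nat \<Rightarrow> expo \<Rightarrow> int \<times> int" where
  "bideg n m t = (int (xdeg n t), int (ydeg n m t))"

text \<open>\<open>S\<^sub>(\<^sub>a\<^sub>,\<^sub>b\<^sub>)\<close>; it contains 0 for all \<open>(a,b)\<close>, and nothing else if \<open>a < 0\<close> or \<open>b < 0\<close>.\<close>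

definition bihom_part :: "nat \<Rightarrow> nat \<Rightarrow> int \<times> int \<Rightarrow> 'a::comm_ring_1 mpol set" where
  "bihom_part n m d =
    {p \<in> carrier (bi_ring n m). \<forall>t \<in> Poly_Mapping.keys p. bideg n m t = d}"

definition bihom_ideal :: "nat \<Rightarrow> nat \<Rightarrow> 'a::comm_ring_1 mpol set \<Rightarrow> bool" where
  "bihom_ideal n m I \<longleftrightarrow>
    (\<exists>B \<subseteq> (\<Union>d. bihom_part n m d). I = genideal (bi_ring n m) B)"


section \<open>Local cohomology and the partial regularity region\<close>

text \<open>
  Local cohomology with respect to \<open>(x\<^sub>0,\<dots>,x\<^sub>n)\<close> is the cohomology of the Cech complex on
  \<open>x\<^sub>0,\<dots>,x\<^sub>n\<close>, whose term in cohomological degree \<open>p\<close> is the direct sum of the localizations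
  \<open>I[1/x\<^sub>\<sigma>]\<close>, \<open>x\<^sub>\<sigma> = (\<Prod>i\<in>\<sigma>. x\<^sub>i)\<close>, over the \<open>p\<close>-element subsets \<open>\<sigma>\<close> of \<open>{0,\<dots>,n}\<close>. As \<open>S\<close> is a
  domain and \<open>I\<close> is an ideal, these localizations are submodules of the fraction field, and the
  localization maps are inclusions. The complex is bigraded, so the component of its cohomology
  in bidegree \<open>(a,b)\<close> is the cohomology of its component in bidegree \<open>(a,b)\<close>. For bihomogeneous
  \<open>I\<close>, the elements of bidegree \<open>(a,b)\<close> of \<open>I[1/x\<^sub>\<sigma>]\<close> are the fractions \<open>f / x\<^sub>\<sigma>^N\<close> with \<open>f\<close> in \<open>I\<close> of
  bidegree \<open>(a + N * card \<sigma>, b)\<close>.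
\<close>

definition loc_part ::
  "nat \<Rightarrow> nat \<Rightarrow> 'a::idom mpol set \<Rightarrow> int \<times> int \<Rightarrow> nat set \<Rightarrow> 'a mpol fract set" where
  "loc_part n m I d \<sigma> =
    {Fraction_Field.Fract f ((\<Prod>i\<in>\<sigma>. var i) ^ N) | f N.
       f \<in> I \<inter> bihom_part n m (fst d + int (N * card \<sigma>), snd d)}"

definition cech_index :: "nat \<Rightarrow> nat \<Rightarrow> nat set set" where
  "cech_index n p = {\<sigma>. \<sigma> \<subseteq> {..n} \<and> card \<sigma> = p}"

text \<open>Cochains are families indexed by sets, extended by zero outside the index set.\<close>

definition cech_cochains ::
  "nat \<Rightarrow> nat \<Rightarrow> 'a::idom mpol set \<Rightarrow> int \<times> int \<Rightarrow> nat \<Rightarrow> (nat set \<Rightarrow> 'a mpol fract) set" where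
  "cech_cochains n m I d p =
    {c. (\<forall>\<sigma> \<in> cech_index n p. c \<sigma> \<in> loc_part n m I d \<sigma>) \<and> (\<forall>\<sigma>. \<sigma> \<notin> cech_index n p \<longrightarrow> c \<sigma> = 0)}"

definition cech_diff ::
  "nat \<Rightarrow> nat \<Rightarrow> (nat set \<Rightarrow> 'a::idom mpol fract) \<Rightarrow> nat set \<Rightarrow> 'a mpol fract" where
  "cech_diff n p c \<sigma> =
    (if \<sigma> \<in> cech_index n (Suc p) then \<Sum>i\<in>\<sigma>. (- 1) ^ card {j \<in> \<sigma>. j < i} * c (\<sigma> - {i}) else 0)"

definition cech_cocycles ::
  "nat \<Rightarrow> nat \<Rightarrow> 'a::idom mpol set \<Rightarrow> int \<times> int \<Rightarrow> nat \<Rightarrow> (nat set \<Rightarrow> 'a mpol fract) set" where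
  "cech_cocycles n m I d p = {c \<in> cech_cochains n m I d p. cech_diff n p c = (\<lambda>\<sigma>. 0)}"

definition cech_coboundaries ::
  "nat \<Rightarrow> nat \<Rightarrow> 'a::idom mpol set \<Rightarrow> int \<times> int \<Rightarrow> nat \<Rightarrow> (nat set \<Rightarrow> 'a mpol fract) set" where
  "cech_coboundaries n m I d p =
    (case p of 0 \<Rightarrow> {\<lambda>\<sigma>. 0} | Suc q \<Rightarrow> cech_diff n q ` cech_cochains n m I d q)"

text \<open>The component in bidegree \<open>d\<close> of the local cohomology module in cohomological degree \<open>p\<close>.\<close>

definition local_cohomology ::
  "nat \<Rightarrow> nat \<Rightarrow> 'a::idom mpol set \<Rightarrow> nat \<Rightarrow> int \<times> int \<Rightarrow> (nat set \<Rightarrow> 'a mpol fract) set set" where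
  "local_cohomology n m I p d =
    cech_cocycles n m I d p //
      {(c, c'). c \<in> cech_cocycles n m I d p \<and> c' \<in> cech_cocycles n m I d p \<and>
                (\<lambda>\<sigma>. c \<sigma> - c' \<sigma>) \<in> cech_coboundaries n m I d p}"

text \<open>The quotient is zero iff the class of 0, i.e. the set of coboundaries, is its only element.\<close>

definition x_reg :: "nat \<Rightarrow> nat \<Rightarrow> 'a::idom mpol set \<Rightarrow> (int \<times> int) set" where
  "x_reg n m I =
    {(a, b). \<forall>i\<ge>1. \<forall>a' b'. a' \<ge> a - int i + 1 \<and> b' \<ge> b \<longrightarrow>
       local_cohomology n m I i (a', b') = {cech_coboundaries n m I (a', b') i}}"


section \<open>Initial ideals\<close>

text \<open>
  Degree reverse lexicographical order with \<open>x\<^sub>0 < \<dots> < x\<^sub>n < y\<^sub>0 < \<dots> < y\<^sub>m\<close>; among monomials of the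
  same degree, \<open>s\<close> is smaller than \<open>t\<close> iff the leftmost nonzero entry of \<open>t - s\<close> is negative.
\<close>

definition drl_less :: "nat \<Rightarrow> nat \<Rightarrow> expo \<Rightarrow> expo \<Rightarrow> bool" where
  "drl_less n m s t \<longleftrightarrow>
    (let deg = (\<lambda>u. xdeg n u + ydeg n m u) in
      deg s < deg t \<or>
      deg s = deg t \<and>
        (\<exists>k. Poly_Mapping.lookup t k < Poly_Mapping.lookup s k \<and>
             (\<forall>j<k. Poly_Mapping.lookup t j = Poly_Mapping.lookup s j)))"

definition is_lead_monom :: "nat \<Rightarrow> nat \<Rightarrow> 'a::comm_ring_1 mpol \<Rightarrow> expo \<Rightarrow> bool" where
  "is_lead_monom n m f t \<longleftrightarrow>
    t \<in> Poly_Mapping.keys f \<and> (\<forall>s \<in> Poly_Mapping.keys f. s \<noteq> t \<longrightarrow> drl_less n m s t)"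

definition initial_ideal :: "nat \<Rightarrow> nat \<Rightarrow> 'a::comm_ring_1 mpol set \<Rightarrow> 'a mpol set" where
  "initial_ideal n m I =
    genideal (bi_ring n m) {monom_of t | t. \<exists>f\<in>I. is_lead_monom n m f t}"


section \<open>Linear coordinate changes and the bigeneric initial ideal\<close>

text \<open>Substitution of \<open>g v\<close> for each variable \<open>v\<close>, with coefficients mapped by \<open>c\<close>.\<close>

definition subst_poly ::
  "('a::comm_ring_1 \<Rightarrow> 'b::comm_ring_1) \<Rightarrow> ('v \<Rightarrow> 'b) \<Rightarrow> (('v \<Rightarrow>\<^sub>0 nat) \<Rightarrow>\<^sub>0 'a) \<Rightarrow> 'b" where
  "subst_poly c g p =
    (\<Sum>t \<in> Poly_Mapping.keys p. c (Poly_Mapping.lookup p t) *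
       (\<Prod>v \<in> Poly_Mapping.keys t. g v ^ Poly_Mapping.lookup t v))"

definition block_GL :: "nat \<Rightarrow> nat \<Rightarrow> ('a::field mat \<times> 'a mat) set" where
  "block_GL n m =
    {A \<in> carrier_mat (n + 1) (n + 1). invertible_mat A} \<times>
    {B \<in> carrier_mat (m + 1) (m + 1). invertible_mat B}"

definition lin_form :: "nat \<Rightarrow> nat \<Rightarrow> 'a::field mat \<times> 'a mat \<Rightarrow> nat \<Rightarrow> 'a mpol" where
  "lin_form n m u k =
    (if k \<le> n
     then \<Sum>j\<le>n. Poly_Mapping.single 0 (fst u $$ (k, j)) * var j
     else \<Sum>j\<le>m. Poly_Mapping.single 0 (snd u $$ (k - (n + 1), j)) * var (n + 1 + j))"

definition act :: "nat \<Rightarrow> nat \<Rightarrow> 'a::field mat \<times> 'a mat \<Rightarrow> 'a mpol \<Rightarrow> 'a mpol" where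
  "act n m u = subst_poly (Poly_Mapping.single 0) (lin_form n m u)"

text \<open>
  Regular functions on pairs of matrices are given by polynomials in the indeterminates
  \<open>Inl (i,j)\<close> and \<open>Inr (i,j)\<close>, standing for the entries of the first and of the second matrix.
\<close>

definition entry_inds :: "nat \<Rightarrow> nat \<Rightarrow> (nat \<times> nat + nat \<times> nat) set" where
  "entry_inds n m = ({..n} \<times> {..n}) <+> ({..m} \<times> {..m})"

definition eval_entries ::
  "((nat \<times> nat + nat \<times> nat \<Rightarrow>\<^sub>0 nat) \<Rightarrow>\<^sub>0 'a) \<Rightarrow> 'a::field mat \<times> 'a mat \<Rightarrow> 'a" where
  "eval_entries p u =
    subst_poly id (case_sum (\<lambda>ij. fst u $$ ij) (\<lambda>ij. snd u $$ ij)) p"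

definition zariski_open :: "nat \<Rightarrow> nat \<Rightarrow> ('a::field mat \<times> 'a mat) set \<Rightarrow> bool" where
  "zariski_open n m U \<longleftrightarrow>
    (\<exists>F. (\<forall>p\<in>F. \<forall>t \<in> Poly_Mapping.keys p. Poly_Mapping.keys t \<subseteq> entry_inds n m) \<and>
         U = {u \<in> block_GL n m. \<exists>p\<in>F. eval_entries p u \<noteq> 0})"

text \<open>
  Over an infinite field any two nonempty open sets meet, so at most one \<open>J\<close> satisfies this.
\<close>

definition is_bigin :: "nat \<Rightarrow> nat \<Rightarrow> 'a::field mpol set \<Rightarrow> 'a mpol set \<Rightarrow> bool" where
  "is_bigin n m I J \<longleftrightarrow>
    (\<exists>U. zariski_open n m U \<and> U \<noteq> {} \<and> (\<forall>u\<in>U. initial_ideal n m (act n m u ` I) = J))"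

definition min_monom_gens :: "nat \<Rightarrow> nat \<Rightarrow> 'a::comm_ring_1 mpol set \<Rightarrow> expo set \<Rightarrow> bool" where
  "min_monom_gens n m J G \<longleftrightarrow>
    G \<subseteq> expos n m \<and> genideal (bi_ring n m) (monom_of ` G) = J \<and>
    (\<forall>G'. G' \<subset> G \<longrightarrow> genideal (bi_ring n m) (monom_of ` G') \<noteq> J)"

definition is_minimal_generator :: "nat \<Rightarrow> nat \<Rightarrow> 'a::comm_ring_1 mpol set \<Rightarrow> expo \<Rightarrow> bool" where
  "is_minimal_generator n m J t \<longleftrightarrow> (\<exists>G. min_monom_gens n m J G \<and> t \<in> G)"

end

theory Submission
  imports Defs "Jordan_Normal_Form.Determinant"
begin

text \<open>
  Let \<open>t\<close> be a minimal generator of \<open>bigin(I)\<close> of bidegree \<open>(a',b')\<close>, and let \<open>bigin(I) = in(K)\<close> with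
  \<open>K = u \<circ> I\<close>. As \<open>a' > 0\<close>, some \<open>x\<^sub>i\<close> divides \<open>t\<close>; let \<open>i\<close> be the least such index and \<open>t = x\<^sub>i t'\<close>.
  Let \<open>f\<close> in \<open>K\<close> be bihomogeneous with leading monomial \<open>t\<close>. In the reverse lexicographical order every
  monomial of \<open>f\<close> is divisible by \<open>x\<^sub>i\<close> or lies in \<open>(x\<^sub>0,\<dots>,x\<^bsub>i-1\<^esub>)\<close>, so that \<open>f\<close> is \<open>x\<^sub>i h\<close> modulo
  \<open>(x\<^sub>0,\<dots>,x\<^bsub>i-1\<^esub>)\<close>, where \<open>h\<close> has leading monomial \<open>t'\<close>. If
    \<open>((K,x\<^sub>0,\<dots>,x\<^bsub>i-1\<^esub>) : x\<^sub>i) = (K,x\<^sub>0,\<dots>,x\<^bsub>i-1\<^esub>)\<close> in bidegree \<open>(a'-1,b')\<close>,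
  then \<open>h\<close> is congruent modulo \<open>(x\<^sub>0,\<dots>,x\<^bsub>i-1\<^esub>)\<close> to an element of \<open>K\<close>, whose leading monomial is again
  \<open>t'\<close>; so \<open>t'\<close> lies in \<open>in(K)\<close> and \<open>t\<close> is not minimal. This is \<open>revlex_colon\<close>.

  Pulled back along \<open>u\<close>, the condition speaks of \<open>I\<close> and the linear forms \<open>l\<^sub>i = u\<^sup>-\<^sup>1 x\<^sub>i\<close>. Suppose that each
  \<open>l\<^sub>i\<close> is filter-regular on \<open>I\<^sub>i = (I,l\<^sub>0,\<dots>,l\<^bsub>i-1\<^esub>)\<close>, that is, a nonzerodivisor modulo \<open>I\<^sub>i\<close> up to
  \<open>(x\<^sub>0,\<dots>,x\<^sub>n)\<close>-torsion. Then the exact sequences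
    \<open>0 \<longrightarrow> S/(I\<^sub>i : l\<^sub>i)(-1,0) \<longrightarrow> S/I\<^sub>i \<longrightarrow> S/I\<^bsub>i+1\<^esub> \<longrightarrow> 0\<close>
  carry the vanishing of local cohomology from \<open>S/I\<^sub>i\<close> to \<open>S/I\<^bsub>i+1\<^esub>\<close> at the cost of one cohomological
  degree (\<open>kvanish_adjoin\<close>). It begins with \<open>H\<^sup>p(S/I)\<close>, \<open>p \<le> n\<close>, which embeds into \<open>H\<^bsup>p+1\<^esup>(I)\<close> because
  \<open>H\<^sup>p(S) = 0\<close> (\<open>kvanish_of_local_cohomology\<close>), and ends with \<open>H\<^sup>0(S/I\<^sub>i) = 0\<close> in bidegree \<open>(a'-1,b')\<close> for
  all \<open>i \<le> n\<close>. Together with filter-regularity this is the colon condition (\<open>generic_colon\<close>).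

  Filter-regular forms exist because a linear form only has to avoid finitely many ideals
  (\<open>filter_regular_avoid\<close>, a Noetherian induction). The rows of \<open>u\<^sup>-\<^sup>1\<close> are chosen one after the other on
  lines in the space of matrices. On a line through a matrix whose inverse lies in the given nonempty open
  set, all but finitely many points have this property, so that \<open>u\<close> can be found in the open set on which
  \<open>in(u \<circ> I)\<close> is \<open>bigin(I)\<close> (\<open>inverse_rows_line_open\<close>, \<open>filter_regular_rows_exist\<close>).
\<close>

section \<open>Polynomials and their monomials\<close>

abbreviation lookup where "lookup \<equiv> Poly_Mapping.lookup"
abbreviation keys where "keys \<equiv> Poly_Mapping.keys"
abbreviation single where "single \<equiv> Poly_Mapping.single"

lemma monom_expansion:
  fixes p :: "'b \<Rightarrow>\<^sub>0 'c::comm_monoid_add"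
  shows "p = (\<Sum>t\<in>keys p. single t (lookup p t))"
proof (rule poly_mapping_eqI)
  fix k
  have "lookup (\<Sum>t\<in>keys p. single t (lookup p t)) k = (\<Sum>t\<in>keys p. lookup p t when t = k)"
    by (simp add: lookup_sum lookup_single)
  also have "\<dots> = (\<Sum>t\<in>keys p. if t = k then lookup p k else 0)"
    by (rule sum.cong) (auto simp: when_def)
  also have "\<dots> = lookup p k" by (auto simp: in_keys_iff)
  finally show "lookup p k = lookup (\<Sum>t\<in>keys p. single t (lookup p t)) k" by simp
qed

lemma mpol_induct [case_names zero monom add]:
  fixes p :: "'b \<Rightarrow>\<^sub>0 'c::comm_monoid_add"
  assumes "P 0" and "\<And>t c. t \<in> keys p \<Longrightarrow> P (single t c)"
    and "\<And>q r. P q \<Longrightarrow> P r \<Longrightarrow> P (q + r)"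
  shows "P p"
proof -
  have "P (\<Sum>t\<in>A. single t (lookup p t))" if "A \<subseteq> keys p" for A
    using finite_subset[OF that finite_keys] that
    by (induction A rule: finite_induct) (auto intro: assms)
  then show ?thesis using monom_expansion[of p] by (metis order_refl)
qed

definition part :: "('b \<Rightarrow> bool) \<Rightarrow> ('b \<Rightarrow>\<^sub>0 'c::zero) \<Rightarrow> ('b \<Rightarrow>\<^sub>0 'c)" where
  "part P p = Abs_poly_mapping (\<lambda>t. lookup p t when P t)"

lemma lookup_part: "lookup (part P p) t = (lookup p t when P t)"
proof -
  have "{x. (lookup p x when P x) \<noteq> 0} \<subseteq> keys p" by (auto simp: in_keys_iff)
  then have "finite {x. (lookup p x when P x) \<noteq> 0}" using finite_subset finite_keys by blast
  then show ?thesis by (simp add: part_def)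
qed

lemma keys_part: "keys (part P p) = {t \<in> keys p. P t}"
  by (auto simp: in_keys_iff lookup_part)

lemma part_add: "part P (p + q) = part P p + part P (q :: _ \<Rightarrow>\<^sub>0 'c::comm_monoid_add)"
  by (rule poly_mapping_eqI) (simp add: lookup_part lookup_add when_add_distrib)

lemma part_zero [simp]: "part P 0 = 0"
  by (rule poly_mapping_eqI) (simp add: lookup_part)

lemma part_id: "(\<And>t. t \<in> keys p \<Longrightarrow> P t) \<Longrightarrow> part P p = p"
  by (rule poly_mapping_eqI) (auto simp: lookup_part when_def in_keys_iff)

lemma single_eq_monom: "single t c = single 0 c * (monom_of t :: 'a::comm_ring_1 mpol)"
  by (simp add: monom_of_def mult_single)

lemma lookup_single_mult:
  fixes p :: "expo \<Rightarrow>\<^sub>0 'a::comm_ring_1"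
  shows "lookup (single e c * p) (e + t) = c * lookup p t"
proof -
  have "lookup (single e c * p) (e + t) = (\<Sum>l. lookup (single e c) l * (\<Sum>q. lookup p q when e + t = l + q))"
    by (rule lookup_mult)
  also have "\<dots> = (\<Sum>l. (c * (\<Sum>q. lookup p q when e + t = e + q)) when l = e)"
    by (rule Sum_any.cong) (auto simp: lookup_single when_def)
  also have "\<dots> = c * (\<Sum>q. lookup p q when e + t = e + q)"
    by (rule Sum_any_when_equal)
  also have "(\<Sum>q. lookup p q when e + t = e + q) = (\<Sum>q. lookup p q when q = t)"
    by (rule Sum_any.cong) (auto simp: when_def)
  finally show ?thesis by simp
qed

lemma lookup_single_mult_0:
  fixes p :: "expo \<Rightarrow>\<^sub>0 'a::comm_ring_1"
  assumes "\<And>s. t \<noteq> e + s"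
  shows "lookup (single e c * p) t = 0"
proof -
  have "t \<notin> keys (single e c * p)"
  proof
    assume "t \<in> keys (single e c * p)"
    with keys_mult[of "single e c" p] obtain a b where "a \<in> keys (single e c)" "t = a + b" by blast
    then show False using assms by (auto split: if_splits)
  qed
  then show ?thesis by (simp add: in_keys_iff)
qed

lemma var_power: "(var k ^ N :: 'a::comm_ring_1 mpol) = monom_of (single k N)"
  by (induction N) (auto simp: var_def monom_of_def mult_single single_add[symmetric] simp flip: single_one)

lemma single_le_iff: "(\<exists>s. t = single k N + s) \<longleftrightarrow> N \<le> lookup t (k::nat)" for t :: expo
proof
  assume "N \<le> lookup t k"
  then have "t = single k N + (t - single k N)"
    by (intro poly_mapping_eqI) (auto simp: lookup_add lookup_minus lookup_single when_def)
  then show "\<exists>s. t = single k N + s" by blast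
qed (auto simp: lookup_add)

text \<open>
  Division by \<open>x\<^sub>k^N\<close> that drops the monomials it does not divide. It is a left inverse of multiplication
  by \<open>x\<^sub>k^N\<close> and commutes with multiplication by the other variables; on these two properties rests the
  contraction of the Koszul complex along \<open>x\<^sub>k\<close>.
\<close>

definition quot :: "nat \<Rightarrow> nat \<Rightarrow> 'a::comm_ring_1 mpol \<Rightarrow> 'a mpol" where
  "quot k N p = Abs_poly_mapping (\<lambda>t. lookup p (single k N + t))"

lemma lookup_quot: "lookup (quot k N p) t = lookup p (single k N + t)"
proof -
  have "{t. lookup p (single k N + t) \<noteq> 0} = (\<lambda>t. single k N + t) -` keys p"
    by (auto simp: in_keys_iff)
  moreover have "finite ((\<lambda>t. single k N + t) -` keys p)"
    by (rule finite_vimageI) (auto simp: inj_on_def)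
  ultimately show ?thesis by (simp add: quot_def)
qed

lemma quot_add: "quot k N (p + q) = quot k N p + quot k N q"
  by (rule poly_mapping_eqI) (simp add: lookup_quot lookup_add)

lemma quot_zero [simp]: "quot k N 0 = 0"
  by (rule poly_mapping_eqI) (simp add: lookup_quot)

lemma quot_uminus: "quot k N (- p) = - quot k N p"
  by (rule poly_mapping_eqI) (simp add: lookup_quot)

lemma quot_sum: "quot k N (sum f A) = (\<Sum>i\<in>A. quot k N (f i))"
  by (induction A rule: infinite_finite_induct) (auto simp: quot_add)

lemma quot_sign: "quot k N ((- 1) ^ e * p) = (- 1) ^ e * quot k N p"
  by (induction e) (auto simp: quot_uminus)

lemma quot_var_power: "quot k N (var k ^ N * p) = p"
  by (rule poly_mapping_eqI) (simp add: lookup_quot var_power monom_of_def lookup_single_mult)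

lemma quot_var_power_commute:
  assumes "j \<noteq> k" shows "quot k N (var j ^ M * p) = var j ^ M * quot k N p"
proof (rule poly_mapping_eqI)
  fix t
  show "lookup (quot k N (var j ^ M * p)) t = lookup (var j ^ M * quot k N p) t"
  proof (cases "\<exists>s. t = single j M + s")
    case True
    then obtain s where s: "t = single j M + s" by blast
    have "lookup (quot k N (var j ^ M * p)) t = lookup (single (single j M) 1 * p) (single j M + (single k N + s))"
      by (simp add: lookup_quot var_power monom_of_def s ac_simps)
    also have "\<dots> = lookup p (single k N + s)" by (simp only: lookup_single_mult) simp
    also have "\<dots> = lookup (var j ^ M * quot k N p) t"
      by (simp add: s var_power monom_of_def lookup_single_mult lookup_quot)
    finally show ?thesis .
  next
    case False
    then have "\<not> M \<le> lookup t j" by (simp add: single_le_iff)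
    then have "\<not> M \<le> lookup (single k N + t) j"
      using assms by (simp add: lookup_add lookup_single_not_eq)
    then have F2: "\<And>s. single k N + t \<noteq> single j M + s" by (metis single_le_iff)
    show ?thesis using False F2
      by (simp add: lookup_quot var_power monom_of_def lookup_single_mult_0)
  qed
qed

lemma keys_quot: "keys (quot k N p) = {t. single k N + t \<in> keys p}"
  by (auto simp: in_keys_iff lookup_quot)

lemma var_power_mult_quot:
  assumes "\<And>t. t \<in> keys p \<Longrightarrow> N \<le> lookup t k"
  shows "var k ^ N * quot k N p = p"
proof (rule poly_mapping_eqI)
  fix t
  show "lookup (var k ^ N * quot k N p) t = lookup p t"
  proof (cases "N \<le> lookup t k")
    case True
    then obtain s where "t = single k N + s" using single_le_iff by blast
    then show ?thesis by (simp add: var_power monom_of_def lookup_single_mult lookup_quot)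
  next
    case False
    then have "\<And>s. t \<noteq> single k N + s" using single_le_iff by blast
    moreover have "t \<notin> keys p" using False assms by blast
    ultimately show ?thesis by (simp add: var_power monom_of_def lookup_single_mult_0 in_keys_iff)
  qed
qed

section \<open>Bihomogeneous ideals\<close>

locale bigraded =
  fixes n m :: nat
begin

abbreviation S :: "'a::comm_ring_1 mpol set" where "S \<equiv> carrier (bi_ring n m)"
abbreviation H :: "int \<times> int \<Rightarrow> 'a::comm_ring_1 mpol set" where "H \<equiv> bihom_part n m"
abbreviation poly_ideal :: "'a::comm_ring_1 mpol set \<Rightarrow> bool" where
  "poly_ideal I \<equiv> ideal I (bi_ring n m)"

lemma S_iff: "p \<in> S \<longleftrightarrow> keys p \<subseteq> expos n m"
  by (simp add: bi_ring_def)

lemma bi_ring_simps [simp]: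
  "x \<otimes>\<^bsub>bi_ring n m\<^esub> y = x * y" "x \<oplus>\<^bsub>bi_ring n m\<^esub> y = x + y"
  "\<one>\<^bsub>bi_ring n m\<^esub> = 1" "\<zero>\<^bsub>bi_ring n m\<^esub> = 0"
  by (simp_all add: bi_ring_def)

lemma expos_add: "s + t \<in> expos n m \<longleftrightarrow> s \<in> expos n m \<and> t \<in> expos n m"
proof -
  have "keys (s + t) = keys s \<union> keys t"
    by (auto simp: in_keys_iff lookup_add)
  then show ?thesis by (simp add: expos_def)
qed

lemma S_zero [simp]: "0 \<in> S" and S_one [simp]: "1 \<in> S"
  by (auto simp: S_iff expos_def)

lemma S_add: "p \<in> S \<Longrightarrow> q \<in> S \<Longrightarrow> p + q \<in> S"
  using keys_add[of p q] by (auto simp: S_iff)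

lemma S_mult: "p \<in> S \<Longrightarrow> q \<in> S \<Longrightarrow> p * q \<in> S"
  unfolding S_iff using keys_mult[of p q] expos_add by blast

lemma S_uminus: "p \<in> S \<Longrightarrow> - p \<in> S"
  by (simp add: S_iff)

lemma S_prod: "(\<And>i. i \<in> A \<Longrightarrow> f i \<in> S) \<Longrightarrow> prod f A \<in> S"
  by (induction A rule: infinite_finite_induct) (auto simp: S_mult)

lemma S_power: "p \<in> S \<Longrightarrow> p ^ N \<in> S"
  by (induction N) (auto simp: S_mult)

lemma S_single: "t \<in> expos n m \<Longrightarrow> single t c \<in> S"
  by (auto simp: S_iff)

lemma S_const [simp]: "single 0 c \<in> S"
  by (rule S_single) (simp add: expos_def)

lemma S_var: "k \<le> n + m + 1 \<Longrightarrow> var k \<in> S"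
  unfolding var_def monom_of_def by (rule S_single) (simp add: expos_def)

lemma S_part: "p \<in> S \<Longrightarrow> part P p \<in> S"
  by (auto simp: S_iff keys_part)

lemma S_quot: "p \<in> S \<Longrightarrow> quot k N p \<in> S"
  by (auto simp: S_iff keys_quot expos_add dest!: subsetD)

lemma cring_bi_ring: "cring (bi_ring n m :: 'a::comm_ring_1 mpol ring)"
proof (rule cringI)
  show "abelian_group (bi_ring n m :: 'a mpol ring)"
  proof (rule abelian_groupI, unfold bi_ring_simps)
    fix x :: "'a mpol" assume "x \<in> S"
    then show "\<exists>y\<in>S. y + x = 0"
      by (intro bexI[of _ "- x"] S_uminus) (rule left_minus)
  qed (rule S_add S_zero add.assoc add.commute add_0; assumption?)+
  show "Group.comm_monoid (bi_ring n m :: 'a mpol ring)"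
    by (rule comm_monoidI, unfold bi_ring_simps) (rule S_mult S_one mult.assoc mult.commute mult_1; assumption?)+
qed (unfold bi_ring_simps, rule distrib_right)

lemma ring_bi_ring: "ring (bi_ring n m :: 'a::comm_ring_1 mpol ring)"
  using cring_bi_ring by (rule cring.axioms(1))

lemma ideal_sub: "poly_ideal I \<Longrightarrow> p \<in> I \<Longrightarrow> p \<in> S"
  by (rule ideal.Icarr)

lemma ideal_zero: "poly_ideal I \<Longrightarrow> 0 \<in> I"
  using additive_subgroup.zero_closed[OF ideal.axioms(1), of I "bi_ring n m"] by simp

lemma ideal_add: "poly_ideal I \<Longrightarrow> p \<in> I \<Longrightarrow> q \<in> I \<Longrightarrow> p + q \<in> I"
  using additive_subgroup.a_closed[OF ideal.axioms(1), of I "bi_ring n m" p q] by simp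

lemma ideal_mult: "poly_ideal I \<Longrightarrow> s \<in> S \<Longrightarrow> p \<in> I \<Longrightarrow> s * p \<in> I"
  using ideal.I_l_closed[of I "bi_ring n m" p s] by simp

lemma poly_idealI:
  fixes I :: "'a::comm_ring_1 mpol set"
  assumes "I \<subseteq> S" "0 \<in> I" "\<And>p q. p \<in> I \<Longrightarrow> q \<in> I \<Longrightarrow> p + q \<in> I"
    "\<And>s p. s \<in> S \<Longrightarrow> p \<in> I \<Longrightarrow> s * p \<in> I"
  shows "poly_ideal I"
proof (rule idealI[OF ring_bi_ring])
  have um: "- p \<in> I" if "p \<in> I" for p using assms(4)[OF S_uminus[OF S_one] that] by simp
  have inv: "inv\<^bsub>add_monoid (bi_ring n m)\<^esub> p = - p" if "p \<in> S" for p :: "'a mpol"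
  proof -
    have "(- p) \<oplus>\<^bsub>bi_ring n m\<^esub> p = \<zero>\<^bsub>bi_ring n m\<^esub>" by simp
    from abelian_group.minus_equality[OF ring.is_abelian_group[OF ring_bi_ring] this that S_uminus[OF that]]
    show ?thesis by (simp add: a_inv_def)
  qed
  show "subgroup I (add_monoid (bi_ring n m))"
    by (rule subgroup.intro) (use assms(1-3) um inv in \<open>auto simp: subset_iff\<close>)
  fix a x :: "'a mpol" assume "a \<in> I" "x \<in> S"
  then have "x * a \<in> I" by (intro assms(4))
  then show "x \<otimes>\<^bsub>bi_ring n m\<^esub> a \<in> I" "a \<otimes>\<^bsub>bi_ring n m\<^esub> x \<in> I"
    by (simp_all add: mult.commute)
qed

lemma ideal_uminus: "poly_ideal I \<Longrightarrow> p \<in> I \<Longrightarrow> - p \<in> I"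
  using ideal_mult[OF _ S_uminus[OF S_one], of I p] by simp

lemma ideal_diff: "poly_ideal I \<Longrightarrow> p \<in> I \<Longrightarrow> q \<in> I \<Longrightarrow> p - q \<in> I"
  using ideal_add[OF _ _ ideal_uminus, of I p q] by simp

lemma ideal_sum: "poly_ideal I \<Longrightarrow> (\<And>i. i \<in> A \<Longrightarrow> f i \<in> I) \<Longrightarrow> sum f A \<in> I"
  by (induction A rule: infinite_finite_induct) (auto simp: ideal_add ideal_zero)

lemma xdeg_add: "xdeg n (s + t) = xdeg n s + xdeg n t"
  by (simp add: xdeg_def lookup_add sum.distrib)

lemma ydeg_add: "ydeg n m (s + t) = ydeg n m s + ydeg n m t"
  by (simp add: ydeg_def lookup_add sum.distrib)

lemma xdeg_single: "xdeg n (single k N) = (if k \<le> n then N else 0)"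
  by (simp add: xdeg_def lookup_single when_def)

lemma ydeg_single_x: "k \<le> n \<Longrightarrow> ydeg n m (single k N) = 0"
  by (simp add: ydeg_def lookup_single when_def)

lemma H_iff: "p \<in> H (a, b) \<longleftrightarrow> p \<in> S \<and> (\<forall>t\<in>keys p. int (xdeg n t) = a \<and> int (ydeg n m t) = b)"
  by (auto simp: bihom_part_def bideg_def)

lemma H_S: "p \<in> H d \<Longrightarrow> p \<in> S"
  by (simp add: bihom_part_def)

lemma H_zero [simp]: "0 \<in> H d"
  by (simp add: bihom_part_def)

lemma H_add: "p \<in> H d \<Longrightarrow> q \<in> H d \<Longrightarrow> p + q \<in> H d"
  using keys_add[of p q] by (auto simp: bihom_part_def S_add)

lemma H_uminus: "p \<in> H d \<Longrightarrow> - p \<in> H d"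
  by (auto simp: bihom_part_def S_uminus)

lemma H_diff: "p \<in> H d \<Longrightarrow> q \<in> H d \<Longrightarrow> p - q \<in> H d"
  using H_add[OF _ H_uminus, of p d q] by simp

lemma H_sum: "(\<And>i. i \<in> A \<Longrightarrow> f i \<in> H d) \<Longrightarrow> sum f A \<in> H d"
  by (induction A rule: infinite_finite_induct) (auto simp: H_add)

lemma H_sign: "p \<in> H d \<Longrightarrow> (- 1) ^ e * p \<in> H d"
  by (induction e) (auto simp: H_uminus)

lemma H_mult: "p \<in> H (a, b) \<Longrightarrow> q \<in> H (a', b') \<Longrightarrow> p * q \<in> H (a + a', b + b')"
proof -
  assume p: "p \<in> H (a, b)" and q: "q \<in> H (a', b')"
  have "int (xdeg n t) = a + a' \<and> int (ydeg n m t) = b + b'" if "t \<in> keys (p * q)" for t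
  proof -
    obtain u v where "t = u + v" "u \<in> keys p" "v \<in> keys q" using keys_mult[of p q] \<open>t \<in> keys (p * q)\<close> by blast
    then show ?thesis using p q by (auto simp: H_iff xdeg_add ydeg_add)
  qed
  with p q show ?thesis by (auto simp: H_iff S_mult)
qed

lemma H_one: "1 \<in> H (0, 0)"
  by (auto simp: H_iff xdeg_def ydeg_def)

lemma H_const: "single 0 c \<in> H (0, 0)"
  by (auto simp: H_iff xdeg_def ydeg_def)

lemma H_var_power: "k \<le> n \<Longrightarrow> var k ^ N \<in> H (int N, 0)"
  unfolding H_iff using S_power[OF S_var, of k N]
  by (auto simp: var_power monom_of_def xdeg_single ydeg_single_x)

lemma H_var_power_mult: "k \<le> n \<Longrightarrow> p \<in> H (a, b) \<Longrightarrow> var k ^ N * p \<in> H (a + int N, b)"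
  using H_mult[OF H_var_power, of k p a b N] by (simp add: add.commute)

lemma H_quot: "k \<le> n \<Longrightarrow> p \<in> H (a, b) \<Longrightarrow> quot k N p \<in> H (a - int N, b)"
  by (auto simp: H_iff S_quot keys_quot xdeg_add ydeg_add xdeg_single ydeg_single_x
      dest!: bspec[of _ _ "single k N + _"])

definition bicomp :: "int \<times> int \<Rightarrow> 'a::comm_ring_1 mpol \<Rightarrow> 'a mpol" where
  "bicomp d = part (\<lambda>t. bideg n m t = d)"

lemma bicomp_H: "p \<in> S \<Longrightarrow> bicomp d p \<in> H d"
  by (auto simp: bicomp_def bihom_part_def S_part keys_part)

lemma bicomp_id: "p \<in> H d \<Longrightarrow> bicomp d p = p"
  unfolding bicomp_def by (rule part_id) (simp add: bihom_part_def)

lemma bicomp_other: "p \<in> H d \<Longrightarrow> d \<noteq> d' \<Longrightarrow> bicomp d' p = 0"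
proof -
  assume "p \<in> H d" "d \<noteq> d'"
  then have "keys (bicomp d' p) = {}" by (auto simp: bicomp_def keys_part bihom_part_def)
  then show ?thesis by simp
qed

lemma bicomp_add: "bicomp d (p + q) = bicomp d p + bicomp d q"
  by (simp add: bicomp_def part_add)

lemma bicomp_mult:
  assumes "l \<in> H (a', b')" "q \<in> S"
  shows "bicomp (a, b) (l * q) = l * bicomp (a - a', b - b') q"
proof (induction q rule: mpol_induct)
  case (monom t c)
  let ?d = "bideg n m t"
  have t: "single t c \<in> H ?d"
    using monom assms(2) by (auto simp: bihom_part_def intro!: S_single split: if_splits dest: S_iff[THEN iffD1])
  have lt: "l * single t c \<in> H (a' + fst ?d, b' + snd ?d)"
    using H_mult[OF assms(1), of "single t c" "fst ?d" "snd ?d"] t by simp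
  show ?case
  proof (cases "?d = (a - a', b - b')")
    case True
    with t lt show ?thesis by (simp add: bicomp_id)
  next
    case False
    then have "(a' + fst ?d, b' + snd ?d) \<noteq> (a, b)" by (cases ?d) auto
    with False show ?thesis using bicomp_other[OF lt] bicomp_other[OF t] by simp
  qed
qed (auto simp: bicomp_add algebra_simps, simp_all add: bicomp_def)

definition hom_ideal :: "'a::comm_ring_1 mpol set \<Rightarrow> bool" where
  "hom_ideal I \<longleftrightarrow> poly_ideal I \<and> (\<forall>p\<in>I. \<forall>d. bicomp d p \<in> I)"

text \<open>
  The polynomials all of whose components lie in \<open>I\<close> form an ideal, and it contains the bihomogeneous
  generators of \<open>I\<close>.
\<close>

lemma bihom_ideal_imp_hom_ideal:
  fixes I :: "'a::comm_ring_1 mpol set"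
  assumes "bihom_ideal n m I" shows "hom_ideal I"
proof -
  obtain B where B: "B \<subseteq> (\<Union>d. H d)" and I: "I = genideal (bi_ring n m) B"
    using assms by (auto simp: bihom_ideal_def)
  have BS: "B \<subseteq> S" using B H_S by blast
  have id: "poly_ideal I" unfolding I by (rule ring.genideal_ideal[OF ring_bi_ring BS])
  let ?T = "{p \<in> S. \<forall>d. bicomp d p \<in> I}"
  have mon: "single t c * p \<in> ?T" if "t \<in> expos n m" "p \<in> ?T" for t c p
  proof -
    have t: "single t c \<in> H (int (xdeg n t), int (ydeg n m t))"
      using that(1) by (auto simp: H_iff intro: S_single)
    have "bicomp (a, b) (single t c * p) \<in> I" for a b
      using that ideal_mult[OF id S_single[OF that(1)]] by (subst bicomp_mult[OF t]) auto
    then show ?thesis using that S_mult[OF S_single[OF that(1)]] by auto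
  qed
  have "poly_ideal ?T"
  proof (rule poly_idealI)
    fix s p :: "'a mpol" assume s: "s \<in> S" and p: "p \<in> ?T"
    show "s * p \<in> ?T"
    proof (induction s rule: mpol_induct)
      case (monom t c)
      then show ?case using s p by (intro mon) (auto simp: S_iff)
    next
      case (add q r)
      then show ?case using ideal_add[OF id] by (auto simp: distrib_right bicomp_add S_add)
    qed (auto simp: bicomp_def ideal_zero[OF id])
  qed (use ideal_add[OF id] ideal_zero[OF id] in \<open>auto simp: S_add bicomp_add\<close>, simp add: bicomp_def ideal_zero[OF id])
  moreover have "B \<subseteq> ?T"
  proof
    fix p assume "p \<in> B"
    then obtain d where d: "p \<in> H d" using B by blast
    have "p \<in> I" unfolding I using ring.genideal_self[OF ring_bi_ring BS] \<open>p \<in> B\<close> by blast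
    then have "bicomp d' p \<in> I" for d'
      using bicomp_id[OF d] bicomp_other[OF d, of d'] ideal_zero[OF id] by (cases "d = d'") auto
    then show "p \<in> ?T" using H_S[OF d] by simp
  qed
  ultimately have "I \<subseteq> ?T" unfolding I using ring.genideal_minimal[OF ring_bi_ring] by blast
  with id show ?thesis by (auto simp: hom_ideal_def)
qed

definition adjoin :: "'a::comm_ring_1 mpol set \<Rightarrow> 'a mpol \<Rightarrow> 'a mpol set" where
  "adjoin I l = {p + l * q | p q. p \<in> I \<and> q \<in> S}"

lemma adjoinI: "p \<in> I \<Longrightarrow> q \<in> S \<Longrightarrow> p + l * q \<in> adjoin I l"
  by (auto simp: adjoin_def)

lemma adjoin_sup: "p \<in> I \<Longrightarrow> p \<in> adjoin I l"
  using adjoinI[of p I 0 l] by simp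

lemma adjoin_mult: "poly_ideal I \<Longrightarrow> q \<in> S \<Longrightarrow> l * q \<in> adjoin I l"
  using adjoinI[of 0 I q l] by (simp add: ideal_zero)

lemma adjoin_ideal:
  fixes I :: "'a::comm_ring_1 mpol set"
  assumes "poly_ideal I" "l \<in> S" shows "poly_ideal (adjoin I l)"
proof (rule poly_idealI)
  show "adjoin I l \<subseteq> S" using assms by (auto simp: adjoin_def S_add S_mult ideal_sub)
  show "0 \<in> adjoin I l" using adjoin_sup[OF ideal_zero[OF assms(1)]] .
  fix p q assume "p \<in> adjoin I l" "q \<in> adjoin I l"
  then obtain p1 p2 q1 q2 where "p = p1 + l * p2" "q = q1 + l * q2" "p1 \<in> I" "q1 \<in> I" "p2 \<in> S" "q2 \<in> S"
    unfolding adjoin_def by blast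
  then show "p + q \<in> adjoin I l"
    using adjoinI[of "p1 + q1" I "p2 + q2" l] ideal_add[OF assms(1)] by (simp add: S_add algebra_simps)
next
  fix s p :: "'a mpol" assume s: "s \<in> S" and "p \<in> adjoin I l"
  then obtain p1 p2 where "p = p1 + l * p2" "p1 \<in> I" "p2 \<in> S" unfolding adjoin_def by blast
  then show "s * p \<in> adjoin I l"
    using adjoinI[of "s * p1" I "s * p2" l] ideal_mult[OF assms(1) s] s by (simp add: S_mult algebra_simps)
qed

lemma adjoin_hom_ideal:
  assumes "hom_ideal I" "l \<in> H (1, 0)" shows "hom_ideal (adjoin I l)"
proof -
  have id: "poly_ideal I" and cl: "\<And>p d. p \<in> I \<Longrightarrow> bicomp d p \<in> I" using assms by (auto simp: hom_ideal_def)
  have "bicomp d p \<in> adjoin I l" if "p \<in> adjoin I l" for p d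
  proof -
    obtain p1 p2 where p: "p = p1 + l * p2" "p1 \<in> I" "p2 \<in> S" using \<open>p \<in> adjoin I l\<close> by (auto simp: adjoin_def)
    obtain a b where d: "d = (a, b)" by (cases d)
    show ?thesis using p cl[OF p(2)] bicomp_H[OF p(3), THEN H_S] unfolding d
      by (auto simp: bicomp_add bicomp_mult[OF assms(2)] intro: adjoinI)
  qed
  with adjoin_ideal[OF id H_S[OF assms(2)]] show ?thesis by (auto simp: hom_ideal_def)
qed

primrec adjoin_upto :: "'a::comm_ring_1 mpol set \<Rightarrow> (nat \<Rightarrow> 'a mpol) \<Rightarrow> nat \<Rightarrow> 'a mpol set" where
  "adjoin_upto I l 0 = I"
| "adjoin_upto I l (Suc j) = adjoin (adjoin_upto I l j) (l j)"

lemma adjoin_upto_ideal: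
  "poly_ideal I \<Longrightarrow> (\<And>i. i < j \<Longrightarrow> l i \<in> S) \<Longrightarrow> poly_ideal (adjoin_upto I l j)"
  by (induction j) (auto intro: adjoin_ideal)

lemma adjoin_upto_hom_ideal:
  "hom_ideal I \<Longrightarrow> (\<And>i. i < j \<Longrightarrow> l i \<in> H (1, 0)) \<Longrightarrow> hom_ideal (adjoin_upto I l j)"
  by (induction j) (auto intro: adjoin_hom_ideal)

lemma adjoin_upto_cong: "(\<And>i. i < j \<Longrightarrow> l i = l' i) \<Longrightarrow> adjoin_upto I l j = adjoin_upto I l' j"
  by (induction j) auto

end

section \<open>Koszul complexes on powers of the variables\<close>

definition pos_sign :: "nat \<Rightarrow> nat set \<Rightarrow> 'a::comm_ring_1" where
  "pos_sign i \<sigma> = (- 1) ^ card {j \<in> \<sigma>. j < i}"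

lemma pos_sign_square: "pos_sign i \<sigma> * pos_sign i \<sigma> = (1::'a::comm_ring_1)"
  by (simp add: pos_sign_def flip: power_mult_distrib)

lemma pos_sign_square': "pos_sign i \<sigma> * (pos_sign i \<sigma> * x) = (x::'a::comm_ring_1)"
  by (simp add: pos_sign_square flip: mult.assoc)

lemma pos_sign_swap:
  assumes "finite \<tau>" "i \<in> \<tau>" "j \<in> \<tau>" "i \<noteq> j"
  shows "pos_sign i \<tau> * pos_sign j (\<tau> - {i}) = - (pos_sign j \<tau> * pos_sign i (\<tau> - {j}) :: 'a::comm_ring_1)"
proof -
  have *: "pos_sign i \<tau> * pos_sign j (\<tau> - {i}) = - (pos_sign j \<tau> * pos_sign i (\<tau> - {j}) :: 'a)"
    if "i < j" "i \<in> \<tau>" "j \<in> \<tau>" for i j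
  proof -
    have 1: "{k \<in> \<tau> - {i}. k < j} = {k \<in> \<tau>. k < j} - {i}" by auto
    have 2: "{k \<in> \<tau> - {j}. k < i} = {k \<in> \<tau>. k < i}" using that by auto
    have "card {k \<in> \<tau>. k < j} = Suc (card ({k \<in> \<tau>. k < j} - {i}))"
      by (rule card.remove) (use assms(1) that in auto)
    then show ?thesis unfolding pos_sign_def 1 2 by simp
  qed
  show ?thesis
  proof (cases "i < j")
    case True
    then show ?thesis using * assms by blast
  next
    case False
    then have "j < i" using assms by simp
    from *[OF this assms(3,2)] show ?thesis by simp
  qed
qed

text \<open>
  The differential of the Koszul complex on \<open>x\<^sub>0^N,\<dots>,x\<^sub>n^N\<close>, with the signs of the Cech differential. A cochain
  is a function on all sets of indices, of which only the values on sets of the right size matter.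
\<close>

definition kdiff :: "nat \<Rightarrow> (nat set \<Rightarrow> 'a::comm_ring_1 mpol) \<Rightarrow> nat set \<Rightarrow> 'a mpol" where
  "kdiff N f \<sigma> = (\<Sum>i\<in>\<sigma>. pos_sign i \<sigma> * (var i ^ N * f (\<sigma> - {i})))"

definition var_prod :: "nat set \<Rightarrow> 'a::comm_ring_1 mpol" where
  "var_prod \<sigma> = (\<Prod>i\<in>\<sigma>. var i)"

lemma kdiff_add: "kdiff N (\<lambda>\<sigma>. f \<sigma> + g \<sigma>) \<sigma> = kdiff N f \<sigma> + kdiff N g \<sigma>"
  by (simp add: kdiff_def algebra_simps sum.distrib)

lemma kdiff_diff: "kdiff N (\<lambda>\<sigma>. f \<sigma> - g \<sigma>) \<sigma> = kdiff N f \<sigma> - kdiff N g \<sigma>"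
  by (simp add: kdiff_def algebra_simps sum_subtractf)

lemma kdiff_scale: "kdiff N (\<lambda>\<sigma>. c * f \<sigma>) \<sigma> = c * kdiff N f \<sigma>"
  by (simp add: kdiff_def sum_distrib_left algebra_simps)

lemma kdiff_cong: "(\<And>i. i \<in> \<sigma> \<Longrightarrow> f (\<sigma> - {i}) = g (\<sigma> - {i})) \<Longrightarrow> kdiff N f \<sigma> = kdiff N g \<sigma>"
  by (simp add: kdiff_def cong: sum.cong)

text \<open>
  The square of the differential is a double sum of terms \<open>A i j\<close> that change sign when the order in which
  \<open>i\<close> and \<open>j\<close> are removed is exchanged. So it equals its negative, and in characteristic 0 it vanishes.
\<close>

lemma kdiff_kdiff:
  fixes f :: "nat set \<Rightarrow> 'a::{idom,ring_char_0} mpol"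
  assumes fin: "finite \<tau>" shows "kdiff N (kdiff N f) \<tau> = 0"
proof -
  define A :: "nat \<Rightarrow> nat \<Rightarrow> 'a mpol" where
    "A i j = (if i = j then 0 else pos_sign i \<tau> * pos_sign j (\<tau> - {i}) * (var i ^ N * var j ^ N * f (\<tau> - {i} - {j})))" for i j
  have anti: "A i j = - A j i" if "i \<in> \<tau>" "j \<in> \<tau>" for i j
  proof (cases "i = j")
    case False
    have eq: "\<tau> - {i} - {j} = \<tau> - {j} - {i}" by auto
    have "A i j = (pos_sign i \<tau> * pos_sign j (\<tau> - {i})) * (var i ^ N * var j ^ N * f (\<tau> - {i} - {j}))"
      using False by (simp add: A_def)
    also have "\<dots> = - (pos_sign j \<tau> * pos_sign i (\<tau> - {j})) * (var j ^ N * var i ^ N * f (\<tau> - {j} - {i}))"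
      by (simp only: pos_sign_swap[OF fin that False] eq mult.commute[of "var i ^ N"])
    also have "\<dots> = - A j i" using False by (simp add: A_def)
    finally show ?thesis .
  qed (simp add: A_def)
  have "kdiff N (kdiff N f) \<tau> = (\<Sum>i\<in>\<tau>. \<Sum>j\<in>\<tau>-{i}. A i j)"
    unfolding kdiff_def sum_distrib_left
    by (intro sum.cong refl) (auto simp: A_def mult.assoc mult.left_commute)
  also have "\<dots> = (\<Sum>i\<in>\<tau>. \<Sum>j\<in>\<tau>. A i j)"
    by (intro sum.cong refl sum.mono_neutral_left) (auto simp: A_def fin)
  finally have 1: "kdiff N (kdiff N f) \<tau> = (\<Sum>i\<in>\<tau>. \<Sum>j\<in>\<tau>. A i j)" .
  also have "\<dots> = (\<Sum>j\<in>\<tau>. \<Sum>i\<in>\<tau>. A i j)" by (rule sum.swap)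
  also have "\<dots> = (\<Sum>j\<in>\<tau>. \<Sum>i\<in>\<tau>. - A j i)"
    using anti by (intro sum.cong refl) blast
  also have "\<dots> = - kdiff N (kdiff N f) \<tau>" unfolding 1 by (simp add: sum_negf)
  finally have "2 * kdiff N (kdiff N f) \<tau> = 0" by (simp only: eq_neg_iff_add_eq_0 mult_2)
  then show ?thesis by simp
qed

lemma var_prod_remove: "finite \<tau> \<Longrightarrow> i \<in> \<tau> \<Longrightarrow> var_prod \<tau> ^ M = var i ^ M * var_prod (\<tau> - {i}) ^ M"
  unfolding var_prod_def by (subst prod.remove[of \<tau> i]) (simp_all add: power_mult_distrib)

text \<open>
  Multiplication by \<open>var_prod \<sigma> ^ M\<close> in the component \<open>\<sigma>\<close> is a map of complexes. The colimit of the Koszul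
  complexes along these maps is the Cech complex: a family \<open>f\<close> at exponent \<open>N\<close> stands for the fractions
  \<open>f \<sigma> / var_prod \<sigma> ^ N\<close>.
\<close>

lemma kdiff_transition:
  assumes "finite \<tau>"
  shows "kdiff (N + M) (\<lambda>\<sigma>. var_prod \<sigma> ^ M * f \<sigma>) \<tau> = var_prod \<tau> ^ M * kdiff N f \<tau>"
  unfolding kdiff_def sum_distrib_left
  by (intro sum.cong refl) (simp add: var_prod_remove[OF assms] power_add algebra_simps)

context bigraded begin

lemma cech_index_iff: "\<sigma> \<in> cech_index n p \<longleftrightarrow> \<sigma> \<subseteq> {..n} \<and> card \<sigma> = p"
  by (simp add: cech_index_def)

lemma cech_index_finite: "\<sigma> \<in> cech_index n p \<Longrightarrow> finite \<sigma>"
  using finite_subset by (auto simp: cech_index_iff)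

lemma cech_index_remove: "\<tau> \<in> cech_index n (Suc p) \<Longrightarrow> i \<in> \<tau> \<Longrightarrow> \<tau> - {i} \<in> cech_index n p"
  using finite_subset by (fastforce simp: cech_index_iff)

lemma cech_index_insert: "\<sigma> \<in> cech_index n p \<Longrightarrow> i \<le> n \<Longrightarrow> i \<notin> \<sigma> \<Longrightarrow> insert i \<sigma> \<in> cech_index n (Suc p)"
  using finite_subset by (fastforce simp: cech_index_iff)

lemma H_pos_sign: "p \<in> H d \<Longrightarrow> pos_sign i \<sigma> * p \<in> H d"
  by (simp add: pos_sign_def H_sign)

lemma H_var_prod:
  assumes "\<sigma> \<in> cech_index n p" "f \<in> H (c, b)"
  shows "var_prod \<sigma> ^ M * f \<in> H (c + int (M * p), b)"
proof -
  have "(var_prod \<sigma> :: 'a mpol) \<in> H (int (card \<sigma>), 0)" if "\<sigma> \<subseteq> {..n}"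
  proof -
    have "finite \<sigma>" using that finite_subset by blast
    then show ?thesis using that
    proof (induction \<sigma> rule: finite_induct)
      case (insert x F)
      then show ?case using H_mult[OF H_var_power[of x 1], of "var_prod F" "int (card F)" 0]
        by (simp add: var_prod_def)
    qed (simp add: var_prod_def H_one)
  qed
  then have v: "(var_prod \<sigma> :: 'a mpol) \<in> H (int p, 0)" using assms by (auto simp: cech_index_iff)
  show ?thesis
  proof (induction M)
    case (Suc M)
    from H_mult[OF v Suc] show ?case by (simp add: algebra_simps)
  qed (use assms in simp)
qed

text \<open>
  The degree shift by \<open>N * p\<close> gives the fractions \<open>f \<sigma> / var_prod \<sigma> ^ N\<close> the bidegree \<open>(c, b)\<close>.
\<close>

definition kcochain :: "nat \<Rightarrow> nat \<Rightarrow> int \<Rightarrow> int \<Rightarrow> (nat set \<Rightarrow> 'a::comm_ring_1 mpol) \<Rightarrow> bool" where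
  "kcochain p N c b f \<longleftrightarrow> (\<forall>\<sigma>\<in>cech_index n p. f \<sigma> \<in> H (c + int (N * p), b))"

lemma kcochainD: "kcochain p N c b f \<Longrightarrow> \<sigma> \<in> cech_index n p \<Longrightarrow> f \<sigma> \<in> H (c + int (N * p), b)"
  by (simp add: kcochain_def)

lemma kcochain_diff: "kcochain p N c b f \<Longrightarrow> kcochain p N c b g \<Longrightarrow> kcochain p N c b (\<lambda>\<sigma>. f \<sigma> - g \<sigma>)"
  by (simp add: kcochain_def H_diff)

lemma kcochain_add: "kcochain p N c b f \<Longrightarrow> kcochain p N c b g \<Longrightarrow> kcochain p N c b (\<lambda>\<sigma>. f \<sigma> + g \<sigma>)"
  by (simp add: kcochain_def H_add)

lemma kcochain_kdiff:
  assumes "kcochain p N c b f" shows "kcochain (Suc p) N c b (kdiff N f)"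
  unfolding kcochain_def kdiff_def
proof (intro ballI H_sum H_pos_sign)
  fix \<tau> i assume t: "\<tau> \<in> cech_index n (Suc p)" "i \<in> \<tau>"
  then have "i \<le> n" by (auto simp: cech_index_iff)
  from H_var_power_mult[OF this kcochainD[OF assms cech_index_remove[OF t]], of N]
  show "var i ^ N * f (\<tau> - {i}) \<in> H (c + int (N * Suc p), b)"
    by (simp add: algebra_simps)
qed

lemma kcochain_transition:
  "kcochain p N c b f \<Longrightarrow> kcochain p (N + M) c b (\<lambda>\<sigma>. var_prod \<sigma> ^ M * f \<sigma>)"
  using H_var_prod by (fastforce simp: kcochain_def algebra_simps)

text \<open>
  Contraction along \<open>x\<^sub>k\<close>. If \<open>\<delta>\<close> is the differential and \<open>h\<close> this map, then \<open>f - \<delta> (h f)\<close> vanishes for a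
  cocycle \<open>f\<close> on the sets without \<open>k\<close>, and on a set with \<open>k\<close> it keeps of \<open>f\<close> the monomials that \<open>x\<^sub>k^N\<close>
  does not divide.
\<close>

definition khomotopy :: "nat \<Rightarrow> nat \<Rightarrow> (nat set \<Rightarrow> 'a::comm_ring_1 mpol) \<Rightarrow> nat set \<Rightarrow> 'a mpol" where
  "khomotopy k N f \<rho> = (if k \<in> \<rho> then 0 else pos_sign k (insert k \<rho>) * quot k N (f (insert k \<rho>)))"

lemma khomotopy_in:
  assumes "finite \<sigma>" "k \<in> \<sigma>"
  shows "kdiff N (khomotopy k N f) \<sigma> = var k ^ N * quot k N (f \<sigma>)"
proof -
  have "kdiff N (khomotopy k N f) \<sigma> = (\<Sum>i\<in>\<sigma>. if i = k then var k ^ N * quot k N (f \<sigma>) else 0)"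
    unfolding kdiff_def using assms
    by (intro sum.cong refl) (auto simp: khomotopy_def pos_sign_square' insert_absorb algebra_simps)
  then show ?thesis using assms by simp
qed

lemma khomotopy_notin:
  assumes "finite \<sigma>" "k \<notin> \<sigma>" and z: "kdiff N f (insert k \<sigma>) = 0"
  shows "kdiff N (khomotopy k N f) \<sigma> = f \<sigma>"
proof -
  let ?\<tau> = "insert k \<sigma>"
  let ?Q = "\<lambda>i. var i ^ N * quot k N (f (?\<tau> - {i}))"
  have "0 = quot k N (kdiff N f ?\<tau>)" by (simp add: z)
  also have "\<dots> = (\<Sum>i\<in>?\<tau>. pos_sign i ?\<tau> * quot k N (var i ^ N * f (?\<tau> - {i})))"
    by (simp add: kdiff_def quot_sum quot_sign pos_sign_def)
  also have "\<dots> = pos_sign k ?\<tau> * quot k N (var k ^ N * f (?\<tau> - {k}))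
     + (\<Sum>i\<in>\<sigma>. pos_sign i ?\<tau> * quot k N (var i ^ N * f (?\<tau> - {i})))"
    using assms by simp
  also have "quot k N (var k ^ N * f (?\<tau> - {k})) = f \<sigma>"
    using assms by (simp add: quot_var_power)
  also have "(\<Sum>i\<in>\<sigma>. pos_sign i ?\<tau> * quot k N (var i ^ N * f (?\<tau> - {i}))) = (\<Sum>i\<in>\<sigma>. pos_sign i ?\<tau> * ?Q i)"
    using assms by (intro sum.cong refl arg_cong[where f = "(*) _"] quot_var_power_commute) auto
  finally have "pos_sign k ?\<tau> * f \<sigma> + (\<Sum>i\<in>\<sigma>. pos_sign i ?\<tau> * ?Q i) = 0" by (rule sym)
  then have "(\<Sum>i\<in>\<sigma>. pos_sign i ?\<tau> * ?Q i) = - (pos_sign k ?\<tau> * f \<sigma>)"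
    by (simp only: add_eq_0_iff)
  then have "f \<sigma> = pos_sign k ?\<tau> * (- (\<Sum>i\<in>\<sigma>. pos_sign i ?\<tau> * ?Q i))"
    by (simp only: minus_minus pos_sign_square')
  also have "\<dots> = (\<Sum>i\<in>\<sigma>. - (pos_sign k ?\<tau> * pos_sign i ?\<tau>) * ?Q i)"
    by (simp add: sum_distrib_left sum_negf mult.assoc)
  also have "\<dots> = (\<Sum>i\<in>\<sigma>. pos_sign i \<sigma> * pos_sign k (?\<tau> - {i}) * ?Q i)"
  proof (intro sum.cong refl arg_cong2[where f = "(*)"])
    fix i assume i: "i \<in> \<sigma>"
    then have ik: "i \<noteq> k" using assms by auto
    have s: "?\<tau> - {k} = \<sigma>" using assms by auto
    have "pos_sign i ?\<tau> * pos_sign k (?\<tau> - {i}) = - (pos_sign k ?\<tau> * pos_sign i \<sigma> :: 'a mpol)"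
      using pos_sign_swap[of ?\<tau> i k] i ik assms(1) s by auto
    then have "pos_sign i \<sigma> * (pos_sign i ?\<tau> * (pos_sign i ?\<tau> * pos_sign k (?\<tau> - {i})))
        = - (pos_sign k ?\<tau> * pos_sign i ?\<tau>) * (pos_sign i \<sigma> * pos_sign i \<sigma> :: 'a mpol)"
      by (simp add: ac_simps)
    then show "- (pos_sign k ?\<tau> * pos_sign i ?\<tau>) = (pos_sign i \<sigma> * pos_sign k (?\<tau> - {i}) :: 'a mpol)"
      by (simp only: pos_sign_square' pos_sign_square mult_1_right)
  qed
  also have "\<dots> = kdiff N (khomotopy k N f) \<sigma>"
    unfolding kdiff_def
  proof (intro sum.cong refl)
    fix i assume i: "i \<in> \<sigma>"
    then have "i \<noteq> k" using assms by auto
    then have "insert k (\<sigma> - {i}) = ?\<tau> - {i}" by auto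
    then show "pos_sign i \<sigma> * pos_sign k (?\<tau> - {i}) * ?Q i
        = pos_sign i \<sigma> * (var i ^ N * khomotopy k N f (\<sigma> - {i}))"
      using assms by (simp add: khomotopy_def algebra_simps)
  qed
  finally show ?thesis by simp
qed

lemma kcochain_khomotopy:
  assumes "kcochain (Suc p) N c b f" "k \<le> n" shows "kcochain p N c b (khomotopy k N f)"
  unfolding kcochain_def
proof
  fix \<rho> assume r: "\<rho> \<in> cech_index n p"
  show "khomotopy k N f \<rho> \<in> H (c + int (N * p), b)"
  proof (cases "k \<in> \<rho>")
    case False
    from H_quot[OF assms(2) kcochainD[OF assms(1) cech_index_insert[OF r assms(2) False]], of N]
    show ?thesis using False by (simp add: khomotopy_def H_pos_sign)
  qed (simp add: khomotopy_def)
qed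

text \<open>
  Subtracting from a cocycle its coboundaries \<open>\<delta> (h f)\<close> for \<open>k = 0, 1, \<dots>\<close> makes it vanish on more and more
  sets: after step \<open>k\<close> it lives on the sets that contain \<open>{..k}\<close>, since the subtraction never enlarges the
  support. After step \<open>n\<close> only the set \<open>{..n}\<close> is left, and it has more than \<open>p + 1\<close> elements.
\<close>

lemma koszul_exact:
  fixes f :: "nat set \<Rightarrow> 'a::{idom,ring_char_0} mpol"
  assumes "p < n" and f: "kcochain (Suc p) N c b f"
    and z: "\<And>\<tau>. \<tau> \<in> cech_index n (Suc (Suc p)) \<Longrightarrow> kdiff N f \<tau> = 0"
  shows "\<exists>g. kcochain p N c b g \<and> (\<forall>\<sigma>\<in>cech_index n (Suc p). f \<sigma> = kdiff N g \<sigma>)"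
proof -
  have "\<exists>g. kcochain p N c b g \<and> (\<forall>\<sigma>\<in>cech_index n (Suc p). \<not> {..<k} \<subseteq> \<sigma> \<longrightarrow> f \<sigma> = kdiff N g \<sigma>)"
    if "k \<le> Suc n" for k
    using that
  proof (induction k)
    case 0
    show ?case by (rule exI[of _ "\<lambda>_. 0"]) (simp add: kcochain_def)
  next
    case (Suc k)
    then obtain g where g: "kcochain p N c b g"
      "\<And>\<sigma>. \<sigma> \<in> cech_index n (Suc p) \<Longrightarrow> \<not> {..<k} \<subseteq> \<sigma> \<Longrightarrow> f \<sigma> = kdiff N g \<sigma>" by auto
    define f' where "f' = (\<lambda>\<sigma>. f \<sigma> - kdiff N g \<sigma>)"
    have f': "kcochain (Suc p) N c b f'" unfolding f'_def by (rule kcochain_diff[OF f kcochain_kdiff[OF g(1)]])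
    have z': "kdiff N f' \<tau> = 0" if "\<tau> \<in> cech_index n (Suc (Suc p))" for \<tau>
      unfolding f'_def kdiff_diff using z[OF that] kdiff_kdiff[OF cech_index_finite[OF that]] by simp
    have kn: "k \<le> n" using Suc.prems by simp
    have "f \<sigma> = kdiff N (\<lambda>\<sigma>. g \<sigma> + khomotopy k N f' \<sigma>) \<sigma>"
      if s: "\<sigma> \<in> cech_index n (Suc p)" "\<not> {..<Suc k} \<subseteq> \<sigma>" for \<sigma>
    proof (cases "k \<in> \<sigma>")
      case True
      with s have "\<not> {..<k} \<subseteq> \<sigma>" by (auto simp: less_Suc_eq)
      then have "f' \<sigma> = 0" using g(2) s by (simp add: f'_def)
      then have "kdiff N (khomotopy k N f') \<sigma> = 0"
        by (simp add: khomotopy_in[OF cech_index_finite[OF s(1)] True])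
      then show ?thesis using \<open>f' \<sigma> = 0\<close> by (simp add: kdiff_add f'_def)
    next
      case False
      have "kdiff N (khomotopy k N f') \<sigma> = f' \<sigma>"
        by (rule khomotopy_notin[OF cech_index_finite[OF s(1)] False z'[OF cech_index_insert[OF s(1) kn False]]])
      then show ?thesis by (simp add: kdiff_add f'_def)
    qed
    moreover have "kcochain p N c b (\<lambda>\<sigma>. g \<sigma> + khomotopy k N f' \<sigma>)"
      by (rule kcochain_add[OF g(1) kcochain_khomotopy[OF f' kn]])
    ultimately show ?case by blast
  qed
  from this[of "Suc n"] obtain g where g: "kcochain p N c b g"
    "\<And>\<sigma>. \<sigma> \<in> cech_index n (Suc p) \<Longrightarrow> \<not> {..<Suc n} \<subseteq> \<sigma> \<Longrightarrow> f \<sigma> = kdiff N g \<sigma>" by auto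
  have "\<not> {..<Suc n} \<subseteq> \<sigma>" if "\<sigma> \<in> cech_index n (Suc p)" for \<sigma>
    using that card_mono[of \<sigma> "{..<Suc n}"] \<open>p < n\<close> finite_subset[of \<sigma> "{..n}"] by (auto simp: cech_index_iff)
  with g show ?thesis by blast
qed

lemma koszul_exact_0:
  fixes f :: "nat set \<Rightarrow> 'a::comm_ring_1 mpol"
  assumes "\<And>\<tau>. \<tau> \<in> cech_index n (Suc 0) \<Longrightarrow> kdiff N f \<tau> = 0"
  shows "f {} = 0"
proof -
  have "kdiff N f {0} = 0" by (rule assms) (simp add: cech_index_iff)
  then have "quot 0 N (var 0 ^ N * f {}) = 0" by (simp add: kdiff_def pos_sign_def)
  then show ?thesis by (simp add: quot_var_power)
qed

end

section \<open>Local cohomology of quotients of the polynomial ring\<close>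

abbreviation Fract where "Fract \<equiv> Fraction_Field.Fract"

lemma pos_sign_singleton: "pos_sign j {j} = 1"
proof -
  have "{i \<in> {j}. i < j} = {}" by auto
  then show ?thesis unfolding pos_sign_def by (metis card.empty power_0)
qed

lemma var_nonzero: "(var k :: 'a::comm_ring_1 mpol) \<noteq> 0"
  by (simp add: var_def monom_of_def flip: keys_eq_empty)

lemma var_prod_nonzero: "(var_prod \<sigma> :: 'a::idom mpol) \<noteq> 0"
proof (cases "finite \<sigma>")
  case True
  then show ?thesis by (simp add: var_prod_def var_nonzero)
qed (simp add: var_prod_def)

lemma Fract_as_quotient: "b \<noteq> 0 \<Longrightarrow> Fract a b = Fract a 1 / Fract b (1::'a::idom)"
  by (simp add: divide_fract)

lemma Fract_sum: "Fract (\<Sum>i\<in>A. f i) (1::'a::idom) = (\<Sum>i\<in>A. Fract (f i) 1)"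
proof (induction A rule: infinite_finite_induct)
  case (insert x F)
  have "Fract (sum f (insert x F)) 1 = Fract (f x) 1 + Fract (sum f F) 1" using insert(1,2) by simp
  with insert show ?case by simp
qed (simp_all add: Zero_fract_def)

lemma Fract_sign: "Fract ((- 1) ^ e * a) (1::'a::idom) = (- 1) ^ e * Fract a 1"
  by (induction e) (auto simp flip: minus_fract)

context bigraded begin

lemma finite_cech_index: "finite (cech_index n p)"
  unfolding cech_index_def by (rule finite_subset[of _ "Pow {..n}"]) auto

text \<open>
  Vanishing in bidegree \<open>(c, b)\<close> of the local cohomology of \<open>S / I\<close> in degree \<open>p\<close>. It is the colimit over \<open>N\<close>
  of the Koszul cohomology on \<open>x\<^sub>0^N,\<dots>,x\<^sub>n^N\<close>, so that every cocycle at level \<open>N\<close> has to become a coboundary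
  at some level \<open>N + M\<close>. Classes of \<open>S / I\<close> are represented by polynomials, and equations hold modulo \<open>I\<close>;
  thus no module has to be localized. For \<open>p = 0\<close> the truncated \<open>p - 1\<close> is harmless: on the empty set
  \<open>kdiff\<close> is an empty sum, so \<open>g\<close> contributes nothing.
\<close>

definition kvanish :: "'a::comm_ring_1 mpol set \<Rightarrow> nat \<Rightarrow> int \<Rightarrow> int \<Rightarrow> bool" where
  "kvanish I p c b \<longleftrightarrow>
    (\<forall>N f. kcochain p N c b f \<and> (\<forall>\<tau>\<in>cech_index n (Suc p). kdiff N f \<tau> \<in> I) \<longrightarrow>
      (\<exists>M g. kcochain (p - 1) (N + M) c b g \<and>
        (\<forall>\<sigma>\<in>cech_index n p. var_prod \<sigma> ^ M * f \<sigma> - kdiff (N + M) g \<sigma> \<in> I)))"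

lemma kvanishD:
  assumes "kvanish I p c b" "kcochain p N c b f" "\<And>\<tau>. \<tau> \<in> cech_index n (Suc p) \<Longrightarrow> kdiff N f \<tau> \<in> I"
  obtains M g where "kcochain (p - 1) (N + M) c b g"
    "\<And>\<sigma>. \<sigma> \<in> cech_index n p \<Longrightarrow> var_prod \<sigma> ^ M * f \<sigma> - kdiff (N + M) g \<sigma> \<in> I"
  using assms unfolding kvanish_def by blast

text \<open>
  Regularity of \<open>l\<close> on \<open>S / I\<close> up to elements that powers of \<open>x\<^sub>0,\<dots>,x\<^sub>n\<close> annihilate.
\<close>

definition filter_regular :: "'a::comm_ring_1 mpol \<Rightarrow> 'a mpol set \<Rightarrow> bool" where
  "filter_regular l I \<longleftrightarrow> (\<forall>h\<in>S. l * h \<in> I \<longrightarrow> (\<exists>M. \<forall>j\<le>n. var j ^ M * h \<in> I))"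

lemma x_var_S: "j \<le> n \<Longrightarrow> var j \<in> S"
  by (rule S_var) simp

lemma var_power_ideal_mono:
  assumes "poly_ideal I" "j \<le> n" "var j ^ M * h \<in> I" "M \<le> M'"
  shows "var j ^ M' * h \<in> I"
proof -
  have "var j ^ M' * h = var j ^ (M' - M) * (var j ^ M * h)"
    using assms(4) by (simp flip: power_add mult.assoc)
  then show ?thesis using ideal_mult[OF assms(1) S_power[OF x_var_S[OF assms(2)]] assms(3)] by metis
qed

text \<open>
  The long exact sequence of \<open>0 \<longrightarrow> S/(I : l)(-1,0) \<longrightarrow> S/I \<longrightarrow> S/(I,l) \<longrightarrow> 0\<close>, where filter-regularity makes
  \<open>(I : l)/I\<close> a torsion module and so identifies the cohomology of \<open>S/(I : l)\<close> in positive degrees with that of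
  \<open>S/I\<close>. In terms of cochains: a cocycle \<open>f\<close> modulo \<open>(I,l)\<close> satisfies \<open>\<delta> f = P + l h\<close> with \<open>P\<close> in \<open>I\<close>; the
  class of \<open>h\<close> is the image under the connecting map. As \<open>\<delta> h\<close> is torsion modulo \<open>I\<close>, \<open>h\<close> becomes a cocycle
  modulo \<open>I\<close> at a later level and the coboundary of some \<open>g\<close> at a still later one. There \<open>f - l g\<close> is a cocycle modulo \<open>I\<close> itself.
\<close>

lemma kvanish_adjoin:
  fixes I :: "'a::{idom,ring_char_0} mpol set"
  assumes hom: "hom_ideal I" and l: "l \<in> H (1, 0)" and reg: "filter_regular l I"
    and v0: "kvanish I p c b" and v1: "kvanish I (Suc p) (c - 1) b"
  shows "kvanish (adjoin I l) p c b"
  unfolding kvanish_def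
proof (intro allI impI, elim conjE)
  fix N f assume f: "kcochain p N c b f"
    and df: "\<forall>\<tau>\<in>cech_index n (Suc p). kdiff N f \<tau> \<in> adjoin I l"
  have id: "poly_ideal I" using hom by (simp add: hom_ideal_def)
  have lS: "l \<in> S" using H_S[OF l] .
  have "\<exists>P h. kdiff N f \<tau> = P + l * h \<and> P \<in> I \<and> h \<in> H (c - 1 + int (N * Suc p), b)"
    if t: "\<tau> \<in> cech_index n (Suc p)" for \<tau>
  proof -
    obtain P h where *: "kdiff N f \<tau> = P + l * h" "P \<in> I" "h \<in> S" using df t unfolding adjoin_def by blast
    let ?e = "c + int (N * Suc p)"
    have "kdiff N f \<tau> = bicomp (?e, b) (kdiff N f \<tau>)"
      using kcochainD[OF kcochain_kdiff[OF f] t] by (simp only: bicomp_id)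
    also have "\<dots> = bicomp (?e, b) P + l * bicomp (?e - 1, b) h"
      using * by (simp add: bicomp_add bicomp_mult[OF l])
    finally have "kdiff N f \<tau> = bicomp (?e, b) P + l * bicomp (?e - 1, b) h" .
    moreover have "bicomp (?e, b) P \<in> I" using hom *(2) by (simp add: hom_ideal_def)
    moreover have "bicomp (?e - 1, b) h \<in> H (c - 1 + int (N * Suc p), b)"
      using bicomp_H[OF *(3), of "(?e - 1, b)"] by (simp add: algebra_simps)
    ultimately show ?thesis by blast
  qed
  \<comment> \<open>Taking bihomogeneous components makes \<open>h\<close> a cochain of bidegree \<open>(c - 1, b)\<close>.\<close>
  then obtain P h where P: "\<And>\<tau>. \<tau> \<in> cech_index n (Suc p) \<Longrightarrow> kdiff N f \<tau> = P \<tau> + l * h \<tau>"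
      "\<And>\<tau>. \<tau> \<in> cech_index n (Suc p) \<Longrightarrow> P \<tau> \<in> I"
    and h: "kcochain (Suc p) N (c - 1) b h"
    unfolding kcochain_def by metis
  have kI: "kdiff N F \<rho> \<in> I" if "\<rho> \<in> cech_index n (Suc q)" "\<And>\<sigma>. \<sigma> \<in> cech_index n q \<Longrightarrow> F \<sigma> \<in> I" for N F \<rho> q
    unfolding kdiff_def
  proof (intro ideal_sum[OF id])
    fix i assume i: "i \<in> \<rho>"
    then have "i \<le> n" using that(1) by (auto simp: cech_index_iff)
    moreover have "pos_sign i \<rho> \<in> S" by (simp add: pos_sign_def S_power S_uminus)
    ultimately show "pos_sign i \<rho> * (var i ^ N * F (\<rho> - {i})) \<in> I"
      using that(2)[OF cech_index_remove[OF that(1) i]] by (intro ideal_mult[OF id] S_power x_var_S)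
  qed
  have "\<exists>M. \<forall>j\<le>n. var j ^ M * kdiff N h \<rho> \<in> I" if r: "\<rho> \<in> cech_index n (Suc (Suc p))" for \<rho>
  proof -
    have "0 = kdiff N (kdiff N f) \<rho>" using kdiff_kdiff[OF cech_index_finite[OF r]] by simp
    also have "\<dots> = kdiff N (\<lambda>\<tau>. P \<tau> + l * h \<tau>) \<rho>"
      by (rule kdiff_cong) (use P cech_index_remove[OF r] in blast)
    also have "\<dots> = kdiff N P \<rho> + l * kdiff N h \<rho>" by (simp add: kdiff_add kdiff_scale)
    finally have "kdiff N P \<rho> + l * kdiff N h \<rho> = 0" by (rule sym)
    then have "l * kdiff N h \<rho> = - kdiff N P \<rho>" by (simp only: add_eq_0_iff)
    moreover have "- kdiff N P \<rho> \<in> I" by (intro ideal_uminus[OF id] kI[OF r] P(2))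
    ultimately have "l * kdiff N h \<rho> \<in> I" by simp
    then show ?thesis using reg H_S[OF kcochainD[OF kcochain_kdiff[OF h] r]] by (auto simp: filter_regular_def)
  qed
  then obtain Mf where Mf: "\<And>\<rho> j. \<rho> \<in> cech_index n (Suc (Suc p)) \<Longrightarrow> j \<le> n \<Longrightarrow> var j ^ Mf \<rho> * kdiff N h \<rho> \<in> I"
    by metis
  \<comment> \<open>There are finitely many components, so one power annihilates all of them.\<close>
  define M where "M = Max (Mf ` cech_index n (Suc (Suc p)))"
  have M: "var j ^ M * kdiff N h \<rho> \<in> I" if "\<rho> \<in> cech_index n (Suc (Suc p))" "j \<le> n" for \<rho> j
    by (rule var_power_ideal_mono[OF id that(2) Mf[OF that]])
      (use that finite_cech_index in \<open>simp add: M_def\<close>)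
  have "kdiff (N + M) (\<lambda>\<tau>. var_prod \<tau> ^ M * h \<tau>) \<rho> \<in> I" if r: "\<rho> \<in> cech_index n (Suc (Suc p))" for \<rho>
  proof -
    obtain j where j: "j \<in> \<rho>" using r by (fastforce simp: cech_index_iff)
    have sub: "\<rho> \<subseteq> {..n}" using r by (simp add: cech_index_iff)
    have "var_prod \<rho> ^ M * kdiff N h \<rho> = var_prod (\<rho> - {j}) ^ M * (var j ^ M * kdiff N h \<rho>)"
      unfolding var_prod_remove[OF cech_index_finite[OF r] j] by (simp only: mult.assoc mult.left_commute)
    also have "\<dots> \<in> I"
      using j sub by (intro ideal_mult[OF id] M[OF r] S_power) (auto simp: var_prod_def intro!: S_prod x_var_S)
    finally show ?thesis by (simp add: kdiff_transition[OF cech_index_finite[OF r]])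
  qed
  from kvanishD[OF v1 kcochain_transition[OF h] this]
  obtain M' g where "kcochain (Suc p - 1) (N + M + M') (c - 1) b g"
    and g2: "\<And>\<tau>. \<tau> \<in> cech_index n (Suc p) \<Longrightarrow>
       var_prod \<tau> ^ M' * (var_prod \<tau> ^ M * h \<tau>) - kdiff (N + M + M') g \<tau> \<in> I" by blast
  then have g1: "kcochain p (N + M + M') (c - 1) b g" by simp
  define K where "K = M + M'"
  have g': "kcochain p (N + K) (c - 1) b g" using g1 by (simp add: K_def add.assoc)
  have gI: "var_prod \<tau> ^ K * h \<tau> - kdiff (N + K) g \<tau> \<in> I" if "\<tau> \<in> cech_index n (Suc p)" for \<tau>
    using g2[OF that] by (simp add: K_def power_add ac_simps)
  have lg: "kcochain p (N + K) c b (\<lambda>\<sigma>. l * g \<sigma>)"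
    unfolding kcochain_def
  proof
    fix \<sigma> assume "\<sigma> \<in> cech_index n p"
    from H_mult[OF l kcochainD[OF g' this]] show "l * g \<sigma> \<in> H (c + int ((N + K) * p), b)" by simp
  qed
  define f' where "f' = (\<lambda>\<sigma>. var_prod \<sigma> ^ K * f \<sigma> - l * g \<sigma>)"
  have f': "kcochain p (N + K) c b f'"
    unfolding f'_def by (rule kcochain_diff[OF kcochain_transition[OF f] lg])
  have vpS: "var_prod \<sigma> ^ L \<in> S" if "\<sigma> \<in> cech_index n q" for \<sigma> q L
    using that by (auto simp: var_prod_def cech_index_iff intro!: S_power S_prod x_var_S)
  have "kdiff (N + K) f' \<tau> \<in> I" if t: "\<tau> \<in> cech_index n (Suc p)" for \<tau>
  proof -
    have "kdiff (N + K) f' \<tau> = var_prod \<tau> ^ K * kdiff N f \<tau> - l * kdiff (N + K) g \<tau>"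
      by (simp add: f'_def kdiff_diff kdiff_scale kdiff_transition[OF cech_index_finite[OF t]])
    also have "\<dots> = var_prod \<tau> ^ K * P \<tau> + l * (var_prod \<tau> ^ K * h \<tau> - kdiff (N + K) g \<tau>)"
      by (simp add: P(1)[OF t] algebra_simps)
    also have "\<dots> \<in> I"
      by (intro ideal_add[OF id] ideal_mult[OF id] lS vpS[OF t] P(2)[OF t] gI[OF t])
    finally show ?thesis .
  qed
  from kvanishD[OF v0 f' this] obtain M2 G where G: "kcochain (p - 1) (N + K + M2) c b G"
    "\<And>\<sigma>. \<sigma> \<in> cech_index n p \<Longrightarrow> var_prod \<sigma> ^ M2 * f' \<sigma> - kdiff (N + K + M2) G \<sigma> \<in> I"
    by blast
  have "var_prod \<sigma> ^ (K + M2) * f \<sigma> - kdiff (N + (K + M2)) G \<sigma> \<in> adjoin I l" if s: "\<sigma> \<in> cech_index n p" for \<sigma>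
  proof -
    have "var_prod \<sigma> ^ (K + M2) * f \<sigma> - kdiff (N + (K + M2)) G \<sigma>
      = (var_prod \<sigma> ^ M2 * f' \<sigma> - kdiff (N + K + M2) G \<sigma>) + l * (var_prod \<sigma> ^ M2 * g \<sigma>)"
      by (simp add: f'_def power_add algebra_simps)
    also have "\<dots> \<in> adjoin I l"
      by (intro adjoinI G(2)[OF s] S_mult vpS[OF s] H_S[OF kcochainD[OF g' s]])
    finally show ?thesis .
  qed
  with G(1) show "\<exists>M g. kcochain (p - 1) (N + M) c b g \<and>
      (\<forall>\<sigma>\<in>cech_index n p. var_prod \<sigma> ^ M * f \<sigma> - kdiff (N + M) g \<sigma> \<in> adjoin I l)"
    by (intro exI[of _ "K + M2"] exI[of _ G]) (simp add: add.assoc)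
qed

text \<open>
  Over the common denominator \<open>var_prod \<tau> ^ N\<close> the numerator \<open>f (\<tau> - {i})\<close> is multiplied by \<open>x\<^sub>i^N\<close>, which turns
  the Cech differential into the Koszul differential.
\<close>

lemma cech_diff_Fract:
  fixes f :: "nat set \<Rightarrow> 'a::idom mpol"
  assumes t: "\<tau> \<in> cech_index n (Suc p)"
    and c: "\<And>\<sigma>. \<sigma> \<in> cech_index n p \<Longrightarrow> c \<sigma> = Fract (f \<sigma>) (var_prod \<sigma> ^ N)"
  shows "cech_diff n p c \<tau> = Fract (kdiff N f \<tau>) (var_prod \<tau> ^ N)"
proof -
  have nz: "(var_prod \<sigma> ^ N :: 'a mpol) \<noteq> 0" for \<sigma> by (simp add: var_prod_nonzero)
  have "c (\<tau> - {i}) = Fract (var i ^ N * f (\<tau> - {i})) (var_prod \<tau> ^ N)" if i: "i \<in> \<tau>" for i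
  proof -
    have vz: "(var i ^ N :: 'a mpol) \<noteq> 0" by (simp add: var_nonzero)
    have "c (\<tau> - {i}) = Fract (f (\<tau> - {i})) (var_prod (\<tau> - {i}) ^ N)" by (rule c[OF cech_index_remove[OF t i]])
    also have "\<dots> = Fract (var i ^ N * f (\<tau> - {i})) (var_prod \<tau> ^ N)"
      unfolding var_prod_remove[OF cech_index_finite[OF t] i] using vz nz by (intro mult_fract_cancel[symmetric])
    finally show ?thesis .
  qed
  then have "cech_diff n p c \<tau> = (\<Sum>i\<in>\<tau>. pos_sign i \<tau> * Fract (var i ^ N * f (\<tau> - {i})) (var_prod \<tau> ^ N))"
    using t by (simp add: cech_diff_def pos_sign_def)
  also have "\<dots> = (\<Sum>i\<in>\<tau>. Fract (pos_sign i \<tau> * (var i ^ N * f (\<tau> - {i}))) 1) / Fract (var_prod \<tau> ^ N) 1"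
    unfolding sum_divide_distrib pos_sign_def Fract_sign Fract_as_quotient[OF nz, of _ \<tau>]
    by (simp only: times_divide_eq_right)
  also have "\<dots> = Fract (kdiff N f \<tau>) (var_prod \<tau> ^ N)"
    unfolding kdiff_def Fract_as_quotient[OF nz, of "sum _ _" \<tau>] Fract_sum ..
  finally show ?thesis .
qed

lemma zero_cech_cochain: "poly_ideal I \<Longrightarrow> (\<lambda>_. 0) \<in> cech_cochains n m I d p"
  unfolding cech_cochains_def loc_part_def
  by (auto simp: ideal_zero Zero_fract_def intro!: exI[of _ 0])

text \<open>
  The class of \<open>c\<close> is the only element of the quotient, the set of coboundaries; and \<open>c\<close> lies in its own
  class because 0 is a coboundary.
\<close>

lemma local_cohomology_vanishD:
  fixes I :: "'a::idom mpol set"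
  assumes "poly_ideal I" and van: "local_cohomology n m I (Suc p) d = {cech_coboundaries n m I d (Suc p)}"
    and c: "c \<in> cech_cocycles n m I d (Suc p)"
  obtains e where "e \<in> cech_cochains n m I d p" "c = cech_diff n p e"
proof -
  have "cech_diff n p (\<lambda>_. 0) = (\<lambda>_. 0 :: 'a mpol fract)" by (auto simp: cech_diff_def)
  then have "(\<lambda>_. 0) \<in> cech_coboundaries n m I d (Suc p)"
    using imageI[OF zero_cech_cochain[OF assms(1), of d p], of "cech_diff n p"]
    by (simp add: cech_coboundaries_def)
  moreover define r where "r = {(c, c'). c \<in> cech_cocycles n m I d (Suc p) \<and> c' \<in> cech_cocycles n m I d (Suc p) \<and>
                (\<lambda>\<sigma>. c \<sigma> - c' \<sigma>) \<in> cech_coboundaries n m I d (Suc p)}"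
  ultimately have "c \<in> r `` {c}" using c by simp
  moreover have "r `` {c} \<in> local_cohomology n m I (Suc p) d"
    unfolding local_cohomology_def r_def[symmetric] by (rule quotientI[OF c])
  ultimately have "c \<in> cech_coboundaries n m I d (Suc p)" using van by auto
  then show ?thesis using that by (auto simp: cech_coboundaries_def)
qed

text \<open>
  The connecting map from the cohomology of \<open>S/I\<close> in degree \<open>p\<close> to that of \<open>I\<close> in degree \<open>p + 1\<close> is injective
  for \<open>p \<le> n\<close>. A cocycle \<open>f\<close> modulo \<open>I\<close> has \<open>\<delta> f\<close> in \<open>I\<close>; by hypothesis \<open>\<delta> f = \<delta> g'\<close> at a later level, with
  \<open>g'\<close> in \<open>I\<close>. So \<open>f - g'\<close> is a cocycle over \<open>S\<close>, and \<open>koszul_exact\<close> makes it a coboundary.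
\<close>

lemma kvanish_of_local_cohomology:
  fixes I :: "'a::{idom,ring_char_0} mpol set"
  assumes id: "poly_ideal I" and "p \<le> n"
    and van: "local_cohomology n m I (Suc p) (c, b) = {cech_coboundaries n m I (c, b) (Suc p)}"
  shows "kvanish I p c b"
  unfolding kvanish_def
proof (intro allI impI, elim conjE)
  fix N and f :: "nat set \<Rightarrow> 'a mpol" assume f: "kcochain p N c b f"
    and df: "\<forall>\<tau>\<in>cech_index n (Suc p). kdiff N f \<tau> \<in> I"
  define C where "C \<tau> = (if \<tau> \<in> cech_index n (Suc p) then Fract (kdiff N f \<tau>) (var_prod \<tau> ^ N) else 0)" for \<tau>
  have "C \<in> cech_cochains n m I (c, b) (Suc p)"
    unfolding cech_cochains_def loc_part_def
  proof (intro CollectI conjI ballI allI impI)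
    fix \<sigma> assume s: "\<sigma> \<in> cech_index n (Suc p)"
    then have "card \<sigma> = Suc p" by (simp add: cech_index_iff)
    then show "\<exists>g M. C \<sigma> = Fract g (prod var \<sigma> ^ M) \<and>
        g \<in> I \<inter> H (fst (c, b) + int (M * card \<sigma>), snd (c, b))"
      using s df kcochainD[OF kcochain_kdiff[OF f] s]
      by (intro exI[of _ "kdiff N f \<sigma>"] exI[of _ N]) (simp add: C_def var_prod_def)
  qed (simp add: C_def)
  moreover have "cech_diff n (Suc p) C = (\<lambda>\<sigma>. 0)"
  proof
    fix \<sigma> show "cech_diff n (Suc p) C \<sigma> = 0"
    proof (cases "\<sigma> \<in> cech_index n (Suc (Suc p))")
      case True
      have "cech_diff n (Suc p) C \<sigma> = Fract (kdiff N (kdiff N f) \<sigma>) (var_prod \<sigma> ^ N)"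
        by (rule cech_diff_Fract[OF True]) (simp add: C_def)
      then show ?thesis by (simp add: kdiff_kdiff[OF cech_index_finite[OF True]] fract_collapse)
    qed (simp add: cech_diff_def)
  qed
  ultimately have "C \<in> cech_cocycles n m I (c, b) (Suc p)" by (simp add: cech_cocycles_def)
  from local_cohomology_vanishD[OF id van this] obtain e where e: "e \<in> cech_cochains n m I (c, b) p"
    and Ce: "C = cech_diff n p e" .
  have "\<exists>g M. e \<sigma> = Fract g (var_prod \<sigma> ^ M) \<and> g \<in> I \<and> g \<in> H (c + int (M * p), b)" if "\<sigma> \<in> cech_index n p" for \<sigma>
    using e that by (fastforce simp: cech_cochains_def loc_part_def var_prod_def cech_index_iff)
  then obtain g Mf where g: "\<And>\<sigma>. \<sigma> \<in> cech_index n p \<Longrightarrow> e \<sigma> = Fract (g \<sigma>) (var_prod \<sigma> ^ Mf \<sigma>)"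
    "\<And>\<sigma>. \<sigma> \<in> cech_index n p \<Longrightarrow> g \<sigma> \<in> I" "\<And>\<sigma>. \<sigma> \<in> cech_index n p \<Longrightarrow> g \<sigma> \<in> H (c + int (Mf \<sigma> * p), b)"
    by metis
  \<comment> \<open>All fractions are brought to the denominators of the one level \<open>N + M\<close>.\<close>
  define M where "M = Max (Mf ` cech_index n p)"
  have M: "Mf \<sigma> \<le> M" if "\<sigma> \<in> cech_index n p" for \<sigma> using that finite_cech_index by (simp add: M_def)
  define g' where "g' \<sigma> = var_prod \<sigma> ^ (N + M - Mf \<sigma>) * g \<sigma>" for \<sigma>
  have nz: "(var_prod \<sigma> ^ L :: 'a mpol) \<noteq> 0" for \<sigma> L by (simp add: var_prod_nonzero)
  have g'I: "g' \<sigma> \<in> I" if "\<sigma> \<in> cech_index n p" for \<sigma>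
    unfolding g'_def using that
    by (intro ideal_mult[OF id] g(2)[OF that] S_power) (auto simp: var_prod_def cech_index_iff intro!: S_prod x_var_S)
  have g'H: "kcochain p (N + M) c b g'"
    unfolding kcochain_def
  proof
    fix \<sigma> assume s: "\<sigma> \<in> cech_index n p"
    have "Mf \<sigma> * p + (N + M - Mf \<sigma>) * p = (N + M) * p" using M[OF s] by (simp flip: add_mult_distrib)
    then have "c + int (Mf \<sigma> * p) + int ((N + M - Mf \<sigma>) * p) = c + int ((N + M) * p)"
      by (simp only: add.assoc flip: of_nat_add)
    with H_var_prod[OF s g(3)[OF s], of "N + M - Mf \<sigma>"] show "g' \<sigma> \<in> H (c + int ((N + M) * p), b)"
      by (simp only: g'_def)
  qed
  have eg': "e \<sigma> = Fract (g' \<sigma>) (var_prod \<sigma> ^ (N + M))" if s: "\<sigma> \<in> cech_index n p" for \<sigma>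
  proof -
    have "var_prod \<sigma> ^ (N + M) = (var_prod \<sigma> ^ (N + M - Mf \<sigma>) * var_prod \<sigma> ^ Mf \<sigma> :: 'a mpol)"
      using M[OF s] by (simp flip: power_add)
    then show ?thesis unfolding g(1)[OF s] g'_def by (simp only: mult_fract_cancel[OF nz])
  qed
  define F where "F = (\<lambda>\<sigma>. var_prod \<sigma> ^ M * f \<sigma> - g' \<sigma>)"
  have F: "kcochain p (N + M) c b F"
    unfolding F_def by (rule kcochain_diff[OF kcochain_transition[OF f] g'H])
  have zF: "kdiff (N + M) F \<tau> = 0" if t: "\<tau> \<in> cech_index n (Suc p)" for \<tau>
  proof -
    have "Fract (kdiff N f \<tau>) (var_prod \<tau> ^ N) = Fract (kdiff (N + M) g' \<tau>) (var_prod \<tau> ^ (N + M))"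
      using cech_diff_Fract[OF t eg'] t fun_cong[OF Ce, of \<tau>] by (simp add: C_def)
    then have "kdiff N f \<tau> * var_prod \<tau> ^ (N + M) = kdiff (N + M) g' \<tau> * var_prod \<tau> ^ N"
      by (simp only: eq_fract(1)[OF nz nz])
    then have "var_prod \<tau> ^ N * (var_prod \<tau> ^ M * kdiff N f \<tau>) = var_prod \<tau> ^ N * kdiff (N + M) g' \<tau>"
      by (simp only: power_add ac_simps)
    then have "var_prod \<tau> ^ M * kdiff N f \<tau> = kdiff (N + M) g' \<tau>"
      using nz by (simp only: mult_cancel_left) blast
    then show ?thesis by (simp add: F_def kdiff_diff kdiff_transition[OF cech_index_finite[OF t]])
  qed
  have "\<exists>G. kcochain (p - 1) (N + M) c b G \<and> (\<forall>\<sigma>\<in>cech_index n p. F \<sigma> = kdiff (N + M) G \<sigma>)"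
  proof (cases p)
    case 0
    then have "F {} = 0" using zF koszul_exact_0 by blast
    then have "F \<sigma> = kdiff (N + M) (\<lambda>_. 0) \<sigma>" if "\<sigma> \<in> cech_index n p" for \<sigma>
      using that cech_index_finite[OF that] 0 by (simp add: cech_index_iff kdiff_def)
    then show ?thesis by (intro exI[of _ "\<lambda>_. 0"]) (simp add: kcochain_def)
  next
    case (Suc q)
    then show ?thesis using koszul_exact[of q "N + M" c b F] F zF \<open>p \<le> n\<close> by simp
  qed
  then obtain G where G: "kcochain (p - 1) (N + M) c b G" "\<And>\<sigma>. \<sigma> \<in> cech_index n p \<Longrightarrow> F \<sigma> = kdiff (N + M) G \<sigma>"
    by blast
  have "var_prod \<sigma> ^ M * f \<sigma> - kdiff (N + M) G \<sigma> \<in> I" if "\<sigma> \<in> cech_index n p" for \<sigma>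
  proof -
    have "var_prod \<sigma> ^ M * f \<sigma> - kdiff (N + M) G \<sigma> = g' \<sigma>" using G(2)[OF that] by (simp add: F_def algebra_simps)
    then show ?thesis using g'I[OF that] by simp
  qed
  with G(1) show "\<exists>M g. kcochain (p - 1) (N + M) c b g \<and>
      (\<forall>\<sigma>\<in>cech_index n p. var_prod \<sigma> ^ M * f \<sigma> - kdiff (N + M) g \<sigma> \<in> I)" by blast
qed

text \<open>
  Degree \<open>p\<close> for \<open>j + 1\<close> forms rests on the degrees \<open>p\<close> and \<open>p + 1\<close> for \<open>j\<close> forms, the latter with first degree
  lowered by 1; hence the shift \<open>c - int p\<close> and the bound \<open>p + j \<le> n\<close>.
\<close>

lemma kvanish_adjoin_upto:
  fixes I :: "'a::{idom,ring_char_0} mpol set"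
  assumes hom: "hom_ideal I" and l: "\<And>i. i < j \<Longrightarrow> l i \<in> H (1, 0)"
    and reg: "\<And>i. i < j \<Longrightarrow> filter_regular (l i) (adjoin_upto I l i)"
    and van: "\<And>p. p \<le> n \<Longrightarrow> kvanish I p (c - int p) b" and "p + j \<le> n"
  shows "kvanish (adjoin_upto I l j) p (c - int p) b"
  using l reg \<open>p + j \<le> n\<close>
proof (induction j arbitrary: p)
  case (Suc j)
  have "kvanish (adjoin (adjoin_upto I l j) (l j)) p (c - int p) b"
  proof (rule kvanish_adjoin)
    show "hom_ideal (adjoin_upto I l j)" by (rule adjoin_upto_hom_ideal[OF hom]) (simp add: Suc.prems)
    have "kvanish (adjoin_upto I l j) (Suc p) (c - int (Suc p)) b"
      by (rule Suc.IH) (use Suc.prems in auto)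
    then show "kvanish (adjoin_upto I l j) (Suc p) (c - int p - 1) b" by (simp add: algebra_simps)
  qed (use Suc in auto)
  then show ?case by simp
qed (use van in simp)

lemma kvanish_0D:
  assumes "kvanish I 0 c b" "h \<in> H (c, b)" "\<And>j. j \<le> n \<Longrightarrow> var j ^ M * h \<in> I"
  shows "h \<in> I"
proof -
  have "kcochain 0 M c b (\<lambda>_. h)" using assms(2) by (simp add: kcochain_def)
  moreover have "kdiff M (\<lambda>_. h) \<tau> \<in> I" if "\<tau> \<in> cech_index n (Suc 0)" for \<tau>
  proof -
    have "card \<tau> = 1" using that by (simp add: cech_index_iff)
    then obtain j where "\<tau> = {j}" by (rule card_1_singletonE)
    with that have "j \<le> n" by (auto simp: cech_index_iff)
    then show ?thesis using assms(3) \<open>\<tau> = {j}\<close>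
      by (simp add: kdiff_def pos_sign_singleton)
  qed
  ultimately obtain M' g where "\<And>\<sigma>. \<sigma> \<in> cech_index n 0 \<Longrightarrow> var_prod \<sigma> ^ M' * h - kdiff (M + M') g \<sigma> \<in> I"
    using kvanishD[OF assms(1)] by metis
  from this[of "{}"] show ?thesis by (simp add: cech_index_iff var_prod_def kdiff_def)
qed

end

section \<open>Leading monomials and the ascending chain condition\<close>

lemma incseq_subseq:
  fixes f :: "nat \<Rightarrow> nat"
  obtains r where "strict_mono r" "incseq (\<lambda>i. f (r i))"
proof -
  obtain r where r: "strict_mono r" "monoseq (\<lambda>i. f (r i))" using seq_monosub[of f] by blast
  show ?thesis
  proof (cases "incseq (\<lambda>i. f (r i))")
    case True
    then show ?thesis using that r by blast
  next
    case False
    then have dec: "decseq (\<lambda>i. f (r i))" using r(2) by (auto simp: monoseq_iff)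
    obtain N where N: "\<And>i. f (r N) \<le> f (r i)"
      using ex_has_least_nat[of "\<lambda>_. True" _ "\<lambda>i. f (r i)"] by blast
    have "f (r (N + i)) = f (r N)" for i
      using N[of "N + i"] decseqD[OF dec, of N "N + i"] by simp
    then have "incseq (\<lambda>i. f (r (N + i)))" by (simp add: incseq_def)
    moreover have "strict_mono (\<lambda>i. r (N + i))" using r(1) by (simp add: strict_mono_def)
    ultimately show ?thesis using that by blast
  qed
qed

text \<open>
  Passing to a subsequence once for each coordinate makes all coordinates nondecreasing.
\<close>

lemma dickson:
  fixes t :: "nat \<Rightarrow> expo"
  assumes "\<And>i. keys (t i) \<subseteq> {..<K}"
  obtains i j where "i < j" "\<And>k. lookup (t i) k \<le> lookup (t j) k"
proof -
  have "\<exists>r. strict_mono r \<and> (\<forall>k<L. incseq (\<lambda>i. lookup (t (r i)) k))" for L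
  proof (induction L)
    case 0
    show ?case by (rule exI[of _ id]) (simp add: strict_mono_def)
  next
    case (Suc L)
    then obtain r where r: "strict_mono r" "\<And>k. k < L \<Longrightarrow> incseq (\<lambda>i. lookup (t (r i)) k)" by blast
    obtain r' where r': "strict_mono r'" "incseq (\<lambda>i. lookup (t (r (r' i))) L)"
      using incseq_subseq[of "\<lambda>i. lookup (t (r i)) L"] .
    have "incseq (\<lambda>i. lookup (t (r (r' i))) k)" if "k < L" for k
      using r(2)[OF that] strict_mono_leD[OF r'(1)] by (simp add: incseq_def)
    moreover have "strict_mono (\<lambda>i. r (r' i))" using r(1) r'(1) by (simp add: strict_mono_def)
    ultimately show ?case using r'(2) by (intro exI[of _ "\<lambda>i. r (r' i)"]) (auto simp: less_Suc_eq)
  qed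
  then obtain r where r: "strict_mono r" "\<And>k. k < K \<Longrightarrow> incseq (\<lambda>i. lookup (t (r i)) k)" by blast
  have "lookup (t (r 0)) k \<le> lookup (t (r 1)) k" for k
  proof (cases "k < K")
    case True
    then show ?thesis using incseqD[OF r(2)[OF True], of 0 1] by simp
  next
    case False
    then have "k \<notin> keys (t (r 0))" using assms by blast
    then show ?thesis by (simp add: in_keys_iff)
  qed
  moreover have "r 0 < r 1" using r(1) by (simp add: strict_mono_def)
  ultimately show ?thesis using that by blast
qed

lemma expo_le_obtains:
  fixes s t :: expo assumes "\<And>k. lookup s k \<le> lookup t k" obtains u where "t = u + s"
proof
  show "t = (t - s) + s" by (rule poly_mapping_eqI) (simp add: lookup_add lookup_minus assms)
qed

lemma finite_bounded_expos:
  assumes "finite A" shows "finite {t :: expo. keys t \<subseteq> A \<and> (\<forall>k\<in>A. lookup t k \<le> D)}"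
proof (rule finite_imageD[of lookup])
  have "lookup ` {t :: expo. keys t \<subseteq> A \<and> (\<forall>k\<in>A. lookup t k \<le> D)}
      \<subseteq> {f. \<forall>k. (k \<in> A \<longrightarrow> f k \<in> {..D}) \<and> (k \<notin> A \<longrightarrow> f k = 0)}"
    by (auto simp: in_keys_iff subset_iff)
  then show "finite (lookup ` {t :: expo. keys t \<subseteq> A \<and> (\<forall>k\<in>A. lookup t k \<le> D)})"
    by (rule finite_subset) (rule finite_set_of_finite_funs[OF assms], simp)
qed (simp add: inj_on_def)

definition revlex :: "expo \<Rightarrow> expo \<Rightarrow> bool" where
  "revlex s t \<longleftrightarrow> (\<exists>k. lookup t k < lookup s k \<and> (\<forall>j<k. lookup t j = lookup s j))"

lemma revlex_irrefl: "\<not> revlex t t"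
  by (simp add: revlex_def)

lemma revlex_add: "revlex (u + s) (u + t) \<longleftrightarrow> revlex s t"
  by (simp add: revlex_def lookup_add)

lemma revlex_total:
  assumes "s \<noteq> t" shows "revlex s t \<or> revlex t s"
proof -
  define k where "k = (LEAST k. lookup s k \<noteq> lookup t k)"
  have "\<exists>k. lookup s k \<noteq> lookup t k" using assms poly_mapping_eqI[of s t] by auto
  then have k: "lookup s k \<noteq> lookup t k" unfolding k_def by (rule LeastI_ex)
  have eq: "lookup s j = lookup t j" if "j < k" for j
    using not_less_Least that unfolding k_def by blast
  from k consider "lookup t k < lookup s k" | "lookup s k < lookup t k" by linarith
  then show ?thesis
  proof cases
    case 1
    then have "revlex s t" unfolding revlex_def by (intro exI[of _ k]) (simp add: eq)
    then show ?thesis ..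
  next
    case 2
    then have "revlex t s" unfolding revlex_def by (intro exI[of _ k]) (simp add: eq)
    then show ?thesis ..
  qed
qed

lemma revlex_trans:
  assumes "revlex s t" "revlex t u" shows "revlex s u"
proof -
  obtain k where k: "lookup t k < lookup s k" "\<And>j. j < k \<Longrightarrow> lookup t j = lookup s j"
    using assms(1) unfolding revlex_def by blast
  obtain l where l: "lookup u l < lookup t l" "\<And>j. j < l \<Longrightarrow> lookup u j = lookup t j"
    using assms(2) unfolding revlex_def by blast
  have "lookup u (min k l) < lookup s (min k l)"
  proof (cases k l rule: linorder_cases)
    case less
    then show ?thesis using k(1) l(2)[OF less] by (simp add: min_def)
  next
    case equal
    then show ?thesis using k(1) l(1) by simp
  next
    case greater
    then show ?thesis using l(1) k(2)[OF greater] by (simp add: min_def)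
  qed
  moreover have "\<forall>j<min k l. lookup u j = lookup s j" using k(2) l(2) by simp
  ultimately show ?thesis unfolding revlex_def by blast
qed

context bigraded begin

abbreviation drl :: "expo \<Rightarrow> expo \<Rightarrow> bool" where "drl \<equiv> drl_less n m"

definition deg :: "expo \<Rightarrow> nat" where "deg t = xdeg n t + ydeg n m t"

lemma deg_add: "deg (s + t) = deg s + deg t"
  by (simp add: deg_def xdeg_add ydeg_add)

lemma drl_iff: "drl s t \<longleftrightarrow> deg s < deg t \<or> deg s = deg t \<and> revlex s t"
  by (simp add: drl_less_def deg_def revlex_def)

lemma drl_irrefl: "\<not> drl t t"
  by (simp add: drl_iff revlex_irrefl)

lemma drl_total: "s \<noteq> t \<Longrightarrow> drl s t \<or> drl t s"
  unfolding drl_iff using revlex_total[of s t] by linarith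

lemma drl_trans: "drl s t \<Longrightarrow> drl t u \<Longrightarrow> drl s u"
  unfolding drl_iff using revlex_trans[of s t u] by linarith

lemma drl_add: "drl s t \<Longrightarrow> drl (u + s) (u + t)"
  by (simp add: drl_iff deg_add revlex_add)

lemma lookup_le_deg: "t \<in> expos n m \<Longrightarrow> lookup t k \<le> deg t"
proof -
  assume t: "t \<in> expos n m"
  consider "k \<le> n" | "n < k" "k \<le> n + m + 1" | "k > n + m + 1" by linarith
  then show ?thesis
  proof cases
    case 1
    then show ?thesis unfolding deg_def xdeg_def
      by (intro trans_le_add1 member_le_sum) auto
  next
    case 2
    define j where "j = k - (n + 1)"
    have j: "k = n + 1 + j" "j \<in> {..m}" using 2 by (auto simp: j_def)
    show ?thesis unfolding deg_def ydeg_def j(1)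
      by (intro trans_le_add2 member_le_sum[of j "{..m}" "\<lambda>j. lookup t (n + 1 + j)", OF j(2)]) auto
  next
    case 3
    then have "k \<notin> keys t" using t by (auto simp: expos_def)
    then show ?thesis by (simp add: in_keys_iff)
  qed
qed

lemma finite_drl_below: "finite {s \<in> expos n m. drl s t}"
proof (rule finite_subset)
  show "{s \<in> expos n m. drl s t} \<subseteq> {s. keys s \<subseteq> {..n + m + 1} \<and> (\<forall>k\<in>{..n + m + 1}. lookup s k \<le> deg t)}"
    by (auto simp: drl_iff expos_def intro: le_trans[OF lookup_le_deg])
qed (rule finite_bounded_expos, simp)

text \<open>
  The position of a monomial in the order, which lets leading monomials be minimized over the natural
  numbers.
\<close>

definition drl_rank :: "expo \<Rightarrow> nat" where "drl_rank t = card {s \<in> expos n m. drl s t}"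

lemma drl_rank_less:
  assumes "drl s t" "s \<in> expos n m" shows "drl_rank s < drl_rank t"
  unfolding drl_rank_def
proof (rule psubset_card_mono[OF finite_drl_below])
  show "{u \<in> expos n m. drl u s} \<subset> {u \<in> expos n m. drl u t}"
  proof
    show "{u \<in> expos n m. drl u s} \<subseteq> {u \<in> expos n m. drl u t}"
      using drl_trans[OF _ assms(1)] by auto
    show "{u \<in> expos n m. drl u s} \<noteq> {u \<in> expos n m. drl u t}"
      using assms drl_irrefl[of s] by auto
  qed
qed

abbreviation lead :: "'a::comm_ring_1 mpol \<Rightarrow> expo \<Rightarrow> bool" where "lead \<equiv> is_lead_monom n m"

lemma lead_exists:
  assumes "p \<in> S" "p \<noteq> 0" obtains t where "lead p t"
proof -
  have "keys p \<noteq> {}" using assms(2) by simp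
  then obtain t where t: "t \<in> keys p" "\<And>s. s \<in> keys p \<Longrightarrow> drl_rank s \<le> drl_rank t"
    using Max_in[of "drl_rank ` keys p"] Max_ge[of "drl_rank ` keys p"] by fastforce
  have "drl s t" if "s \<in> keys p" "s \<noteq> t" for s
    using drl_total[OF that(2)] drl_rank_less[of t s] t that assms(1) by (force simp: S_iff)
  with t have "lead p t" by (simp add: is_lead_monom_def)
  then show ?thesis by (rule that)
qed

text \<open>
  Suppose that \<open>I\<^sub>0 \<subset> I\<^sub>1 \<subset> \<dots>\<close>, and choose \<open>g\<^sub>i\<close> in \<open>I\<^bsub>i+1\<^esub> - I\<^sub>i\<close> with least leading monomial. By Dickson's lemma
  the leading monomial of some \<open>g\<^sub>i\<close> divides that of a later \<open>g\<^sub>j\<close>. Cancelling the leading term of \<open>g\<^sub>j\<close> with a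
  multiple of \<open>g\<^sub>i\<close> gives an element of \<open>I\<^bsub>j+1\<^esub> - I\<^sub>j\<close> with smaller leading monomial.
\<close>

lemma noetherian: "wf {(J, I). poly_ideal I \<and> poly_ideal J \<and> I \<subset> (J :: 'a::field mpol set)}"
proof (unfold wf_iff_no_infinite_down_chain, safe)
  fix f :: "nat \<Rightarrow> 'a mpol set"
  assume "\<forall>i. (f (Suc i), f i) \<in> {(J, I). poly_ideal I \<and> poly_ideal J \<and> I \<subset> J}"
  then have id: "poly_ideal (f i)" and sub: "f i \<subset> f (Suc i)" for i by auto
  have mono: "f i \<subseteq> f j" if "i \<le> j" for i j using lift_Suc_mono_le[of f i j] sub that by blast
  have "\<exists>p t. p \<in> f (Suc i) - f i \<and> lead p t \<and>
      (\<forall>q s. q \<in> f (Suc i) - f i \<and> lead q s \<longrightarrow> drl_rank t \<le> drl_rank s)" for i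
  proof -
    obtain p where p: "p \<in> f (Suc i) - f i" using sub by blast
    then have "p \<noteq> 0" using ideal_zero[OF id] by auto
    then obtain t where "lead p t" using lead_exists p ideal_sub[OF id] by blast
    with p show ?thesis
      using ex_has_least_nat[of "\<lambda>(p, t). p \<in> f (Suc i) - f i \<and> lead p t" "(p, t)" "\<lambda>(p, t). drl_rank t"]
      by auto
  qed
  then obtain g t where g: "\<And>i. g i \<in> f (Suc i) - f i" "\<And>i. lead (g i) (t i)"
    and least: "\<And>i q s. q \<in> f (Suc i) - f i \<Longrightarrow> lead q s \<Longrightarrow> drl_rank (t i) \<le> drl_rank s"
    by metis
  have gS: "g i \<in> S" for i using g(1) ideal_sub[OF id] by blast
  have texp: "t i \<in> expos n m" for i using gS[of i] g(2)[of i] by (auto simp: S_iff is_lead_monom_def)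
  have "keys (t i) \<subseteq> {..<n + m + 2}" for i using texp[of i] by (auto simp: expos_def)
  then obtain i j where ij: "i < j" "\<And>k. lookup (t i) k \<le> lookup (t j) k"
    by (rule dickson[of t]) blast
  then obtain u where u: "t j = u + t i" using expo_le_obtains by blast
  have uexp: "u \<in> expos n m" using texp[of j] u by (simp add: expos_add)
  define c where "c = lookup (g j) (t j) / lookup (g i) (t i)"
  have nz: "lookup (g i) (t i) \<noteq> 0" using g(2)[of i] by (auto simp: is_lead_monom_def in_keys_iff)
  define q where "q = g j - single u c * g i"
  have "g i \<in> f j" using g(1)[of i] mono[of "Suc i" j] ij(1) by auto
  then have sI: "single u c * g i \<in> f j" by (rule ideal_mult[OF id S_single[OF uexp]])
  then have "single u c * g i \<in> f (Suc j)" using sub by blast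
  then have q1: "q \<in> f (Suc j)" unfolding q_def using g(1)[of j] by (intro ideal_diff[OF id]) auto
  have q2: "q \<notin> f j" using ideal_add[OF id sI, of q] g(1)[of j] by (auto simp: q_def)
  then have "q \<noteq> 0" using ideal_zero[OF id] by auto
  then obtain s where s: "lead q s" using lead_exists q1 ideal_sub[OF id] by blast
  then have sk: "s \<in> keys q" by (simp add: is_lead_monom_def)
  have "lookup (single u c * g i) (t j) = c * lookup (g i) (t i)"
    unfolding u by (rule lookup_single_mult)
  then have "lookup q (t j) = 0" using nz by (simp add: q_def lookup_minus c_def)
  then have "s \<noteq> t j" using sk by (auto simp: in_keys_iff)
  have "s \<in> keys (g j) \<or> s \<in> keys (single u c * g i)"
    using sk keys_diff[of "g j" "single u c * g i"] by (auto simp: q_def)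
  then have "drl s (t j)"
  proof
    assume "s \<in> keys (g j)"
    then show ?thesis using g(2)[of j] \<open>s \<noteq> t j\<close> by (auto simp: is_lead_monom_def)
  next
    assume "s \<in> keys (single u c * g i)"
    then obtain v where v: "s = u + v" "v \<in> keys (g i)"
      using keys_mult[of "single u c" "g i"] by (auto split: if_splits)
    then show ?thesis using g(2)[of i] \<open>s \<noteq> t j\<close> by (auto simp: is_lead_monom_def u drl_add)
  qed
  then have "drl_rank s < drl_rank (t j)"
    using drl_rank_less sk ideal_sub[OF id q1] by (auto simp: S_iff)
  with least[of q j s] q1 q2 s show False by auto
qed

section \<open>Existence of filter-regular linear forms\<close>

lemma colon_ideal:
  fixes I :: "'a::comm_ring_1 mpol set"
  assumes "poly_ideal I" "f \<in> S" shows "poly_ideal {h \<in> S. f * h \<in> I}"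
proof (rule poly_idealI)
  fix s p :: "'a mpol" assume "s \<in> S" "p \<in> {h \<in> S. f * h \<in> I}"
  then show "s * p \<in> {h \<in> S. f * h \<in> I}"
    using ideal_mult[OF assms(1), of s "f * p"] by (simp add: S_mult mult.left_commute)
qed (use ideal_add[OF assms(1)] ideal_zero[OF assms(1)] in \<open>auto simp: S_add distrib_left\<close>)

text \<open>
  The sequence \<open>0 \<longrightarrow> S/(I : f) \<longrightarrow> S/I \<longrightarrow> S/(I,f) \<longrightarrow> 0\<close>: if \<open>l h\<close> is in \<open>I\<close>, a power of each variable moves \<open>h\<close>
  into \<open>(I,f)\<close>, where it is \<open>f q\<close> modulo \<open>I\<close> with \<open>l q\<close> in \<open>I : f\<close>, and a further power moves \<open>q\<close> into \<open>I : f\<close>.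
\<close>

lemma filter_regular_extension:
  assumes id: "poly_ideal I" and f: "f \<in> S" and l: "l \<in> S"
    and r1: "filter_regular l {h \<in> S. f * h \<in> I}" and r2: "filter_regular l (adjoin I f)"
  shows "filter_regular l I"
  unfolding filter_regular_def
proof (intro ballI impI)
  fix h assume h: "h \<in> S" "l * h \<in> I"
  then have "l * h \<in> adjoin I f" by (simp add: adjoin_sup)
  then obtain M where M: "\<And>j. j \<le> n \<Longrightarrow> var j ^ M * h \<in> adjoin I f"
    using r2 h unfolding filter_regular_def by blast
  have "\<exists>M'. var j ^ M' * (var j ^ M * h) \<in> I" if j: "j \<le> n" for j
  proof -
    have vS: "var j ^ L \<in> S" for L by (intro S_power x_var_S j)
    obtain p q where pq: "var j ^ M * h = p + f * q" "p \<in> I" "q \<in> S" using M[OF j] by (auto simp: adjoin_def)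
    have "var j ^ M * (l * h) = l * (p + f * q)" unfolding pq(1)[symmetric] by (rule mult.left_commute)
    then have "f * (l * q) = var j ^ M * (l * h) - l * p" by (simp add: algebra_simps)
    then have "f * (l * q) \<in> I" using ideal_diff[OF id ideal_mult[OF id vS h(2)] ideal_mult[OF id l pq(2)]] by simp
    then have "l * q \<in> {h \<in> S. f * h \<in> I}" using l pq by (simp add: S_mult)
    then obtain M' where "\<And>i. i \<le> n \<Longrightarrow> var i ^ M' * q \<in> {h \<in> S. f * h \<in> I}"
      using r1 pq(3) unfolding filter_regular_def by blast
    then have "f * (var j ^ M' * q) \<in> I" using j by blast
    then have "var j ^ M' * p + f * (var j ^ M' * q) \<in> I" using ideal_add[OF id ideal_mult[OF id vS pq(2)]] by blast
    then show ?thesis unfolding pq(1) by (intro exI[of _ M']) (simp add: algebra_simps)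
  qed
  then obtain M' where M': "\<And>j. j \<le> n \<Longrightarrow> var j ^ M' j * (var j ^ M * h) \<in> I" by metis
  define K where "K = Max (M' ` {..n})"
  have "var j ^ (K + M) * h \<in> I" if "j \<le> n" for j
    using var_power_ideal_mono[OF id that M'[OF that], of K] that
    by (simp add: K_def power_add mult.assoc)
  then show "\<exists>M. \<forall>j\<le>n. var j ^ M * h \<in> I" by blast
qed

text \<open>
  The members of \<open>\<P>\<close> play the part of the associated primes of \<open>I\<close> that do not contain all \<open>x\<^sub>i\<close>. Noetherian
  induction finds them without primary decomposition: a prime ideal serves for itself, and if \<open>f g\<close> lies in
  \<open>I\<close> but neither factor does, then a form that is filter-regular on the strictly larger ideals \<open>I : f\<close> and
  \<open>(I,f)\<close> is so on \<open>I\<close>.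
\<close>

lemma filter_regular_avoid:
  fixes I :: "'a::field mpol set"
  assumes "poly_ideal I"
  shows "\<exists>\<P>. finite \<P> \<and> (\<forall>P\<in>\<P>. poly_ideal P \<and> (\<exists>i\<le>n. var i \<notin> P)) \<and>
           (\<forall>l\<in>S. (\<forall>P\<in>\<P>. l \<notin> P) \<longrightarrow> filter_regular l I)"
  using noetherian assms
proof (induction I rule: wf_induct_rule)
  case (less I)
  note id = \<open>poly_ideal I\<close>
  show ?case
  proof (cases "\<forall>f\<in>S. \<forall>g\<in>S. f * g \<in> I \<longrightarrow> f \<in> I \<or> g \<in> I")
    case True
    show ?thesis
    proof (cases "\<exists>i\<le>n. var i \<notin> I")
      case True': True
      have "filter_regular l I" if "l \<in> S" "l \<notin> I" for l
        using True that unfolding filter_regular_def by (auto intro!: exI[of _ 0])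
      then show ?thesis using id True' by (intro exI[of _ "{I}"]) auto
    next
      case False
      have "var j ^ 1 * h \<in> I" if "h \<in> S" "j \<le> n" for h j
        using ideal_mult[OF id that(1), of "var j"] False that(2) by (simp add: mult.commute)
      then have "filter_regular l I" for l unfolding filter_regular_def by blast
      then show ?thesis by (intro exI[of _ "{}"]) auto
    qed
  next
    case False
    then obtain f g where fg: "f \<in> S" "g \<in> S" "f * g \<in> I" "f \<notin> I" "g \<notin> I" by blast
    let ?Q = "{h \<in> S. f * h \<in> I}"
    have Q: "poly_ideal ?Q" by (rule colon_ideal[OF id fg(1)])
    have A: "poly_ideal (adjoin I f)" by (rule adjoin_ideal[OF id fg(1)])
    have "I \<subseteq> ?Q" using ideal_sub[OF id] ideal_mult[OF id fg(1)] by blast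
    moreover have "g \<in> ?Q" using fg by simp
    ultimately have "I \<subset> ?Q" using fg(5) by blast
    then have "(?Q, I) \<in> {(J, I). poly_ideal I \<and> poly_ideal J \<and> I \<subset> J}" using id Q by simp
    from less.IH[OF this Q] obtain \<P> where
      P: "finite \<P>" "\<forall>P\<in>\<P>. poly_ideal P \<and> (\<exists>i\<le>n. var i \<notin> P)"
        "\<forall>l\<in>S. (\<forall>P\<in>\<P>. l \<notin> P) \<longrightarrow> filter_regular l ?Q" by (elim exE conjE)
    have "f \<in> adjoin I f" using adjoin_mult[OF id S_one, of f] by simp
    then have "I \<subset> adjoin I f" using fg(4) adjoin_sup[of _ I f] by blast
    then have "(adjoin I f, I) \<in> {(J, I). poly_ideal I \<and> poly_ideal J \<and> I \<subset> J}" using id A by simp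
    from less.IH[OF this A] obtain \<P>' where
      P': "finite \<P>'" "\<forall>P\<in>\<P>'. poly_ideal P \<and> (\<exists>i\<le>n. var i \<notin> P)"
        "\<forall>l\<in>S. (\<forall>P\<in>\<P>'. l \<notin> P) \<longrightarrow> filter_regular l (adjoin I f)" by (elim exE conjE)
    have "filter_regular l I" if "l \<in> S" "\<forall>P\<in>\<P> \<union> \<P>'. l \<notin> P" for l
      by (rule filter_regular_extension[OF id fg(1) that(1)]) (use P(3) P'(3) that in blast)+
    then show ?thesis using P(1,2) P'(1,2) by (intro exI[of _ "\<P> \<union> \<P>'"]) auto
  qed
qed

end

section \<open>Choosing the coordinate change\<close>

text \<open>
  All that is needed from a Zariski open set of matrices \<open>A\<close>: a line through one of its points leaves it
  only finitely often. In contrast to the definition by polynomials, this passes easily to the set of inverse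
  matrices.
\<close>

definition line_open :: "(nat \<Rightarrow> nat \<Rightarrow> 'a::field) set \<Rightarrow> bool" where
  "line_open \<O> \<longleftrightarrow> (\<forall>A\<in>\<O>. \<forall>D. finite {s. (\<lambda>i j. A i j + s * D i j) \<notin> \<O>})"

lemma finite_if_subsingleton:
  assumes "\<And>x y. P x \<Longrightarrow> P y \<Longrightarrow> x = y" shows "finite {x. P x}"
proof (cases "\<exists>x. P x")
  case True
  then obtain x where "P x" ..
  then have "{x. P x} \<subseteq> {x}" using assms by blast
  then show ?thesis using finite_subset by blast
qed simp

context bigraded begin

definition x_form :: "(nat \<Rightarrow> 'a::comm_ring_1) \<Rightarrow> 'a mpol" where
  "x_form c = (\<Sum>j\<le>n. single 0 (c j) * var j)"

lemma H_x_form: "x_form c \<in> H (1, 0)"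
  unfolding x_form_def
proof (rule H_sum)
  fix j assume "j \<in> {..n}"
  then show "single 0 (c j) * var j \<in> H (1, 0)"
    using H_mult[OF H_const H_var_power[of j 1], of "c j"] by simp
qed

lemma x_form_add_unit:
  assumes "w \<le> n" shows "x_form (\<lambda>j. c j + s * (if j = w then 1 else 0)) = x_form c + single 0 s * var w"
proof -
  have "x_form (\<lambda>j. c j + s * (if j = w then 1 else 0))
      = (\<Sum>j\<le>n. single 0 (c j) * var j + (if j = w then single 0 s * var w else 0))"
    unfolding x_form_def by (rule sum.cong) (auto simp: single_add distrib_right)
  also have "\<dots> = x_form c + single 0 s * var w"
    using assms by (simp add: sum.distrib x_form_def)
  finally show ?thesis .
qed

text \<open>
  Row \<open>k\<close> is moved in the direction of a variable \<open>x\<^sub>w\<close> outside \<open>P\<close>. An ideal that contains two forms on this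
  line contains \<open>x\<^sub>w\<close> and all forms on the line, so that \<open>P\<close>, and each ideal that was avoided before,
  excludes at most one parameter; \<open>\<O>\<close> excludes finitely many, and the field is infinite.
\<close>

lemma avoid_ideals_in_row:
  fixes \<P> :: "'a::field_char_0 mpol set set"
  assumes \<O>: "line_open \<O>" "A \<in> \<O>" and "finite \<P>"
    and "\<And>P. P \<in> \<P> \<Longrightarrow> poly_ideal P" "\<And>P. P \<in> \<P> \<Longrightarrow> \<exists>i\<le>n. var i \<notin> P"
  shows "\<exists>A'\<in>\<O>. (\<forall>i. i \<noteq> k \<longrightarrow> A' i = A i) \<and> (\<forall>P\<in>\<P>. x_form (A' k) \<notin> P)"
  using \<open>finite \<P>\<close> assms(4,5)
proof (induction \<P> rule: finite_induct)
  case empty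
  show ?case using \<O>(2) by auto
next
  case (insert P F)
  then obtain A' where A': "A' \<in> \<O>" "\<And>i. i \<noteq> k \<Longrightarrow> A' i = A i" "\<And>Q. Q \<in> F \<Longrightarrow> x_form (A' k) \<notin> Q" by auto
  obtain w where w: "w \<le> n" "var w \<notin> P" using insert.prems(2) by blast
  define D :: "nat \<Rightarrow> nat \<Rightarrow> 'a" where "D i j = (if i = k \<and> j = w then 1 else 0)" for i j
  define A'' where "A'' s = (\<lambda>i j. A' i j + s * D i j)" for s
  have A''k: "x_form (A'' s k) = x_form (A' k) + single 0 s * var w" for s
    using x_form_add_unit[OF w(1), of "A' k" s] by (simp add: A''_def D_def)
  have "finite {s. x_form (A'' s k) \<in> Q}" if Q: "Q \<in> insert P F" for Q
  proof (rule finite_if_subsingleton, rule ccontr)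
    fix s s' assume s: "x_form (A'' s k) \<in> Q" "x_form (A'' s' k) \<in> Q" "s \<noteq> s'"
    have id: "poly_ideal Q" using insert.prems(1)[OF Q] .
    have "x_form (A'' s k) - x_form (A'' s' k) = single 0 (s - s') * var w"
      unfolding A''k by (simp add: algebra_simps single_diff)
    then have "single 0 (s - s') * var w \<in> Q" using ideal_diff[OF id s(1,2)] by simp
    then have "single 0 (inverse (s - s')) * (single 0 (s - s') * var w) \<in> Q"
      by (rule ideal_mult[OF id S_const])
    then have v: "var w \<in> Q" using s(3) by (simp add: mult_single flip: mult.assoc)
    then have "x_form (A'' s k) - single 0 s * var w \<in> Q" by (intro ideal_diff[OF id s(1)] ideal_mult[OF id S_const])
    then have "x_form (A' k) \<in> Q" by (simp add: A''k)
    with v show False using Q w(2) A'(3) by blast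
  qed
  then have "finite (\<Union>Q\<in>insert P F. {s. x_form (A'' s k) \<in> Q})" using insert.hyps(1) by blast
  moreover have "finite {s. A'' s \<notin> \<O>}" using \<O>(1) A'(1) unfolding line_open_def A''_def by blast
  ultimately have "finite ({s. A'' s \<notin> \<O>} \<union> (\<Union>Q\<in>insert P F. {s. x_form (A'' s k) \<in> Q}))" by blast
  then obtain s where "s \<notin> {s. A'' s \<notin> \<O>} \<union> (\<Union>Q\<in>insert P F. {s. x_form (A'' s k) \<in> Q})"
    using ex_new_if_finite[OF infinite_UNIV_char_0] by blast
  then have "A'' s \<in> \<O>" "\<forall>Q\<in>insert P F. x_form (A'' s k) \<notin> Q" by auto
  moreover have "A'' s i = A i" if "i \<noteq> k" for i using that A'(2) by (auto simp: A''_def D_def)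
  ultimately show ?case by blast
qed

text \<open>
  The ideal on which the form of row \<open>k\<close> has to be filter-regular involves the rows before \<open>k\<close> only, so the
  rows can be adjusted one after the other.
\<close>

lemma filter_regular_rows_exist:
  fixes I :: "'a::field_char_0 mpol set"
  assumes id: "poly_ideal I" and \<O>: "line_open \<O>" "\<O> \<noteq> {}"
  shows "\<exists>A\<in>\<O>. \<forall>j<k. filter_regular (x_form (A j)) (adjoin_upto I (\<lambda>i. x_form (A i)) j)"
proof (induction k)
  case 0
  then show ?case using \<O>(2) by auto
next
  case (Suc k)
  then obtain A where A: "A \<in> \<O>"
    "\<And>j. j < k \<Longrightarrow> filter_regular (x_form (A j)) (adjoin_upto I (\<lambda>i. x_form (A i)) j)" by blast
  let ?I = "adjoin_upto I (\<lambda>i. x_form (A i)) k"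
  have "poly_ideal ?I" by (rule adjoin_upto_ideal[OF id]) (rule H_S[OF H_x_form])
  from filter_regular_avoid[OF this] obtain \<P> where P: "finite \<P>"
    "\<forall>P\<in>\<P>. poly_ideal P \<and> (\<exists>i\<le>n. var i \<notin> P)"
    "\<forall>l\<in>S. (\<forall>P\<in>\<P>. l \<notin> P) \<longrightarrow> filter_regular l ?I" by (elim exE conjE)
  from avoid_ideals_in_row[OF \<O>(1) A(1) P(1), of k] P(2) obtain A' where
    A': "A' \<in> \<O>" "\<And>i. i \<noteq> k \<Longrightarrow> A' i = A i" "\<And>P. P \<in> \<P> \<Longrightarrow> x_form (A' k) \<notin> P" by blast
  have eq: "adjoin_upto I (\<lambda>i. x_form (A' i)) j = adjoin_upto I (\<lambda>i. x_form (A i)) j" if "j \<le> k" for j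
    by (rule adjoin_upto_cong) (use that A'(2) in simp)
  have "filter_regular (x_form (A' j)) (adjoin_upto I (\<lambda>i. x_form (A' i)) j)" if "j < Suc k" for j
  proof (cases "j = k")
    case True
    have "filter_regular (x_form (A' k)) ?I" using P(3) A'(3) H_S[OF H_x_form, of "A' k"] by blast
    then show ?thesis using True eq[of k] by simp
  next
    case False
    then show ?thesis using that A(2)[of j] A'(2)[of j] eq[of j] by simp
  qed
  with A'(1) show ?case by blast
qed

end

text \<open>
  Rational functions of a parameter whose denominator is a power of \<open>d\<close>.
\<close>

definition frac_fun :: "'a::field poly \<Rightarrow> ('a \<Rightarrow> 'a) \<Rightarrow> bool" where
  "frac_fun d \<phi> \<longleftrightarrow> (\<exists>P k. \<forall>s. poly d s \<noteq> 0 \<longrightarrow> \<phi> s * poly d s ^ k = poly P s)"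

lemma frac_fun_const: "frac_fun d (\<lambda>_. c)"
  unfolding frac_fun_def by (intro exI[of _ "[:c:]"] exI[of _ 0]) simp

lemma frac_fun_add:
  assumes "frac_fun d \<phi>" "frac_fun d \<psi>" shows "frac_fun d (\<lambda>s. \<phi> s + \<psi> s)"
proof -
  obtain P k Q l where PQ: "\<And>s. poly d s \<noteq> 0 \<Longrightarrow> \<phi> s * poly d s ^ k = poly P s"
    "\<And>s. poly d s \<noteq> 0 \<Longrightarrow> \<psi> s * poly d s ^ l = poly Q s" using assms unfolding frac_fun_def by blast
  have "(\<phi> s + \<psi> s) * poly d s ^ (k + l) = poly (P * d ^ l + Q * d ^ k) s" if "poly d s \<noteq> 0" for s
    unfolding poly_add poly_mult poly_power PQ[OF that, symmetric] by (simp add: power_add algebra_simps)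
  then show ?thesis unfolding frac_fun_def by blast
qed

lemma frac_fun_mult:
  assumes "frac_fun d \<phi>" "frac_fun d \<psi>" shows "frac_fun d (\<lambda>s. \<phi> s * \<psi> s)"
proof -
  obtain P k Q l where PQ: "\<And>s. poly d s \<noteq> 0 \<Longrightarrow> \<phi> s * poly d s ^ k = poly P s"
    "\<And>s. poly d s \<noteq> 0 \<Longrightarrow> \<psi> s * poly d s ^ l = poly Q s" using assms unfolding frac_fun_def by blast
  have "(\<phi> s * \<psi> s) * poly d s ^ (k + l) = poly (P * Q) s" if "poly d s \<noteq> 0" for s
    unfolding poly_add poly_mult poly_power PQ[OF that, symmetric] by (simp add: power_add algebra_simps)
  then show ?thesis unfolding frac_fun_def by blast
qed

lemma frac_fun_power: "frac_fun d \<phi> \<Longrightarrow> frac_fun d (\<lambda>s. \<phi> s ^ k)"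
  by (induction k) (auto intro: frac_fun_const frac_fun_mult)

lemma frac_fun_sum: "(\<And>i. i \<in> A \<Longrightarrow> frac_fun d (f i)) \<Longrightarrow> frac_fun d (\<lambda>s. \<Sum>i\<in>A. f i s)"
  by (induction A rule: infinite_finite_induct) (auto intro: frac_fun_const frac_fun_add)

lemma frac_fun_prod: "(\<And>i. i \<in> A \<Longrightarrow> frac_fun d (f i)) \<Longrightarrow> frac_fun d (\<lambda>s. \<Prod>i\<in>A. f i s)"
  by (induction A rule: infinite_finite_induct) (auto intro: frac_fun_const frac_fun_mult)

lemma frac_fun_finite_zeros:
  assumes "frac_fun d \<phi>" "\<phi> s0 \<noteq> 0" "poly d s0 \<noteq> 0"
  shows "finite {s. poly d s = 0 \<or> \<phi> s = 0}"
proof -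
  obtain P k where P: "\<And>s. poly d s \<noteq> 0 \<Longrightarrow> \<phi> s * poly d s ^ k = poly P s"
    using assms(1) unfolding frac_fun_def by blast
  have "poly P s0 \<noteq> 0" using P[OF assms(3)] assms(2,3) by (metis mult_eq_0_iff power_not_zero)
  then have "P \<noteq> 0" "d \<noteq> 0" using assms(3) by auto
  moreover have "{s. poly d s = 0 \<or> \<phi> s = 0} \<subseteq> {s. poly d s = 0} \<union> {s. poly P s = 0}"
  proof
    fix s assume "s \<in> {s. poly d s = 0 \<or> \<phi> s = 0}"
    then show "s \<in> {s. poly d s = 0} \<union> {s. poly P s = 0}" using P[of s] by (cases "poly d s = 0") auto
  qed
  ultimately show ?thesis using finite_subset poly_roots_finite by (metis finite_Un)
qed

definition square_of :: "nat \<Rightarrow> (nat \<Rightarrow> nat \<Rightarrow> 'a) \<Rightarrow> 'a mat" where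
  "square_of k A = mat k k (\<lambda>(i, j). A i j)"

lemma square_of_carrier [simp]: "square_of k A \<in> carrier_mat k k"
  by (simp add: square_of_def)

lemma square_of_index: "M \<in> carrier_mat k k \<Longrightarrow> square_of k (\<lambda>i j. M $$ (i, j)) = M"
  by (intro eq_matI) (auto simp: square_of_def)

definition inv_pair :: "nat \<Rightarrow> 'a::field mat \<Rightarrow> 'a mat \<Rightarrow> bool" where
  "inv_pair k v w \<longleftrightarrow> v \<in> carrier_mat k k \<and> w \<in> carrier_mat k k \<and> v * w = 1\<^sub>m k \<and> w * v = 1\<^sub>m k"

lemma inv_pair_unique:
  assumes "inv_pair k v w" "inv_pair k v w'" shows "w' = w"
proof -
  have c: "v \<in> carrier_mat k k" "w \<in> carrier_mat k k" "w' \<in> carrier_mat k k"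
    and wv: "w * v = 1\<^sub>m k" and vw: "v * w' = 1\<^sub>m k" using assms by (auto simp: inv_pair_def)
  have "w' = (w * v) * w'" using c(3) unfolding wv by (rule left_mult_one_mat[symmetric])
  also have "\<dots> = w * (v * w')" by (rule assoc_mult_mat[OF c(2,1,3)])
  also have "\<dots> = w" unfolding vw by (rule right_mult_one_mat[OF c(2)])
  finally show ?thesis .
qed

lemma inv_pair_invertible: "inv_pair k v w \<Longrightarrow> invertible_mat w"
  by (auto simp: inv_pair_def invertible_mat_def inverts_mat_def)

lemma invertible_inv_pair:
  assumes "w \<in> carrier_mat k k" "invertible_mat w" obtains v where "inv_pair k v w"
proof -
  obtain v where v: "w * v = 1\<^sub>m k" "v * w = 1\<^sub>m (dim_row v)"
    using assms by (auto simp: invertible_mat_def inverts_mat_def)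
  have "dim_col v = k" using arg_cong[OF v(1), of dim_col] by simp
  moreover have "dim_row v = k" using arg_cong[OF v(2), of dim_col] assms(1) by simp
  ultimately show ?thesis using v assms(1) that unfolding inv_pair_def by auto
qed

text \<open>
  The determinant \<open>d\<close> and the adjugate of the pencil \<open>A + s D\<close> are taken over the polynomials in \<open>s\<close>, and
  then evaluated.
\<close>

lemma inverse_along_line:
  fixes A D :: "nat \<Rightarrow> nat \<Rightarrow> 'a::field"
  assumes "inv_pair k (square_of k A) w"
  obtains d :: "'a poly" and W where "poly d 0 \<noteq> 0" "W 0 = w"
    "\<And>s. poly d s \<noteq> 0 \<Longrightarrow> inv_pair k (square_of k (\<lambda>i j. A i j + s * D i j)) (W s)"
    "\<And>i j. i < k \<Longrightarrow> j < k \<Longrightarrow> frac_fun d (\<lambda>s. W s $$ (i, j))"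
proof -
  define M where "M = square_of k (\<lambda>i j. [:A i j, D i j:])"
  define d where "d = det M"
  define W where "W s = inverse (poly d s) \<cdot>\<^sub>m map_mat (\<lambda>p. poly p s) (adj_mat M)" for s
  have M: "M \<in> carrier_mat k k" by (simp add: M_def)
  have ev: "comm_ring_hom (\<lambda>p. poly p s)" for s :: 'a by unfold_locales auto
  have Ms: "map_mat (\<lambda>p. poly p s) M = square_of k (\<lambda>i j. A i j + s * D i j)" for s
    by (rule eq_matI) (auto simp: M_def square_of_def)
  have "det (square_of k A) * det w = 1"
    using assms det_mult[of "square_of k A" k w] by (simp add: inv_pair_def)
  moreover have "det (square_of k A) = poly d 0"
    using comm_ring_hom.hom_det[OF ev, of 0 M] by (simp add: Ms d_def)
  ultimately have d0: "poly d 0 \<noteq> 0" by auto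
  have Winv: "inv_pair k (square_of k (\<lambda>i j. A i j + s * D i j)) (W s)" if s: "poly d s \<noteq> 0" for s
  proof -
    interpret ev: comm_ring_hom "\<lambda>p. poly p s" by (rule ev)
    note adj = adj_mat[OF M]
    have one: "map_mat (\<lambda>p. poly p s) (det M \<cdot>\<^sub>m 1\<^sub>m k) = poly d s \<cdot>\<^sub>m 1\<^sub>m k"
      by (rule eq_matI) (auto simp: d_def)
    have inv1: "inverse (poly d s) \<cdot>\<^sub>m (poly d s \<cdot>\<^sub>m 1\<^sub>m k) = 1\<^sub>m k"
      using s by (intro eq_matI) auto
    have cM: "map_mat (\<lambda>p. poly p s) M \<in> carrier_mat k k"
      and cA: "map_mat (\<lambda>p. poly p s) (adj_mat M) \<in> carrier_mat k k" using M adj(1) by auto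
    have "map_mat (\<lambda>p. poly p s) M * W s = 1\<^sub>m k"
      unfolding W_def mult_smult_distrib[OF cM cA] ev.mat_hom_mult[OF M adj(1), symmetric] adj(2) one inv1 ..
    moreover have "W s * map_mat (\<lambda>p. poly p s) M = 1\<^sub>m k"
      unfolding W_def mult_smult_assoc_mat[OF cA cM] ev.mat_hom_mult[OF adj(1) M, symmetric] adj(3) one inv1 ..
    moreover have "W s \<in> carrier_mat k k" using cA by (simp add: W_def)
    ultimately show ?thesis using cM unfolding inv_pair_def Ms by blast
  qed
  have "W 0 = w" using inv_pair_unique[OF assms, of "W 0"] Winv[OF d0] by simp
  moreover have "frac_fun d (\<lambda>s. W s $$ (i, j))" if "i < k" "j < k" for i j
    unfolding frac_fun_def
  proof (intro exI[of _ "adj_mat M $$ (i, j)"] exI[of _ 1] allI impI)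
    fix s assume "poly d s \<noteq> 0"
    then show "W s $$ (i, j) * poly d s ^ 1 = poly (adj_mat M $$ (i, j)) s"
      using that adj_mat(1)[OF M] by (simp add: W_def)
  qed
  ultimately show ?thesis using that d0 Winv by blast
qed

context bigraded begin

text \<open>
  The forms to be chosen are the rows of \<open>u\<^sup>-\<^sup>1\<close>, while \<open>U\<close> restricts \<open>u\<close>. Along a line of matrices the entries of
  the inverse are rational functions of the parameter, and a polynomial that does not vanish at the
  starting point turns into a nonzero rational function.
\<close>

lemma inverse_rows_line_open:
  fixes U :: "('a::field mat \<times> 'a mat) set"
  assumes "zariski_open n m U"
  shows "line_open {A. \<exists>w. inv_pair (n + 1) (square_of (n + 1) A) w \<and> (w, B) \<in> U}"
  unfolding line_open_def
proof (intro ballI allI)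
  fix A D assume "A \<in> {A. \<exists>w. inv_pair (n + 1) (square_of (n + 1) A) w \<and> (w, B) \<in> U}"
  then obtain w where w: "inv_pair (n + 1) (square_of (n + 1) A) w" "(w, B) \<in> U" by blast
  obtain F where F: "\<forall>p\<in>F. \<forall>t \<in> keys p. keys t \<subseteq> entry_inds n m"
    and U: "U = {u \<in> block_GL n m. \<exists>p\<in>F. eval_entries p u \<noteq> 0}" using assms unfolding zariski_open_def by blast
  obtain p where p: "p \<in> F" "eval_entries p (w, B) \<noteq> 0" and B: "(w, B) \<in> block_GL n m" using w(2) U by auto
  obtain d W where d: "poly d 0 \<noteq> 0" and W0: "W 0 = w"
    and W: "\<And>s. poly d s \<noteq> 0 \<Longrightarrow> inv_pair (n + 1) (square_of (n + 1) (\<lambda>i j. A i j + s * D i j)) (W s)"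
    and fr: "\<And>i j. i < n + 1 \<Longrightarrow> j < n + 1 \<Longrightarrow> frac_fun d (\<lambda>s. W s $$ (i, j))"
    using inverse_along_line[OF w(1), of D] by blast
  have "frac_fun d (\<lambda>s. eval_entries p (W s, B))"
    unfolding eval_entries_def subst_poly_def id_apply
  proof (intro frac_fun_sum frac_fun_mult frac_fun_const frac_fun_prod frac_fun_power)
    fix t v assume "t \<in> keys p" "v \<in> keys t"
    then have "v \<in> entry_inds n m" using F p(1) by blast
    then show "frac_fun d (\<lambda>s. case v of Inl ij \<Rightarrow> fst (W s, B) $$ ij | Inr ij \<Rightarrow> snd (W s, B) $$ ij)"
      using fr by (auto simp: entry_inds_def frac_fun_const)
  qed
  from frac_fun_finite_zeros[OF this _ d] p(2) W0
  have "finite {s. poly d s = 0 \<or> eval_entries p (W s, B) = 0}" by simp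
  moreover have "{s. (\<lambda>i j. A i j + s * D i j) \<notin> {A. \<exists>w. inv_pair (n + 1) (square_of (n + 1) A) w \<and> (w, B) \<in> U}}
      \<subseteq> {s. poly d s = 0 \<or> eval_entries p (W s, B) = 0}"
  proof (rule subsetI, rule ccontr)
    fix s assume s: "s \<in> {s. (\<lambda>i j. A i j + s * D i j) \<notin> {A. \<exists>w. inv_pair (n + 1) (square_of (n + 1) A) w \<and> (w, B) \<in> U}}"
      "s \<notin> {s. poly d s = 0 \<or> eval_entries p (W s, B) = 0}"
    have iv: "inv_pair (n + 1) (square_of (n + 1) (\<lambda>i j. A i j + s * D i j)) (W s)" using W s(2) by simp
    have "(W s, B) \<in> block_GL n m"
      using iv inv_pair_invertible[OF iv] B by (auto simp: block_GL_def inv_pair_def)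
    then have "(W s, B) \<in> U" using s(2) p(1) U by auto
    with iv s(1) show False by blast
  qed
  ultimately show "finite {s. (\<lambda>i j. A i j + s * D i j) \<notin> {A. \<exists>w. inv_pair (n + 1) (square_of (n + 1) A) w \<and> (w, B) \<in> U}}"
    using finite_subset by blast
qed

end

section \<open>Linear substitutions as graded automorphisms\<close>

definition monom_eval :: "('v \<Rightarrow> 'b::comm_monoid_mult) \<Rightarrow> ('v \<Rightarrow>\<^sub>0 nat) \<Rightarrow> 'b" where
  "monom_eval g t = (\<Prod>v\<in>keys t. g v ^ lookup t v)"

lemma monom_eval_superset:
  "finite A \<Longrightarrow> keys t \<subseteq> A \<Longrightarrow> monom_eval g t = (\<Prod>v\<in>A. g v ^ lookup t v)"
  unfolding monom_eval_def by (rule prod.mono_neutral_left) (auto simp: in_keys_iff)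

lemma monom_eval_zero [simp]: "monom_eval g 0 = 1"
  by (simp add: monom_eval_def)

lemma monom_eval_add: "monom_eval g (s + t) = monom_eval g s * monom_eval g t"
proof -
  let ?A = "keys s \<union> keys t"
  have "monom_eval g (s + t) = (\<Prod>v\<in>?A. g v ^ lookup (s + t) v)"
    using keys_add[of s t] by (intro monom_eval_superset) auto
  also have "\<dots> = (\<Prod>v\<in>?A. g v ^ lookup s v) * (\<Prod>v\<in>?A. g v ^ lookup t v)"
    by (simp add: lookup_add power_add prod.distrib)
  finally show ?thesis
    by (simp add: monom_eval_superset[of ?A s] monom_eval_superset[of ?A t])
qed

lemma monom_eval_var: "monom_eval var t = (monom_of t :: 'a::comm_ring_1 mpol)"
proof -
  have "(\<Prod>v\<in>A. var v ^ lookup t v) = (monom_of (\<Sum>v\<in>A. single v (lookup t v)) :: 'a mpol)" if "finite A" for A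
    using that by (induction A rule: finite_induct) (auto simp: var_power monom_of_def mult_single simp flip: single_one)
  from this[OF finite_keys, of t] show ?thesis
    by (simp add: monom_eval_def flip: monom_expansion)
qed

definition subst_vars :: "(nat \<Rightarrow> 'a::comm_ring_1 mpol) \<Rightarrow> 'a mpol \<Rightarrow> 'a mpol" where
  "subst_vars g = subst_poly (single 0) g"

lemma subst_superset:
  fixes g :: "nat \<Rightarrow> 'a::comm_ring_1 mpol"
  assumes "finite A" "keys p \<subseteq> A"
  shows "subst_vars g p = (\<Sum>t\<in>A. single 0 (lookup p t) * monom_eval g t)"
  unfolding subst_vars_def subst_poly_def monom_eval_def[symmetric]
  by (rule sum.mono_neutral_left) (use assms in \<open>auto simp: in_keys_iff\<close>)

lemma subst_add: "subst_vars g (p + q) = subst_vars g p + subst_vars g q"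
proof -
  let ?A = "keys p \<union> keys q"
  have "subst_vars g (p + q) = (\<Sum>t\<in>?A. single 0 (lookup (p + q) t) * monom_eval g t)"
    using keys_add[of p q] by (intro subst_superset) auto
  then show ?thesis
    by (simp add: lookup_add single_add distrib_right sum.distrib subst_superset[of ?A p] subst_superset[of ?A q])
qed

lemma subst_zero [simp]: "subst_vars g 0 = 0"
  by (simp add: subst_vars_def subst_poly_def)

lemma subst_single: "subst_vars g (single t c) = single 0 c * monom_eval g t"
  using subst_superset[of "{t}" "single t c" g] by simp

lemma subst_const [simp]: "subst_vars g (single 0 c) = single 0 c"
  by (simp add: subst_single monom_eval_def)

lemma subst_mult: "subst_vars g (p * q) = subst_vars g p * subst_vars g q"
proof (induction p rule: mpol_induct)
  case (monom t c)
  show ?case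
  proof (induction q rule: mpol_induct)
    case (monom s d)
    have "subst_vars g (single t c * single s d) = single 0 (c * d) * (monom_eval g t * monom_eval g s)"
      by (simp add: mult_single subst_single monom_eval_add)
    also have "single 0 (c * d) = (single 0 c * single 0 d :: 'a mpol)" by (simp add: mult_single)
    finally show ?case by (simp only: subst_single ac_simps)
  qed (simp_all add: subst_add distrib_left)
qed (simp_all add: subst_add distrib_right)

lemma subst_sum: "subst_vars g (sum f A) = (\<Sum>i\<in>A. subst_vars g (f i))"
  by (induction A rule: infinite_finite_induct) (auto simp: subst_add)

lemma subst_one [simp]: "subst_vars g 1 = 1"
  using subst_const[of g 1] by simp

lemma subst_power: "subst_vars g (p ^ k) = subst_vars g p ^ k"
  by (induction k) (auto simp: subst_mult)

lemma subst_prod: "subst_vars g (prod f A) = (\<Prod>i\<in>A. subst_vars g (f i))"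
  by (induction A rule: infinite_finite_induct) (auto simp: subst_mult)

lemma subst_var: "subst_vars g (var k) = g k"
  by (simp add: var_def monom_of_def subst_single monom_eval_def)

lemma subst_monom_eval: "subst_vars g (monom_eval f t) = monom_eval (\<lambda>v. subst_vars g (f v)) t"
  by (simp add: monom_eval_def subst_prod subst_power)

context bigraded begin

lemma subst_inverse:
  assumes "\<And>k. k \<le> n + m + 1 \<Longrightarrow> subst_vars g (f k) = var k" "p \<in> S"
  shows "subst_vars g (subst_vars f p) = p"
proof (induction p rule: mpol_induct)
  case (monom t c)
  have "subst_vars g (subst_vars f (single t c)) = single 0 c * monom_eval (\<lambda>v. subst_vars g (f v)) t"
    by (simp add: subst_single subst_mult subst_monom_eval)
  also have "monom_eval (\<lambda>v. subst_vars g (f v)) t = monom_eval var t"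
    unfolding monom_eval_def using assms monom
    by (intro prod.cong refl arg_cong2[where f = "(^)"] assms(1)) (auto simp: S_iff expos_def subset_iff)
  finally show ?case by (simp add: monom_eval_var flip: single_eq_monom)
qed (simp_all add: subst_add)

lemma H_power: "p \<in> H (a, b) \<Longrightarrow> p ^ k \<in> H (int k * a, int k * b)"
proof (induction k)
  case (Suc k)
  from H_mult[OF Suc.prems Suc.IH[OF Suc.prems]] show ?case by (simp add: algebra_simps)
qed (simp add: H_one)

lemma H_prod:
  assumes "finite A" "\<And>i. i \<in> A \<Longrightarrow> f i \<in> H (a i, b i)"
  shows "prod f A \<in> H (sum a A, sum b A)"
  using assms
proof (induction A rule: finite_induct)
  case (insert x F)
  then show ?case using H_mult[of "f x" "a x" "b x" "prod f F" "sum a F" "sum b F"] by simp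
qed (simp add: H_one)

definition graded_images :: "(nat \<Rightarrow> 'a::comm_ring_1 mpol) \<Rightarrow> bool" where
  "graded_images g \<longleftrightarrow> (\<forall>k\<le>n. g k \<in> H (1, 0)) \<and> (\<forall>k. n < k \<and> k \<le> n + m + 1 \<longrightarrow> g k \<in> H (0, 1))"

lemma monom_eval_H:
  assumes g: "graded_images g" and t: "t \<in> expos n m"
  shows "monom_eval g t \<in> H (bideg n m t)"
proof -
  let ?A = "{..n + m + 1}"
  define dx :: "nat \<Rightarrow> int" where "dx k = (if k \<le> n then 1 else 0)" for k
  define dy :: "nat \<Rightarrow> int" where "dy k = (if k \<le> n then 0 else 1)" for k
  have "(\<Prod>k\<in>?A. g k ^ lookup t k) \<in> H (\<Sum>k\<in>?A. int (lookup t k) * dx k, \<Sum>k\<in>?A. int (lookup t k) * dy k)"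
    using g by (intro H_prod H_power) (auto simp: graded_images_def dx_def dy_def)
  moreover have "(\<Prod>k\<in>?A. g k ^ lookup t k) = monom_eval g t"
    using t by (intro monom_eval_superset[symmetric]) (auto simp: expos_def)
  moreover have "(\<Sum>k\<in>?A. int (lookup t k) * dx k) = int (xdeg n t)"
  proof -
    have "(\<Sum>k\<in>?A. int (lookup t k) * dx k) = (\<Sum>k\<le>n. int (lookup t k) * dx k)"
      by (rule sum.mono_neutral_right) (auto simp: dx_def)
    then show ?thesis by (simp add: xdeg_def dx_def)
  qed
  moreover have "(\<Sum>k\<in>?A. int (lookup t k) * dy k) = int (ydeg n m t)"
  proof -
    have "(\<Sum>k\<in>?A. int (lookup t k) * dy k) = (\<Sum>k\<in>{n+1..n+m+1}. int (lookup t k) * dy k)"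
      by (rule sum.mono_neutral_right) (auto simp: dy_def)
    also have "\<dots> = (\<Sum>j\<le>m. int (lookup t (n + 1 + j)))"
      by (rule sum.reindex_bij_witness[of _ "\<lambda>j. n + 1 + j" "\<lambda>k. k - (n + 1)"]) (auto simp: dy_def)
    finally show ?thesis by (simp add: ydeg_def)
  qed
  ultimately show ?thesis by (simp add: bideg_def)
qed

lemma subst_H:
  assumes g: "graded_images g" and "p \<in> H d" shows "subst_vars g p \<in> H d"
proof (induction p rule: mpol_induct)
  case (monom t c)
  then have "t \<in> expos n m" "bideg n m t = d" using assms(2) by (auto simp: bihom_part_def S_iff)
  with monom_eval_H[OF g this(1)] show ?case
    using H_mult[OF H_const[of c], of "monom_eval g t" "fst d" "snd d"] by (simp add: subst_single)
qed (simp_all add: subst_add H_add)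

lemma subst_bicomp:
  assumes g: "graded_images g" and "p \<in> S"
  shows "bicomp d (subst_vars g p) = subst_vars g (bicomp d p)"
proof (induction p rule: mpol_induct)
  case (monom t c)
  then have t: "single t c \<in> H (bideg n m t)"
    using assms(2) by (auto simp: bihom_part_def S_iff)
  then show ?case using subst_H[OF g t] by (cases "bideg n m t = d") (auto simp: bicomp_id bicomp_other)
qed (simp_all add: subst_add bicomp_add, simp_all add: bicomp_def)

lemma subst_S:
  assumes g: "graded_images g" and "p \<in> S" shows "subst_vars g p \<in> S"
proof (induction p rule: mpol_induct)
  case (monom t c)
  then have "single t c \<in> H (bideg n m t)"
    using assms(2) by (auto simp: bihom_part_def S_iff)
  from H_S[OF subst_H[OF g this]] show ?case .
qed (simp_all add: subst_add S_add)

lemma subst_image_hom_ideal: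
  fixes g f :: "nat \<Rightarrow> 'a::comm_ring_1 mpol"
  assumes g: "graded_images g" and f: "graded_images f" and I: "hom_ideal I"
    and inv: "\<And>p. p \<in> S \<Longrightarrow> subst_vars g (subst_vars f p) = p"
  shows "hom_ideal (subst_vars g ` I)"
proof -
  have id: "poly_ideal I" using I by (simp add: hom_ideal_def)
  have "poly_ideal (subst_vars g ` I)"
  proof (rule poly_idealI)
    show "subst_vars g ` I \<subseteq> S" using subst_S[OF g ideal_sub[OF id]] by blast
    show "0 \<in> subst_vars g ` I" using imageI[OF ideal_zero[OF id], of "subst_vars g"] by simp
  next
    fix p q assume "p \<in> subst_vars g ` I" "q \<in> subst_vars g ` I"
    then show "p + q \<in> subst_vars g ` I" using ideal_add[OF id] by (auto simp flip: subst_add)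
  next
    fix s p :: "'a mpol" assume s: "s \<in> S" and "p \<in> subst_vars g ` I"
    then obtain p' where p': "p = subst_vars g p'" "p' \<in> I" by blast
    have "s * p = subst_vars g (subst_vars f s * p')" by (simp add: subst_mult inv[OF s] p')
    then show "s * p \<in> subst_vars g ` I" using ideal_mult[OF id subst_S[OF f s] p'(2)] by blast
  qed
  moreover have "bicomp d (subst_vars g p) \<in> subst_vars g ` I" if "p \<in> I" for p d
    using subst_bicomp[OF g ideal_sub[OF id that], of d] that I unfolding hom_ideal_def by (metis imageI)
  ultimately show ?thesis unfolding hom_ideal_def by blast
qed

text \<open>
  On the right the forms are multiplied by all of \<open>S\<close>. The right inverse \<open>f\<close> makes the substitution map \<open>S\<close>
  onto itself, so that every such multiple is an image.
\<close>

lemma subst_image_adjoin_upto: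
  fixes g f :: "nat \<Rightarrow> 'a::comm_ring_1 mpol"
  assumes g: "graded_images g" and f: "graded_images f"
    and inv: "\<And>p. p \<in> S \<Longrightarrow> subst_vars g (subst_vars f p) = p"
  shows "subst_vars g ` adjoin_upto I l j = adjoin_upto (subst_vars g ` I) (\<lambda>i. subst_vars g (l i)) j"
proof (induction j)
  case (Suc j)
  have surj: "subst_vars g ` S = S" using subst_S[OF g] subst_S[OF f] inv by (auto simp: image_iff) metis
  have "subst_vars g ` adjoin A k = adjoin (subst_vars g ` A) (subst_vars g k)" for A k
  proof
    show "subst_vars g ` adjoin A k \<subseteq> adjoin (subst_vars g ` A) (subst_vars g k)"
      unfolding adjoin_def using subst_S[OF g] by (auto simp: subst_add subst_mult) blast
    show "adjoin (subst_vars g ` A) (subst_vars g k) \<subseteq> subst_vars g ` adjoin A k"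
    proof
      fix x assume "x \<in> adjoin (subst_vars g ` A) (subst_vars g k)"
      then obtain p q where x: "x = subst_vars g p + subst_vars g k * q" "p \<in> A" "q \<in> S" unfolding adjoin_def by blast
      then obtain q' where "q = subst_vars g q'" "q' \<in> S" using surj by blast
      with x have "x = subst_vars g (p + k * q')" by (simp add: subst_add subst_mult)
      with adjoinI[OF x(2) \<open>q' \<in> S\<close>] show "x \<in> subst_vars g ` adjoin A k" by blast
    qed
  qed
  then show ?case using Suc by simp
qed simp

lemma act_eq: "act n m u = subst_vars (lin_form n m u)"
  by (simp add: act_def subst_vars_def)

lemma lin_form_graded: "graded_images (lin_form n m u)"
  unfolding graded_images_def
proof (intro conjI allI impI)
  fix k assume "k \<le> n"
  then show "lin_form n m u k \<in> H (1, 0)"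
    using H_x_form[of "\<lambda>j. fst u $$ (k, j)"] by (simp add: lin_form_def x_form_def)
next
  fix k assume k: "n < k \<and> k \<le> n + m + 1"
  have "var (n + 1 + j) \<in> H (0, 1)" if "j \<le> m" for j
  proof -
    have "ydeg n m (single (Suc (n + j)) 1) = 1" using that by (simp add: ydeg_def lookup_single when_def)
    moreover have "var (Suc (n + j)) \<in> S" using that by (intro S_var) simp
    ultimately show ?thesis by (auto simp: H_iff var_def monom_of_def xdeg_single)
  qed
  then have "(\<Sum>j\<le>m. single 0 (snd u $$ (k - (n + 1), j)) * var (n + 1 + j)) \<in> H (0, 1)"
    using H_mult[OF H_const] by (intro H_sum) fastforce
  then show "lin_form n m u k \<in> H (0, 1)" using k by (simp add: lin_form_def)
qed

lemma linear_inverse: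
  fixes u v :: "'a::field mat"
  assumes "inv_pair (k + 1) v u" and i: "i \<le> k"
  shows "(\<Sum>j\<le>k. single 0 (v $$ (i, j)) * (\<Sum>l\<le>k. single 0 (u $$ (j, l)) * (X l :: 'a mpol))) = X i"
proof -
  have c: "v \<in> carrier_mat (k + 1) (k + 1)" "u \<in> carrier_mat (k + 1) (k + 1)" and vu: "v * u = 1\<^sub>m (k + 1)"
    using assms by (auto simp: inv_pair_def)
  have ent: "(\<Sum>j\<le>k. v $$ (i, j) * u $$ (j, l)) = (if i = l then 1 else 0)" if "l \<le> k" for l
  proof -
    have "(v * u) $$ (i, l) = (\<Sum>j = 0..<k + 1. v $$ (i, j) * u $$ (j, l))"
      using c i that by (auto simp: scalar_prod_def)
    also have "{0..<k + 1} = {..k}" by auto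
    finally show ?thesis using vu i that by simp
  qed
  have "(\<Sum>j\<le>k. single 0 (v $$ (i, j)) * (\<Sum>l\<le>k. single 0 (u $$ (j, l)) * X l))
      = (\<Sum>j\<le>k. \<Sum>l\<le>k. single 0 (v $$ (i, j) * u $$ (j, l)) * X l)"
    by (simp add: sum_distrib_left mult_single flip: mult.assoc)
  also have "\<dots> = (\<Sum>l\<le>k. \<Sum>j\<le>k. single 0 (v $$ (i, j) * u $$ (j, l)) * X l)" by (rule sum.swap)
  also have "\<dots> = (\<Sum>l\<le>k. single 0 (\<Sum>j\<le>k. v $$ (i, j) * u $$ (j, l)) * X l)"
  proof (rule sum.cong[OF refl])
    fix l
    have "single 0 (sum f A) = (\<Sum>j\<in>A. single 0 (f j) :: 'a mpol)" for f and A :: "nat set"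
      by (induction A rule: infinite_finite_induct) (auto simp: single_add)
    then show "(\<Sum>j\<le>k. single 0 (v $$ (i, j) * u $$ (j, l)) * X l)
        = single 0 (\<Sum>j\<le>k. v $$ (i, j) * u $$ (j, l)) * X l" by (simp add: sum_distrib_right)
  qed
  also have "\<dots> = (\<Sum>l\<le>k. if i = l then X l else 0)"
    by (rule sum.cong[OF refl]) (simp add: ent)
  also have "\<dots> = X i" using i by simp
  finally show ?thesis .
qed

lemma act_lin_form:
  fixes u v :: "'a::field mat \<times> 'a mat"
  assumes "inv_pair (n + 1) (fst v) (fst u)" "inv_pair (m + 1) (snd v) (snd u)" "k \<le> n + m + 1"
  shows "act n m u (lin_form n m v k) = var k"
proof (cases "k \<le> n")
  case True
  have "act n m u (lin_form n m v k) = (\<Sum>j\<le>n. single 0 (fst v $$ (k, j)) * lin_form n m u j)"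
    using True by (simp add: act_eq lin_form_def[of n m v k] subst_sum subst_mult subst_var)
  also have "\<dots> = (\<Sum>j\<le>n. single 0 (fst v $$ (k, j)) * (\<Sum>l\<le>n. single 0 (fst u $$ (j, l)) * var l))"
    by (rule sum.cong) (auto simp: lin_form_def)
  also have "\<dots> = var k" by (rule linear_inverse[OF assms(1) True])
  finally show ?thesis .
next
  case False
  define i where "i = k - (n + 1)"
  have i: "i \<le> m" "k = n + 1 + i" using False assms(3) by (auto simp: i_def)
  have "act n m u (lin_form n m v k) = (\<Sum>j\<le>m. single 0 (snd v $$ (i, j)) * lin_form n m u (n + 1 + j))"
    using False by (simp add: act_eq lin_form_def[of n m v k] subst_sum subst_mult subst_var i_def)
  also have "\<dots> = (\<Sum>j\<le>m. single 0 (snd v $$ (i, j)) * (\<Sum>l\<le>m. single 0 (snd u $$ (j, l)) * var (n + 1 + l)))"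
    by (rule sum.cong) (auto simp: lin_form_def)
  also have "\<dots> = var (n + 1 + i)" by (rule linear_inverse[OF assms(2) i(1)])
  finally show ?thesis by (simp add: i)
qed

lemma act_inverse:
  fixes u v :: "'a::field mat \<times> 'a mat"
  assumes "inv_pair (n + 1) (fst v) (fst u)" "inv_pair (m + 1) (snd v) (snd u)" "p \<in> S"
  shows "act n m u (act n m v p) = p"
  unfolding act_eq using act_lin_form[OF assms(1,2)] unfolding act_eq
  by (rule subst_inverse[OF _ assms(3)])

lemma inv_pair_sym: "inv_pair k v w \<Longrightarrow> inv_pair k w v"
  by (auto simp: inv_pair_def)

end

section \<open>Initial ideals and the reverse lexicographical order\<close>

context bigraded begin

lemma monom_ideal_keys:
  fixes p :: "'a::comm_ring_1 mpol"
  assumes "T \<subseteq> expos n m" "p \<in> genideal (bi_ring n m) (monom_of ` T)" "s \<in> keys p"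
  shows "\<exists>t\<in>T. \<exists>r. s = r + t"
proof -
  let ?M = "{p \<in> S. \<forall>s\<in>keys p. \<exists>t\<in>T. \<exists>r. s = r + t} :: 'a mpol set"
  have "poly_ideal ?M"
  proof (rule poly_idealI)
    fix p q assume "p \<in> ?M" "q \<in> ?M"
    then show "p + q \<in> ?M" using keys_add[of p q] S_add by blast
  next
    fix a p :: "'a mpol" assume a: "a \<in> S" and p: "p \<in> ?M"
    have "\<exists>t\<in>T. \<exists>r. s = r + t" if s: "s \<in> keys (a * p)" for s
    proof -
      obtain u v where "s = u + v" "v \<in> keys p" using keys_mult[of a p] s by blast
      moreover from this p obtain t r where "t \<in> T" "v = r + t" by auto
      ultimately show ?thesis by (intro bexI[of _ t] exI[of _ "u + r"]) (auto simp: add.assoc)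
    qed
    then show "a * p \<in> ?M" using S_mult[OF a] p by simp
  qed auto
  moreover have "monom_of ` T \<subseteq> ?M"
    using assms(1) by (auto simp: monom_of_def intro!: S_single split: if_splits)
      (metis add_0)
  ultimately have "genideal (bi_ring n m) (monom_of ` T) \<subseteq> ?M"
    by (rule ring.genideal_minimal[OF ring_bi_ring])
  then show ?thesis using assms by blast
qed

lemma monoms_S: "T \<subseteq> expos n m \<Longrightarrow> monom_of ` T \<subseteq> S"
  by (auto simp: monom_of_def intro!: S_single)

lemma monom_mult_mem:
  assumes "poly_ideal I" "monom_of t \<in> I" "r \<in> expos n m" shows "monom_of (r + t) \<in> I"
  using ideal_mult[OF assms(1) S_single[OF assms(3), of 1] assms(2)]
  by (simp add: monom_of_def mult_single)

text \<open>
  A generator that divides \<open>t'\<close> is a proper divisor of \<open>e + t'\<close>, written multiplicatively, and makes it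
  redundant.
\<close>

lemma minimal_generator_divisor_notin:
  fixes J :: "'a::comm_ring_1 mpol set"
  assumes "is_minimal_generator n m J (e + t')" "e \<noteq> 0"
  shows "monom_of t' \<notin> J"
proof
  assume t': "monom_of t' \<in> J"
  let ?t = "e + t'"
  obtain G where G: "G \<subseteq> expos n m" "genideal (bi_ring n m) (monom_of ` G) = J"
    "\<And>G'. G' \<subset> G \<Longrightarrow> genideal (bi_ring n m) (monom_of ` G') \<noteq> J" and t: "?t \<in> G"
    using assms(1) unfolding is_minimal_generator_def min_monom_gens_def by blast
  have "t' \<in> keys (monom_of t' :: 'a mpol)" by (simp add: monom_of_def)
  with monom_ideal_keys[OF G(1), of "monom_of t'" t'] t' G(2)
  obtain g r where g: "g \<in> G" "t' = r + g" by blast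
  have "g \<noteq> ?t"
  proof
    assume "g = ?t"
    then have "g = (e + r) + g" using g(2) by (simp add: add.assoc)
    then have "e + r = 0" by (metis add_cancel_left_left)
    then have "lookup e k + lookup r k = 0" for k by (metis lookup_add lookup_zero)
    then have "e = 0" by (intro poly_mapping_eqI) simp
    with assms(2) show False ..
  qed
  let ?G' = "G - {?t}"
  have S': "monom_of ` ?G' \<subseteq> (S :: 'a mpol set)" using monoms_S G(1) by blast
  have id': "poly_ideal (genideal (bi_ring n m) (monom_of ` ?G') :: 'a mpol set)"
    by (rule ring.genideal_ideal[OF ring_bi_ring S'])
  have self: "monom_of ` ?G' \<subseteq> (genideal (bi_ring n m) (monom_of ` ?G') :: 'a mpol set)"
    by (rule ring.genideal_self[OF ring_bi_ring S'])
  have "e + r \<in> expos n m" using t G(1) g(2) by (auto simp: expos_add)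
  then have "monom_of ((e + r) + g) \<in> (genideal (bi_ring n m) (monom_of ` ?G') :: 'a mpol set)"
    using self g(1) \<open>g \<noteq> ?t\<close> by (intro monom_mult_mem[OF id']) auto
  then have "monom_of ?t \<in> (genideal (bi_ring n m) (monom_of ` ?G') :: 'a mpol set)"
    by (simp add: g(2) add.assoc)
  with self have "monom_of ` G \<subseteq> (genideal (bi_ring n m) (monom_of ` ?G') :: 'a mpol set)" by blast
  then have "J \<subseteq> genideal (bi_ring n m) (monom_of ` ?G')"
    unfolding G(2)[symmetric] by (rule ring.genideal_minimal[OF ring_bi_ring id'])
  moreover have "genideal (bi_ring n m) (monom_of ` ?G') \<subseteq> J"
  proof (rule ring.genideal_minimal[OF ring_bi_ring])
    show "poly_ideal J" unfolding G(2)[symmetric]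
      by (rule ring.genideal_ideal[OF ring_bi_ring monoms_S[OF G(1)]])
    show "monom_of ` ?G' \<subseteq> J" unfolding G(2)[symmetric]
      using ring.genideal_self[OF ring_bi_ring monoms_S[OF G(1)]] by blast
  qed
  ultimately show False using G(3)[of ?G'] t by blast
qed

lemma lead_expos: "p \<in> S \<Longrightarrow> lead p t \<Longrightarrow> t \<in> expos n m"
  by (auto simp: is_lead_monom_def S_iff)

text \<open>
  The leading monomials of an ideal are closed under multiplication by monomials, so a monomial that one
  of them divides is itself a leading monomial.
\<close>

lemma monom_in_initial_ideal_iff:
  fixes K :: "'a::comm_ring_1 mpol set"
  assumes id: "poly_ideal K" and t: "t \<in> expos n m"
  shows "monom_of t \<in> initial_ideal n m K \<longleftrightarrow> (\<exists>f\<in>K. lead f t)"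
proof -
  let ?T = "{t. \<exists>f\<in>K. lead f t}"
  have T: "?T \<subseteq> expos n m" using lead_expos ideal_sub[OF id] by blast
  have eq: "{monom_of t | t. \<exists>f\<in>K. lead f t} = (monom_of ` ?T :: 'a mpol set)" by auto
  show ?thesis
  proof
    assume "monom_of t \<in> initial_ideal n m K"
    then have "monom_of t \<in> (genideal (bi_ring n m) (monom_of ` ?T) :: 'a mpol set)"
      unfolding initial_ideal_def eq .
    moreover have "t \<in> keys (monom_of t :: 'a mpol)" by (simp add: monom_of_def)
    ultimately obtain s r where "s \<in> ?T" and s: "t = r + s" using monom_ideal_keys[OF T] by blast
    then obtain f where f: "f \<in> K" "lead f s" by blast
    have r: "r \<in> expos n m" using t s by (simp add: expos_add)
    have "lead (single r 1 * f) t"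
      unfolding is_lead_monom_def
    proof (intro conjI ballI impI)
      have "lookup (single r 1 * f) (r + s) = lookup f s" by (simp add: lookup_single_mult)
      then show "t \<in> keys (single r 1 * f)" using f(2) by (simp add: s is_lead_monom_def in_keys_iff)
      fix v assume "v \<in> keys (single r 1 * f)" "v \<noteq> t"
      then obtain w where "v = r + w" "w \<in> keys f" "w \<noteq> s"
        using keys_mult[of "single r 1" f] s by (auto split: if_splits)
      then show "drl v t" using f(2) by (simp add: s is_lead_monom_def drl_add)
    qed
    with ideal_mult[OF id S_single[OF r] f(1)] show "\<exists>f\<in>K. lead f t" by blast
  next
    assume "\<exists>f\<in>K. lead f t"
    then have "monom_of t \<in> (monom_of ` ?T :: 'a mpol set)" by blast
    then show "monom_of t \<in> initial_ideal n m K"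
      unfolding initial_ideal_def eq using ring.genideal_self[OF ring_bi_ring monoms_S[OF T]] by blast
  qed
qed

lemma adjoin_upto_mult_mem:
  assumes "poly_ideal I" "\<And>i. i < j \<Longrightarrow> l i \<in> S" "k < j" "q \<in> S"
  shows "l k * q \<in> adjoin_upto I l j"
  using assms(2,3)
proof (induction j)
  case (Suc j)
  have "poly_ideal (adjoin_upto I l j)" by (rule adjoin_upto_ideal[OF assms(1)]) (simp add: Suc.prems)
  then show ?case using Suc adjoin_mult[OF _ assms(4), of "adjoin_upto I l j" "l j"]
    by (cases "k = j") (auto intro: adjoin_sup)
qed simp

lemma adjoin_upto_repr:
  assumes "z \<in> adjoin_upto I l j"
  shows "\<exists>p\<in>I. \<exists>q. (\<forall>k<j. q k \<in> S) \<and> z = p + (\<Sum>k<j. l k * q k)"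
  using assms
proof (induction j arbitrary: z)
  case (Suc j)
  then obtain z' q' where z: "z = z' + l j * q'" "z' \<in> adjoin_upto I l j" "q' \<in> S" by (auto simp: adjoin_def)
  from Suc.IH[OF z(2)] obtain p q where "p \<in> I" "\<forall>k<j. q k \<in> S" "z' = p + (\<Sum>k<j. l k * q k)" by blast
  then show ?case using z
    by (intro bexI[of _ p] exI[of _ "q(j := q')"]) (auto simp: less_Suc_eq add.assoc)
qed auto

lemma x_ideal_mem:
  assumes id: "poly_ideal K" and "i \<le> n + 1" "p \<in> S" "\<And>t. t \<in> keys p \<Longrightarrow> \<exists>k<i. lookup t k \<noteq> 0"
  shows "p \<in> adjoin_upto K var i"
proof -
  have vS: "var k \<in> S" if "k < i" for k using that assms(2) by (intro x_var_S) simp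
  have aid: "poly_ideal (adjoin_upto K var i)" by (rule adjoin_upto_ideal[OF id vS])
  show ?thesis
  proof (induction p rule: mpol_induct)
    case (monom t c)
    then obtain k where k: "k < i" "lookup t k \<noteq> 0" using assms(4) by blast
    then have "\<exists>s. t = single k 1 + s" unfolding single_le_iff by simp
    then obtain s where s: "t = single k 1 + s" by blast
    then have "s \<in> expos n m" using monom assms(3) by (auto simp: S_iff expos_add)
    then have "var k * single s c \<in> adjoin_upto K var i"
      by (intro adjoin_upto_mult_mem[OF id vS k(1)] S_single)
    moreover have "var k * single s c = single t c" by (simp add: s var_def monom_of_def mult_single)
    ultimately show ?case by simp
  qed (auto simp: ideal_zero[OF aid] intro: ideal_add[OF aid])
qed

text \<open>
  Since \<open>t\<close> involves no \<open>x\<^sub>k\<close> with \<open>k < i\<close>, a smaller monomial of the same bidegree either involves such an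
  \<open>x\<^sub>k\<close> or is divisible by \<open>x\<^sub>i\<close>. The monomials of the first kind are discarded from \<open>f\<close>, and what remains is
  \<open>x\<^sub>i h\<close>. Conversely, a monomial that involves such an \<open>x\<^sub>k\<close> is smaller than every monomial of its degree that
  involves none. So \<open>h\<close> and the element \<open>g\<close> of \<open>K\<close> that the colon condition provides, which agree on monomials
  without such \<open>x\<^sub>k\<close>, have the same leading monomial.
\<close>

lemma revlex_colon:
  fixes K :: "'a::comm_ring_1 mpol set"
  assumes K: "hom_ideal K" and i: "i \<le> n" and low: "\<And>k. k < i \<Longrightarrow> lookup t k = 0" and ti: "lookup t i \<noteq> 0"
    and f: "f \<in> K" "lead f t" and t: "t = single i 1 + t'" and bid: "bideg n m t = (a, b)"
    and colon: "\<And>h. h \<in> H (a - 1, b) \<Longrightarrow> var i * h \<in> adjoin_upto K var i \<Longrightarrow> h \<in> adjoin_upto K var i"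
  shows "\<exists>g\<in>K. lead g t'"
proof -
  have id: "poly_ideal K" using K by (simp add: hom_ideal_def)
  have vS: "var k \<in> S" if "k < i" for k using that i by (intro x_var_S) simp
  have aid: "poly_ideal (adjoin_upto K var i)" by (rule adjoin_upto_ideal[OF id vS])
  define f' where "f' = bicomp (a, b) f"
  have f'K: "f' \<in> K" using K f(1) unfolding f'_def hom_ideal_def by blast
  have f'H: "f' \<in> H (a, b)" unfolding f'_def by (rule bicomp_H[OF ideal_sub[OF id f(1)]])
  have f't: "t \<in> keys f'" using f(2) bid by (simp add: f'_def bicomp_def keys_part is_lead_monom_def)
  have f's: "drl s t" if "s \<in> keys f'" "s \<noteq> t" for s
    using f(2) that by (simp add: f'_def bicomp_def keys_part is_lead_monom_def)
  have dg: "deg s = deg t" if "s \<in> keys f'" for s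
    using that f'H f't unfolding H_iff deg_def by (metis of_nat_eq_iff)
  \<comment> \<open>The monomials outside \<open>(x\<^sub>0,\<dots>,x\<^bsub>i-1\<^esub>)\<close>.\<close>
  define P where "P s \<longleftrightarrow> (\<forall>k<i. lookup s k = 0)" for s :: expo
  have Pi: "1 \<le> lookup s i" if s: "s \<in> keys (part P f')" for s
  proof (cases "s = t")
    case True
    then show ?thesis using ti by simp
  next
    case False
    have s': "s \<in> keys f'" "P s" using s by (auto simp: keys_part)
    then have "revlex s t" using f's[OF _ False] dg[of s] by (simp add: drl_iff)
    then obtain k where k: "lookup t k < lookup s k" "\<forall>j<k. lookup t j = lookup s j" unfolding revlex_def by blast
    have "\<not> k < i" using k(1) s'(2) unfolding P_def by (metis not_less_zero)
    then show ?thesis using k ti by (cases "k = i") auto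
  qed
  define h where "h = quot i 1 (part P f')"
  have vh: "var i * h = part P f'" using var_power_mult_quot[of "part P f'" 1 i] Pi by (simp add: h_def)
  have pH: "part P f' \<in> H (a, b)" using f'H by (auto simp: H_iff keys_part S_part)
  have hH: "h \<in> H (a - 1, b)" unfolding h_def using H_quot[OF i pH, of 1] by simp
  have split: "f' = part P f' + part (\<lambda>s. \<not> P s) f'"
    by (rule poly_mapping_eqI) (simp add: lookup_add lookup_part when_def)
  have "part (\<lambda>s. \<not> P s) f' \<in> adjoin_upto K var i"
    using i by (intro x_ideal_mem[OF id] S_part H_S[OF f'H]) (auto simp: keys_part P_def)
  moreover have "f' \<in> adjoin_upto K var i"
    using f'K by (induction i) (auto intro: adjoin_sup)
  ultimately have "f' - part (\<lambda>s. \<not> P s) f' \<in> adjoin_upto K var i" by (intro ideal_diff[OF aid])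
  moreover have "f' - part (\<lambda>s. \<not> P s) f' = var i * h" using split vh by (metis add_diff_cancel_right')
  ultimately have "var i * h \<in> adjoin_upto K var i" by simp
  then have "h \<in> adjoin_upto K var i" by (rule colon[OF hH])
  then obtain p q where p: "p \<in> K" and q: "\<forall>k<i. q k \<in> S" and hpq: "h = p + (\<Sum>k<i. var k * q k)"
    using adjoin_upto_repr by blast
  define r where "r = (\<Sum>k<i. var k * q k)"
  have rP: "\<not> P s" if s: "s \<in> keys r" for s
  proof -
    obtain k where k: "k < i" "s \<in> keys (var k * q k)" using s keys_sum[of "\<lambda>k. var k * q k" "{..<i}"] unfolding r_def by blast
    then obtain w where "s = single k 1 + w"
      using keys_mult[of "var k" "q k"] by (auto simp: var_def monom_of_def split: if_splits)
    then show ?thesis using k(1) unfolding P_def by (auto simp: lookup_add)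
  qed
  define g where "g = bicomp (a - 1, b) p"
  have gK: "g \<in> K" using K p unfolding g_def hom_ideal_def by blast
  have hg: "h = g + bicomp (a - 1, b) r"
    using bicomp_id[OF hH] hpq by (metis bicomp_add g_def r_def)
  have eqP: "lookup g s = lookup h s" if "P s" for s
  proof -
    have "s \<notin> keys (bicomp (a - 1, b) r)" using rP that by (auto simp: bicomp_def keys_part)
    then show ?thesis by (simp add: hg lookup_add in_keys_iff)
  qed
  have tP: "P t" using low by (simp add: P_def)
  have Pt': "P t'" unfolding P_def
  proof (intro allI impI)
    fix k assume "k < i"
    then show "lookup t' k = 0" using low[of k] by (simp add: t lookup_add lookup_single)
  qed
  have "lookup h t' = lookup f' t" using tP by (simp add: h_def lookup_quot lookup_part t)
  then have "t' \<in> keys g" using eqP[OF Pt'] f't by (simp add: in_keys_iff)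
  moreover have "drl s t'" if s: "s \<in> keys g" "s \<noteq> t'" for s
  proof (cases "P s")
    case True
    then have "lookup h s \<noteq> 0" using eqP s(1) by (simp add: in_keys_iff)
    then have "single i 1 + s \<in> keys f'" by (auto simp: h_def lookup_quot lookup_part in_keys_iff)
    then have "drl (single i 1 + s) (single i 1 + t')" using f's[of "single i 1 + s"] s(2) by (simp add: t)
    then show ?thesis by (simp add: drl_iff deg_add revlex_add)
  next
    case False
    have "g \<in> H (a - 1, b)" unfolding g_def by (rule bicomp_H[OF ideal_sub[OF id p]])
    then have "deg s = deg t'" using s(1) \<open>t' \<in> keys g\<close> unfolding H_iff deg_def by (metis of_nat_eq_iff)
    moreover have "revlex s t'"
    proof -
      define k where "k = (LEAST k. lookup s k \<noteq> 0)"
      from False obtain k0 where k0: "k0 < i" "lookup s k0 \<noteq> 0" unfolding P_def by blast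
      have "lookup s k \<noteq> 0" unfolding k_def by (rule LeastI[of _ k0]) (rule k0(2))
      moreover have "k < i" using Least_le[of "\<lambda>k. lookup s k \<noteq> 0" k0] k0 by (simp add: k_def)
      moreover have "lookup s j = 0" if "j < k" for j using not_less_Least that unfolding k_def by blast
      ultimately show ?thesis using Pt' unfolding revlex_def P_def by (intro exI[of _ k]) simp
    qed
    ultimately show ?thesis by (simp add: drl_iff)
  qed
  ultimately have "lead g t'" by (simp add: is_lead_monom_def)
  with gK show ?thesis by blast
qed

text \<open>
  If \<open>x\<^sub>i h\<close> lies in \<open>(K,x\<^sub>0,\<dots>,x\<^bsub>i-1\<^esub>)\<close>, then the preimage \<open>h'\<close> of \<open>h\<close> under \<open>u\<close> satisfies the same with \<open>I\<close> and
  the forms \<open>l\<^sub>i = u\<^sup>-\<^sup>1 x\<^sub>i\<close>. Filter-regularity makes \<open>h'\<close> a torsion element modulo \<open>(I,l\<^sub>0,\<dots>,l\<^bsub>i-1\<^esub>)\<close>, hence zero by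
  the vanishing of cohomology in degree 0. The second block of \<open>u\<close> is left as it is in some element of \<open>U\<close>.
\<close>

lemma generic_colon:
  fixes I :: "'a::field_char_0 mpol set"
  assumes I: "hom_ideal I" and U: "zariski_open n m U" "U \<noteq> {}"
    and van: "\<And>p. p \<le> n \<Longrightarrow> kvanish I p (c - int p) b"
  shows "\<exists>u\<in>U. hom_ideal (act n m u ` I) \<and>
    (\<forall>i\<le>n. \<forall>h\<in>H (c, b). var i * h \<in> adjoin_upto (act n m u ` I) var i \<longrightarrow> h \<in> adjoin_upto (act n m u ` I) var i)"
proof -
  have id: "poly_ideal I" using I by (simp add: hom_ideal_def)
  have UGL: "U \<subseteq> block_GL n m" using U(1) by (auto simp: zariski_open_def)
  obtain u0 B where "(u0, B) \<in> U" using U(2) by (metis ex_in_conv surj_pair)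
  then have GL: "u0 \<in> carrier_mat (n + 1) (n + 1)" "invertible_mat u0"
    "B \<in> carrier_mat (m + 1) (m + 1)" "invertible_mat B" using UGL by (auto simp: block_GL_def)
  obtain v0 where v0: "inv_pair (n + 1) v0 u0" using invertible_inv_pair[OF GL(1,2)] .
  obtain B' where B': "inv_pair (m + 1) B' B" using invertible_inv_pair[OF GL(3,4)] .
  let ?O = "{A. \<exists>w. inv_pair (n + 1) (square_of (n + 1) A) w \<and> (w, B) \<in> U}"
  have "square_of (n + 1) (\<lambda>i j. v0 $$ (i, j)) = v0" by (rule square_of_index) (use v0 in \<open>simp add: inv_pair_def\<close>)
  then have "(\<lambda>i j. v0 $$ (i, j)) \<in> ?O" using v0 \<open>(u0, B) \<in> U\<close> by auto
  then have "?O \<noteq> {}" by blast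
  from filter_regular_rows_exist[OF id inverse_rows_line_open[OF U(1)] this, of "n + 1"]
  obtain A w where A: "\<And>j. j < n + 1 \<Longrightarrow> filter_regular (x_form (A j)) (adjoin_upto I (\<lambda>i. x_form (A i)) j)"
    and w: "inv_pair (n + 1) (square_of (n + 1) A) w" "(w, B) \<in> U" by blast
  \<comment> \<open>\<open>?v\<close> is the inverse of \<open>?u\<close>, and its first rows give the forms \<open>?l i\<close>.\<close>
  let ?u = "(w, B)" and ?v = "(square_of (n + 1) A, B')"
  let ?l = "\<lambda>i. x_form (A i)"
  let ?\<phi> = "act n m ?u" and ?\<psi> = "act n m ?v"
  have inv1: "?\<phi> (?\<psi> p) = p" if "p \<in> S" for p using act_inverse[of ?v ?u p] w(1) B' that by simp
  have inv2: "?\<psi> (?\<phi> p) = p" if "p \<in> S" for p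
    using act_inverse[of ?u ?v p] inv_pair_sym[OF w(1)] inv_pair_sym[OF B'] that by simp
  have l: "?\<phi> (?l i) = var i" if "i \<le> n" for i
  proof -
    have "lin_form n m ?v i = ?l i" using that by (simp add: lin_form_def x_form_def square_of_def)
    then show ?thesis using act_lin_form[of ?v ?u i] w(1) B' that by simp
  qed
  have K: "hom_ideal (?\<phi> ` I)"
    unfolding act_eq by (rule subst_image_hom_ideal[OF lin_form_graded lin_form_graded I])
      (rule inv1[unfolded act_eq])
  have adj: "?\<phi> ` adjoin_upto I ?l i = adjoin_upto (?\<phi> ` I) var i" if "i \<le> n" for i
  proof -
    have "?\<phi> ` adjoin_upto I ?l i = adjoin_upto (?\<phi> ` I) (\<lambda>i. ?\<phi> (?l i)) i"
      unfolding act_eq by (rule subst_image_adjoin_upto[OF lin_form_graded lin_form_graded])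
        (rule inv1[unfolded act_eq])
    also have "\<dots> = adjoin_upto (?\<phi> ` I) var i" by (rule adjoin_upto_cong) (use l that in simp)
    finally show ?thesis .
  qed
  have "h \<in> adjoin_upto (?\<phi> ` I) var i"
    if i: "i \<le> n" and h: "h \<in> H (c, b)" and vh: "var i * h \<in> adjoin_upto (?\<phi> ` I) var i" for i h
  proof -
    define h' where "h' = ?\<psi> h"
    have h'H: "h' \<in> H (c, b)" unfolding h'_def act_eq by (rule subst_H[OF lin_form_graded h])
    have hh': "?\<phi> h' = h" unfolding h'_def by (rule inv1[OF H_S[OF h]])
    have lS: "?l i \<in> S" for i by (rule H_S[OF H_x_form])
    have aid: "poly_ideal (adjoin_upto I ?l i)" by (rule adjoin_upto_ideal[OF id lS])
    have "?\<phi> (?l i * h') = var i * h" using l[OF i] hh' by (simp add: act_eq subst_mult)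
    then obtain z where z: "z \<in> adjoin_upto I ?l i" "?\<phi> (?l i * h') = ?\<phi> z" using vh unfolding adj[OF i, symmetric] by auto
    then have "?l i * h' = z" using inv2[OF S_mult[OF lS H_S[OF h'H]]] inv2[OF ideal_sub[OF aid z(1)]] by metis
    then have "?l i * h' \<in> adjoin_upto I ?l i" using z(1) by simp
    then obtain M where M: "\<forall>j\<le>n. var j ^ M * h' \<in> adjoin_upto I ?l i"
      using A[of i] i H_S[OF h'H] unfolding filter_regular_def by auto
    have "kvanish (adjoin_upto I ?l i) 0 (c - int 0) b"
      by (rule kvanish_adjoin_upto[OF I H_x_form A van]) (use i in auto)
    then have "h' \<in> adjoin_upto I ?l i" by (intro kvanish_0D[OF _ h'H]) (use M in auto)
    then show ?thesis unfolding adj[OF i, symmetric] hh'[symmetric] by (rule imageI)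
  qed
  with K w(2) show ?thesis by blast
qed

end

text \<open>
  The colon condition is needed in the bidegree \<open>(a' - 1, b')\<close> of \<open>t' = t / x\<^sub>i\<close> only. The cohomology of
  \<open>I\<close> in degree \<open>p + 1\<close> then enters in bidegree \<open>(a' - 1 - p, b')\<close>, which the regularity region covers
  because \<open>a' - 1 - p \<ge> a - (p + 1) + 1\<close>.
\<close>

theorem theorem5p2:
  fixes n m :: nat
    and I J :: "'a::field_char_0 mpol set"
    and a b a' b' :: int
  assumes "bihom_ideal n m I"
    and "is_bigin n m I J"
    and "(a, b) \<in> x_reg n m I"
    and "a > 0" and "b \<ge> 0"
    and "a' \<ge> a + 1" and "b' \<ge> b"
  shows "\<not> (\<exists>t. is_minimal_generator n m J t \<and> bideg n m t = (a', b'))"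
proof
  interpret bigraded n m .
  assume "\<exists>t. is_minimal_generator n m J t \<and> bideg n m t = (a', b')"
  then obtain t where t: "is_minimal_generator n m J t" "bideg n m t = (a', b')" by blast
  have I: "hom_ideal I" by (rule bihom_ideal_imp_hom_ideal[OF assms(1)])
  then have id: "poly_ideal I" by (simp add: hom_ideal_def)
  obtain U where U: "zariski_open n m U" "U \<noteq> {}" "\<And>u. u \<in> U \<Longrightarrow> initial_ideal n m (act n m u ` I) = J"
    using assms(2) unfolding is_bigin_def by blast
  have van: "kvanish I p (a' - 1 - int p) b'" if "p \<le> n" for p
  proof (rule kvanish_of_local_cohomology[OF id that])
    have "\<forall>i\<ge>1. \<forall>c d. c \<ge> a - int i + 1 \<and> d \<ge> b \<longrightarrow>
       local_cohomology n m I i (c, d) = {cech_coboundaries n m I (c, d) i}"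
      using assms(3) by (simp add: x_reg_def)
    then show "local_cohomology n m I (Suc p) (a' - 1 - int p, b') = {cech_coboundaries n m I (a' - 1 - int p, b') (Suc p)}"
      using assms(6,7) by simp
  qed
  obtain u where u: "u \<in> U" and K: "hom_ideal (act n m u ` I)"
    and colon: "\<And>i h. i \<le> n \<Longrightarrow> h \<in> H (a' - 1, b') \<Longrightarrow>
      var i * h \<in> adjoin_upto (act n m u ` I) var i \<Longrightarrow> h \<in> adjoin_upto (act n m u ` I) var i"
    using generic_colon[OF I U(1,2) van] by blast
  have Kid: "poly_ideal (act n m u ` I)" using K by (simp add: hom_ideal_def)
  obtain G where G: "G \<subseteq> expos n m" "genideal (bi_ring n m) (monom_of ` G) = J" "t \<in> G"
    using t(1) unfolding is_minimal_generator_def min_monom_gens_def by blast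
  have texp: "t \<in> expos n m" using G by blast
  have "monom_of t \<in> J" unfolding G(2)[symmetric]
    using ring.genideal_self[OF ring_bi_ring monoms_S[OF G(1)]] G(3) by blast
  then obtain f where f: "f \<in> act n m u ` I" "lead f t"
    using monom_in_initial_ideal_iff[OF Kid texp] U(3)[OF u] by auto
  have "xdeg n t \<noteq> 0" using t(2) assms(4,6) by (auto simp: bideg_def)
  then have "\<exists>i. i \<le> n \<and> lookup t i \<noteq> 0" by (auto simp: xdeg_def)
  then obtain i where i: "i \<le> n" "lookup t i \<noteq> 0" "\<And>k. k < i \<Longrightarrow> \<not> (k \<le> n \<and> lookup t k \<noteq> 0)"
    using exists_least_iff[of "\<lambda>i. i \<le> n \<and> lookup t i \<noteq> 0"] by blast
  then have low: "lookup t k = 0" if "k < i" for k using that by auto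
  have "\<exists>t'. t = single i 1 + t'" unfolding single_le_iff using i(2) by simp
  then obtain t' where t': "t = single i 1 + t'" by blast
  have "\<exists>g\<in>act n m u ` I. lead g t'"
    by (rule revlex_colon[OF K i(1) low i(2) f t' t(2) colon[OF i(1)]])
  moreover have "t' \<in> expos n m" using texp unfolding t' expos_add by simp
  ultimately have "monom_of t' \<in> J"
    using monom_in_initial_ideal_iff[OF Kid] U(3)[OF u] by auto
  moreover have "monom_of t' \<notin> J"
    by (rule minimal_generator_divisor_notin[of J "single i 1"]) (use t(1) t' in \<open>auto simp flip: keys_eq_empty\<close>)
  ultimately show False by blast
qed

end
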